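(* Let $\mathcal M=\mathbb R$ or $\mathbb T$ and $s<0$. Then, for any $T>0$, the solution map $\Phi:u_0\in H^s(\mathcal M)\mapsto u\in C([0,T];H^s(\mathcal M))$ to the BBM equation $$\partial_tu-\partial_{xxt}u+\partial_xu+\tfrac12\partial_x(u^2)=0,\qquad u|_{t=0}=u_0,$$ is discontinuous everywhere in $H^s(\mathcal M)$. That is, any map $\Phi:H^s(\mathcal M)\to C([0,T];H^s(\mathcal M))$ which assigns to each smooth $u_0$ the corresponding smooth solution on $[0,T]$ is discontinuous at every point of $H^s(\mathcal M)$.
   Context: $\mathbb T=\mathbb R/(2\pi\mathbb Z)$. All data and solutions are real-valued, so $H^s(\mathcal M)$ denotes real-valued distributions. Smooth data means $u_0\in\bigcap_{\sigma}H^\sigma(\mathcal M)$; for such data the BBM equation has a unique global solution in $\bigcap_\sigma C([0,\infty);H^\sigma(\mathcal M))$ (known, since the equation is globally well-posed in $H^\sigma(\mathcal M)$ for all $\sigma\ge0$). *)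

theory Defs
  imports "HOL-Analysis.Analysis"
begin

text \<open>The spatial domain. Functions on the torus \<open>\<real>/(2\<pi>\<int>)\<close> are represented by
  \<open>2\<pi>\<close>-periodic functions on \<open>\<real>\<close>.\<close>

datatype domain = Real_Line | Torus

definition D_x :: "(real \<Rightarrow> 'a::real_normed_vector) \<Rightarrow> real \<Rightarrow> 'a" where
  "D_x f = (\<lambda>x. vector_derivative f (at x))"

definition smooth_fun :: "(real \<Rightarrow> 'a::real_normed_vector) \<Rightarrow> bool" where
  "smooth_fun f \<longleftrightarrow> (\<forall>n x. ((D_x ^^ n) f) differentiable (at x))"


section \<open>Distributions\<close>

text \<open>Test functions: Schwartz functions on the line, smooth periodic functions on the torus.\<close>

fun test_fun :: "domain \<Rightarrow> (real \<Rightarrow> complex) set" where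
  "test_fun Real_Line =
     {\<phi>. smooth_fun \<phi> \<and> (\<forall>k n. \<exists>C. \<forall>x. \<bar>x\<bar> ^ k * cmod ((D_x ^^ n) \<phi> x) \<le> C)}"
| "test_fun Torus = {\<phi>. smooth_fun \<phi> \<and> (\<forall>x. \<phi> (x + 2 * pi) = \<phi> x)}"

fun test_seminorm :: "domain \<Rightarrow> nat \<Rightarrow> (real \<Rightarrow> complex) \<Rightarrow> real" where
  "test_seminorm Real_Line N \<phi> =
     (\<Sum>k\<le>N. \<Sum>n\<le>N. SUP x. \<bar>x\<bar> ^ k * cmod ((D_x ^^ n) \<phi> x))"
| "test_seminorm Torus N \<phi> = (\<Sum>n\<le>N. SUP x. cmod ((D_x ^^ n) \<phi> x))"

type_synonym dist_fun = "(real \<Rightarrow> complex) \<Rightarrow> complex"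

text \<open>Real-valued (tempered, resp. periodic) distributions. They are extended by \<open>0\<close>
  outside the test functions, so that HOL equality is equality of distributions.\<close>

definition real_distribution :: "domain \<Rightarrow> dist_fun \<Rightarrow> bool" where
  "real_distribution M u \<longleftrightarrow>
     (\<forall>\<phi>\<in>test_fun M. \<forall>\<psi>\<in>test_fun M. u (\<lambda>x. \<phi> x + \<psi> x) = u \<phi> + u \<psi>) \<and>
     (\<forall>\<phi>\<in>test_fun M. \<forall>c. u (\<lambda>x. c * \<phi> x) = c * u \<phi>) \<and>
     (\<exists>C N. \<forall>\<phi>\<in>test_fun M. cmod (u \<phi>) \<le> C * test_seminorm M N \<phi>) \<and>
     (\<forall>\<phi>\<in>test_fun M. u (\<lambda>x. cnj (\<phi> x)) = cnj (u \<phi>)) \<and>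
     (\<forall>\<phi>. \<phi> \<notin> test_fun M \<longrightarrow> u \<phi> = 0)"

text \<open>The distribution \<open>u\<close> is given by the real function \<open>U\<close>. Integrability is required
  explicitly because the integral of a non-integrable function is \<open>0\<close> by convention.\<close>

definition fun_domain :: "domain \<Rightarrow> real set" where
  "fun_domain M = (case M of Real_Line \<Rightarrow> UNIV | Torus \<Rightarrow> {0..2 * pi})"

definition represents :: "domain \<Rightarrow> (real \<Rightarrow> real) \<Rightarrow> dist_fun \<Rightarrow> bool" where
  "represents M U u \<longleftrightarrow>
     (M = Torus \<longrightarrow> (\<forall>x. U (x + 2 * pi) = U x)) \<and>
     (\<forall>\<phi>\<in>test_fun M.
        set_integrable lborel (fun_domain M) (\<lambda>x. complex_of_real (U x) * \<phi> x) \<and>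
        u \<phi> = (LINT x:fun_domain M|lborel. complex_of_real (U x) * \<phi> x))"


section \<open>Sobolev spaces\<close>

definition fourier :: "(real \<Rightarrow> complex) \<Rightarrow> real \<Rightarrow> complex" where
  "fourier \<phi> \<xi> = (LINT x|lborel. cis (- (\<xi> * x)) * \<phi> x)"

text \<open>The Fourier transform of \<open>u\<close>, defined by \<open>\<langle>\<F>u, \<phi>\<rangle> = \<langle>u, \<F>\<phi>\<rangle>\<close>, is the function \<open>g\<close>;
  such a \<open>g\<close> is unique up to null sets.\<close>

definition has_fourier :: "dist_fun \<Rightarrow> (real \<Rightarrow> complex) \<Rightarrow> bool" where
  "has_fourier u g \<longleftrightarrow> g \<in> borel_measurable lborel \<and>
     (\<forall>\<phi>\<in>test_fun Real_Line. integrable lborel (\<lambda>\<xi>. g \<xi> * \<phi> \<xi>) \<and>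
        u (fourier \<phi>) = (LINT \<xi>|lborel. g \<xi> * \<phi> \<xi>))"

definition fourier_coeff :: "dist_fun \<Rightarrow> int \<Rightarrow> complex" where
  "fourier_coeff u k = u (\<lambda>x. cis (- (of_int k * x))) / complex_of_real (2 * pi)"

fun sobolev :: "domain \<Rightarrow> real \<Rightarrow> dist_fun set" where
  "sobolev Real_Line s = {u. real_distribution Real_Line u \<and>
     (\<exists>g. has_fourier u g \<and> integrable lborel (\<lambda>\<xi>. (1 + \<xi>\<^sup>2) powr s * (cmod (g \<xi>))\<^sup>2))}"
| "sobolev Torus s = {u. real_distribution Torus u \<and>
     (\<lambda>k::int. (1 + (of_int k)\<^sup>2) powr s * (cmod (fourier_coeff u k))\<^sup>2) summable_on UNIV}"

fun sobolev_norm :: "domain \<Rightarrow> real \<Rightarrow> dist_fun \<Rightarrow> real" where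
  "sobolev_norm Real_Line s u =
     (let g = (SOME g. has_fourier u g)
      in sqrt (LINT \<xi>|lborel. (1 + \<xi>\<^sup>2) powr s * (cmod (g \<xi>))\<^sup>2))"
| "sobolev_norm Torus s u =
     sqrt (\<Sum>\<^sub>\<infinity>k::int. (1 + (of_int k)\<^sup>2) powr s * (cmod (fourier_coeff u k))\<^sup>2)"

definition sobolev_dist :: "domain \<Rightarrow> real \<Rightarrow> dist_fun \<Rightarrow> dist_fun \<Rightarrow> real" where
  "sobolev_dist M s u v = sobolev_norm M s (\<lambda>\<phi>. u \<phi> - v \<phi>)"

definition smooth_data :: "domain \<Rightarrow> dist_fun set" where
  "smooth_data M = (\<Inter>\<sigma>. sobolev M \<sigma>)"

text \<open>The space \<open>C([0,T]; H\<^sup>s)\<close> and its distance. Curves are total functions of time whose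
  values outside \<open>[0,T]\<close> play no role.\<close>

definition sobolev_curves :: "domain \<Rightarrow> real \<Rightarrow> real \<Rightarrow> (real \<Rightarrow> dist_fun) set" where
  "sobolev_curves M s T = {u. (\<forall>t\<in>{0..T}. u t \<in> sobolev M s) \<and>
     (\<forall>t\<in>{0..T}. ((\<lambda>\<tau>. sobolev_dist M s (u \<tau>) (u t)) \<longlongrightarrow> 0) (at t within {0..T}))}"

definition curve_dist ::
  "domain \<Rightarrow> real \<Rightarrow> real \<Rightarrow> (real \<Rightarrow> dist_fun) \<Rightarrow> (real \<Rightarrow> dist_fun) \<Rightarrow> real" where
  "curve_dist M s T u v = (SUP t\<in>{0..T}. sobolev_dist M s (u t) (v t))"


section \<open>The BBM equation\<close>

text \<open>Classical form of \<open>\<partial>\<^sub>t U - \<partial>\<^sub>x\<^sub>x\<^sub>t U + \<partial>\<^sub>x U + \<partial>\<^sub>x (U\<^sup>2) / 2 = 0\<close>; time derivatives are one-sided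
  at the end points of \<open>[0,T]\<close>.\<close>

definition bbm_classical :: "real \<Rightarrow> (real \<Rightarrow> real \<Rightarrow> real) \<Rightarrow> bool" where
  "bbm_classical T U \<longleftrightarrow> (\<forall>t\<in>{0..T}. smooth_fun (U t) \<and>
     (\<forall>x. \<exists>U_t U_xxt.
        ((\<lambda>\<tau>. U \<tau> x) has_real_derivative U_t) (at t within {0..T}) \<and>
        ((\<lambda>\<tau>. D_x (D_x (U \<tau>)) x) has_real_derivative U_xxt) (at t within {0..T}) \<and>
        U_t - U_xxt + D_x (U t) x + 1 / 2 * D_x (\<lambda>y. (U t y)\<^sup>2) x = 0))"

definition bbm_smooth_solution :: "domain \<Rightarrow> real \<Rightarrow> dist_fun \<Rightarrow> (real \<Rightarrow> dist_fun) \<Rightarrow> bool" where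
  "bbm_smooth_solution M T u\<^sub>0 u \<longleftrightarrow>
     u \<in> (\<Inter>\<sigma>. sobolev_curves M \<sigma> T) \<and> u 0 = u\<^sub>0 \<and>
     (\<exists>U. (\<forall>t\<in>{0..T}. represents M (U t) (u t)) \<and> bbm_classical T U)"

end

theory Submission
  imports Defs "HOL-Probability.Characteristic_Functions" "HOL-Probability.Sinc_Integral"
    "HOL-Library.Periodic_Fun"
begin

text \<open>
  Interactions of high frequencies feed the low ones. For \<open>s < 0\<close> a wave \<open>h\<close> of fixed
  amplitude \<open>\<mu>\<close> and frequency about \<open>N\<close> tends to \<open>0\<close> in \<open>H\<^sup>s\<close> as \<open>N \<rightarrow> \<infinity>\<close>, but \<open>h\<^sup>2\<close>
  has a low-frequency part of size \<open>\<mu>\<^sup>2\<close> that does not depend on \<open>N\<close>, and this part moves the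
  solution.

  Let \<open>u\<^sub>0\<close> be a point of continuity of \<open>\<Phi>\<close>. Every neighbourhood of \<open>u\<^sub>0\<close> contains data
  \<open>w + h\<close>, where \<open>w\<close> is smooth and fixed and \<open>h\<close> is a wave of arbitrarily large amplitude
  \<open>\<mu>\<close>. Write the solution as \<open>h + z\<close> and look at the time \<open>t = K / \<mu>\<^sup>2\<close>. The operator
  \<open>\<partial>\<^sub>x (1 - \<partial>\<^sub>x\<^sup>2)\<^sup>-\<^sup>1\<close> is bounded in the sup norm (\<open>elliptic_sup_bound\<close>), so a bootstrap
  argument keeps \<open>z\<close> bounded up to the time \<open>t\<close>, uniformly in \<open>\<mu>\<close> and \<open>N\<close>
  (\<open>bbm_bootstrap\<close>). In the flux \<open>u + u\<^sup>2 / 2\<close> all terms except \<open>h\<^sup>2 / 2\<close> are then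
  \<open>O(\<mu>)\<close>, and their effect up to time \<open>t\<close> is \<open>O(1 / \<mu>)\<close>. Tested against \<open>\<psi> - \<psi>''\<close>, the
  displacement of the solution is therefore \<open>(t / 2) \<integral> h\<^sup>2 \<psi>' + O(1 / \<mu>)\<close>
  (\<open>bbm_pairing_growth\<close>), and for a suitable \<open>\<psi>\<close> this is at least \<open>c K / 2 - O(1 / \<mu>)\<close> with
  \<open>c > 0\<close> depending only on the domain (\<open>resonant_test_Real_Line\<close>, \<open>resonant_test_Torus\<close>).
  Continuity at \<open>u\<^sub>0\<close> bounds the displacement by a constant that does not depend on \<open>K\<close>,
  because pairing with \<open>\<psi> - \<psi>''\<close> is continuous in \<open>H\<^sup>s\<close>. For large \<open>K\<close> this is a
  contradiction.

  Both domains are handled at once by a measure on the frequencies: Lebesgue measure for the line,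
  counting measure on the integers for the torus. A distribution in a Sobolev space has a transform,
  unique up to null sets, whose weighted \<open>L\<^sup>2\<close> norm is the Sobolev norm
  (\<open>sobolev_norm_transform\<close>); a function that represents the distribution is synthesised from the
  transform (\<open>representation_by_synthesis\<close>); and symmetric, rapidly decaying transforms yield smooth data
  (\<open>smooth_data_of_transform\<close>). On the line this rests on Fourier inversion for Schwartz functions
  and on the fact that a function orthogonal to them vanishes; on the torus it rests on the
  uniqueness of Fourier coefficients of continuous functions.
\<close>

section \<open>Boundedness and growth for the BBM equation\<close>

text \<open>The function \<open>exp (- x) * (A x + S)\<close> is nonincreasing and tends to \<open>0\<close> at infinity.\<close>

lemma linear_ode_bounded_lower:
  fixes A G :: "real \<Rightarrow> real"
  assumes A: "\<And>x. (A has_real_derivative A x + G x) (at x)"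
    and bdd: "\<And>x. \<bar>A x\<bar> \<le> B" and G: "\<And>x. G x \<le> S"
  shows "- S \<le> A x"
proof -
  define E where "E = (\<lambda>x. exp (- x) * (A x + S))"
  have E': "(E has_real_derivative exp (- x) * (G x - S)) (at x)" for x
    unfolding E_def by (rule derivative_eq_intros A refl | simp add: algebra_simps)+
  have "antimono E"
  proof (rule antimonoI)
    fix x y :: real assume "x \<le> y"
    then show "E y \<le> E x"
    proof (rule DERIV_nonpos_imp_nonincreasing)
      show "\<exists>d. (E has_real_derivative d) (at z) \<and> d \<le> 0" for z
        using E'[of z] G[of z] by (intro exI conjI) (auto simp: mult_nonneg_nonpos)
    qed
  qed
  moreover have "(E \<longlongrightarrow> 0) at_top"
  proof (rule Lim_null_comparison)
    show "\<forall>\<^sub>F x in at_top. norm (E x) \<le> exp (- x) * (B + \<bar>S\<bar>)"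
      unfolding E_def norm_mult
      by (intro always_eventually allI) (use bdd in \<open>auto intro!: order_trans[OF abs_triangle_ineq] add_right_mono\<close>)
    have "((\<lambda>x. exp (- x)) \<longlongrightarrow> (0::real)) at_top"
      by (rule filterlim_compose[OF exp_at_bot filterlim_uminus_at_bot_at_top])
    then show "((\<lambda>x. exp (- x) * (B + \<bar>S\<bar>)) \<longlongrightarrow> 0) at_top"
      by (rule tendsto_mult_left_zero)
  qed
  ultimately have "0 \<le> E x"
    by (intro tendsto_upperbound[of E 0 at_top "E x"])
       (auto simp: eventually_at_top_linorder antimono_def intro!: exI[of _ x])
  then show ?thesis
    by (simp add: E_def zero_le_mult_iff)
qed

lemma linear_ode_bounded:
  fixes A G :: "real \<Rightarrow> real"
  assumes A: "\<And>x. (A has_real_derivative A x + G x) (at x)"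
    and bdd: "\<And>x. \<bar>A x\<bar> \<le> B" and G: "\<And>x. \<bar>G x\<bar> \<le> S"
  shows "\<bar>A x\<bar> \<le> S"
proof -
  have "- S \<le> A x"
    by (rule linear_ode_bounded_lower[OF A bdd]) (use G in \<open>auto simp: abs_le_iff\<close>)
  moreover have "- S \<le> - A x"
    by (rule linear_ode_bounded_lower[of "\<lambda>x. - A x" "\<lambda>x. - G x" B])
       (use DERIV_minus[OF A] bdd G in \<open>auto simp: abs_le_iff\<close>)
  ultimately show ?thesis by auto
qed

text \<open>The equation \<open>q - q'' = - \<Gamma>'\<close> is factored into first-order equations: with
  \<open>p = q' - \<Gamma>\<close> one has \<open>p' = q\<close>, so \<open>q + p\<close> and the reflection of \<open>q - p\<close> are bounded
  solutions of \<open>A' = A \<plusminus> \<Gamma>\<close>. This bounds \<open>\<partial>\<^sub>x (1 - \<partial>\<^sub>x\<^sup>2)\<^sup>-\<^sup>1\<close> on \<open>L\<^sup>\<infinity>\<close> and avoids its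
  convolution kernel.\<close>

lemma elliptic_sup_bound:
  fixes p q \<Gamma> :: "real \<Rightarrow> real"
  assumes q: "\<And>x. (q has_real_derivative p x + \<Gamma> x) (at x)"
    and p: "\<And>x. (p has_real_derivative q x) (at x)"
    and pB: "\<And>x. \<bar>p x\<bar> \<le> B" and qB: "\<And>x. \<bar>q x\<bar> \<le> B'" and \<Gamma>: "\<And>x. \<bar>\<Gamma> x\<bar> \<le> S"
  shows "\<bar>q x\<bar> \<le> S"
proof -
  have *: "\<bar>q x + p x\<bar> \<le> S"
  proof (rule linear_ode_bounded[of "\<lambda>x. q x + p x" \<Gamma> "B' + B"])
    show "((\<lambda>x. q x + p x) has_real_derivative q y + p y + \<Gamma> y) (at y)" for y
      using DERIV_add[OF q[of y] p[of y]] by (simp add: add_ac)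
    show "\<bar>q y + p y\<bar> \<le> B' + B" for y
      using pB[of y] qB[of y] by linarith
  qed (rule \<Gamma>)
  let ?R = "\<lambda>x. q (- x) - p (- x)"
  have R': "(?R has_real_derivative ?R y + - \<Gamma> (- y)) (at y)" for y
    using DERIV_diff[OF q[of "- y", unfolded DERIV_mirror] p[of "- y", unfolded DERIV_mirror]]
    by (simp add: algebra_simps)
  have RB: "\<bar>?R y\<bar> \<le> B' + B" for y
    using pB[of "- y"] qB[of "- y"] by linarith
  have "\<bar>?R (- x)\<bar> \<le> S"
    using R' RB by (rule linear_ode_bounded[where A = ?R and G = "\<lambda>y. - \<Gamma> (- y)"]) (simp_all add: \<Gamma>)
  with * show ?thesis by simp
qed

text \<open>At the first time where \<open>g\<close> reaches \<open>M\<close> the step would give a strict inequality.\<close>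

lemma bootstrap_principle:
  fixes g :: "real \<Rightarrow> real"
  assumes cont: "continuous_on {0..t} g" and g0: "g 0 < M"
    and step: "\<And>s. s \<in> {0..t} \<Longrightarrow> (\<And>\<tau>. \<tau> \<in> {0..s} \<Longrightarrow> g \<tau> \<le> M) \<Longrightarrow> g s < M"
    and s: "s \<in> {0..t}"
  shows "g s < M"
proof (rule ccontr)
  assume "\<not> g s < M"
  define C where "C = {0..t} \<inter> g -` {M..}"
  have "closed C"
    using continuous_closed_preimage[OF cont, of "{M..}"] by (simp add: C_def)
  moreover have "bounded C"
    by (rule bounded_subset[of "{0..t}"]) (auto simp: C_def)
  ultimately have "compact C" by (simp add: compact_eq_bounded_closed)
  moreover have "s \<in> C" using s \<open>\<not> g s < M\<close> by (auto simp: C_def)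
  ultimately obtain r where r: "r \<in> C" "\<And>\<tau>. \<tau> \<in> C \<Longrightarrow> r \<le> \<tau>"
    using compact_attains_inf[of C] by blast
  have cr: "continuous_on {0..r} g"
    by (rule continuous_on_subset[OF cont]) (use r in \<open>auto simp: C_def\<close>)
  obtain r' where r': "0 \<le> r'" "r' \<le> r" "g r' = M"
    using IVT'[of g 0 M r] r g0 cr by (auto simp: C_def)
  have "r' \<in> C" using r r' by (auto simp: C_def)
  with r r' have "g r = M" by fastforce
  have "g r < M"
  proof (rule step)
    show "r \<in> {0..t}" using r by (auto simp: C_def)
    fix \<tau> assume \<tau>: "\<tau> \<in> {0..r}"
    show "g \<tau> \<le> M"
    proof (cases "\<tau> = r")
      case False
      then have "\<tau> \<notin> C" using r(2)[of \<tau>] \<tau> by auto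
      then show ?thesis using \<tau> r(1) by (auto simp: C_def)
    qed (simp add: \<open>g r = M\<close>)
  qed
  then show False using \<open>g r = M\<close> by simp
qed

lemma smooth_fun_has_derivative:
  assumes "smooth_fun f"
  shows "((D_x ^^ n) f has_vector_derivative (D_x ^^ Suc n) f x) (at x)"
  using assms by (simp add: smooth_fun_def D_x_def vector_derivative_works)

definition bbm_flux :: "(real \<Rightarrow> real \<Rightarrow> real) \<Rightarrow> real \<Rightarrow> real \<Rightarrow> real" where
  "bbm_flux U t x = U t x + (U t x)\<^sup>2 / 2"

definition bbm_impulse :: "(real \<Rightarrow> real \<Rightarrow> real) \<Rightarrow> real \<Rightarrow> real \<Rightarrow> real" where
  "bbm_impulse U t x = integral {0..t} (\<lambda>\<tau>. bbm_flux U \<tau> x)"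

text \<open>Integrating the equation in time for fixed \<open>x\<close> gives
  \<open>(1 - \<partial>\<^sub>x\<^sup>2) (U t - U 0) = - \<partial>\<^sub>x \<Gamma>\<close>, where \<open>\<Gamma>\<close> is the impulse. The gauge integral
  integrates any time derivative, so the equation may be used pointwise; joint continuity
  serves to differentiate the impulse under the integral.\<close>

lemma bbm_time_integrated:
  assumes bbm: "bbm_classical T U"
    and U: "continuous_on ({0..T} \<times> UNIV) (\<lambda>(t, x). U t x)"
    and Ux: "continuous_on ({0..T} \<times> UNIV) (\<lambda>(t, x). D_x (U t) x)"
    and t: "t \<in> {0..T}"
  shows "((\<lambda>x. D_x (U t) x - D_x (U 0) x - bbm_impulse U t x)
           has_real_derivative U t x - U 0 x) (at x)"
proof -
  have sm: "smooth_fun (U \<tau>)" if "\<tau> \<in> {0..T}" for \<tau>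
    using bbm that by (auto simp: bbm_classical_def)
  have d1: "(U \<tau> has_real_derivative D_x (U \<tau>) x) (at x)" if "\<tau> \<in> {0..T}" for \<tau> x
    using smooth_fun_has_derivative[OF sm[OF that], of 0 x]
    by (simp add: has_real_derivative_iff_has_vector_derivative)
  have d2: "(D_x (U \<tau>) has_real_derivative D_x (D_x (U \<tau>)) x) (at x)" if "\<tau> \<in> {0..T}" for \<tau> x
    using smooth_fun_has_derivative[OF sm[OF that], of 1 x]
    by (simp add: has_real_derivative_iff_has_vector_derivative)
  define Fx where "Fx = (\<lambda>x \<tau>. D_x (U \<tau>) x + U \<tau> x * D_x (U \<tau>) x)"
  have sq: "D_x (\<lambda>y. (U \<tau> y)\<^sup>2) x = 2 * U \<tau> x * D_x (U \<tau>) x" if "\<tau> \<in> {0..T}" for \<tau> x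
    unfolding D_x_def
    by (rule vector_derivative_at, subst has_real_derivative_iff_has_vector_derivative[symmetric])
       (use d1[OF that] in \<open>auto intro!: derivative_eq_intros simp: D_x_def\<close>)
  have contU: "continuous_on (UNIV \<times> {0..t}) (\<lambda>(x, \<tau>). U \<tau> x)"
    using continuous_on_compose2[OF U continuous_on_swap[of "UNIV \<times> {0..t}"]] t
    by (force simp: case_prod_unfold)
  have contUx: "continuous_on (UNIV \<times> {0..t}) (\<lambda>(x, \<tau>). D_x (U \<tau>) x)"
    using continuous_on_compose2[OF Ux continuous_on_swap[of "UNIV \<times> {0..t}"]] t
    by (force simp: case_prod_unfold)
  have imp: "(bbm_impulse U t has_real_derivative integral {0..t} (Fx x)) (at x)"
  proof -
    have "((\<lambda>x. integral (cbox 0 t) (\<lambda>\<tau>. bbm_flux U \<tau> x)) has_real_derivative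
           integral (cbox 0 t) (Fx x)) (at x within UNIV)"
    proof (rule leibniz_rule_field_derivative)
      show "((\<lambda>x. bbm_flux U \<tau> x) has_real_derivative Fx x \<tau>) (at x within UNIV)"
        if "\<tau> \<in> cbox 0 t" for x \<tau>
      proof -
        have "\<tau> \<in> {0..T}" using that t by auto
        then show ?thesis unfolding bbm_flux_def Fx_def
          by (auto intro!: derivative_eq_intros d1)
      qed
      show "(\<lambda>\<tau>. bbm_flux U \<tau> x) integrable_on cbox 0 t" for x
      proof -
        have "continuous_on {0..t} (\<lambda>\<tau>. case (x, \<tau>) of (x, \<tau>) \<Rightarrow> U \<tau> x)"
          by (rule continuous_on_compose2[OF contU]) (auto intro!: continuous_intros)
        then show ?thesis
          unfolding bbm_flux_def by (intro integrable_continuous) (auto intro!: continuous_intros)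
      qed
      show "continuous_on (UNIV \<times> cbox 0 t) (\<lambda>(x, \<tau>). Fx x \<tau>)"
        using contU contUx unfolding Fx_def case_prod_unfold cbox_interval by (intro continuous_intros)
    qed auto
    then show ?thesis by (simp add: bbm_impulse_def[abs_def])
  qed
  have "((\<lambda>\<tau>. - Fx x \<tau>) has_integral
          (U t x - D_x (D_x (U t)) x) - (U 0 x - D_x (D_x (U 0)) x)) {0..t}"
  proof (rule fundamental_theorem_of_calculus)
    show "0 \<le> t" using t by auto
    fix \<tau> assume "\<tau> \<in> {0..t}"
    with t have \<tau>: "\<tau> \<in> {0..T}" by auto
    from bbm \<tau> obtain a b where
      a: "((\<lambda>\<tau>. U \<tau> x) has_real_derivative a) (at \<tau> within {0..T})" and
      b: "((\<lambda>\<tau>. D_x (D_x (U \<tau>)) x) has_real_derivative b) (at \<tau> within {0..T})" and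
      ab: "a - b + D_x (U \<tau>) x + 1 / 2 * D_x (\<lambda>y. (U \<tau> y)\<^sup>2) x = 0"
      unfolding bbm_classical_def by blast
    have ab': "a - b = - Fx x \<tau>" using ab sq[OF \<tau>, of x] by (simp add: Fx_def)
    have "((\<lambda>\<tau>. U \<tau> x - D_x (D_x (U \<tau>)) x) has_real_derivative - Fx x \<tau>) (at \<tau> within {0..t})"
      unfolding ab'[symmetric]
      by (rule DERIV_subset[OF DERIV_diff[OF a b]]) (use t in auto)
    then show "((\<lambda>\<tau>. U \<tau> x - D_x (D_x (U \<tau>)) x) has_vector_derivative - Fx x \<tau>)
          (at \<tau> within {0..t})"
      by (simp add: has_real_derivative_iff_has_vector_derivative)
  qed
  then have "integral {0..t} (\<lambda>\<tau>. - Fx x \<tau>) =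
      (U t x - D_x (D_x (U t)) x) - (U 0 x - D_x (D_x (U 0)) x)"
    by (rule integral_unique)
  then have "- integral {0..t} (Fx x) = (U t x - D_x (D_x (U t)) x) - (U 0 x - D_x (D_x (U 0)) x)"
    by simp
  then have eq: "D_x (D_x (U t)) x - D_x (D_x (U 0)) x - integral {0..t} (Fx x) = U t x - U 0 x"
    by simp
  show ?thesis
    using DERIV_diff[OF DERIV_diff[OF d2[OF t] d2[of 0]] imp] t by (simp add: eq)
qed

text \<open>Continuous curves in the space of bounded functions with the sup norm.\<close>

definition sup_norm_curve :: "real \<Rightarrow> (real \<Rightarrow> real \<Rightarrow> real) \<Rightarrow> bool" where
  "sup_norm_curve T V \<longleftrightarrow> (\<forall>t\<in>{0..T}. (\<exists>B. \<forall>x. \<bar>V t x\<bar> \<le> B) \<and>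
     (\<forall>e>0. \<forall>\<^sub>F \<tau> in at t within {0..T}. \<forall>x. \<bar>V \<tau> x - V t x\<bar> < e))"

lemma sup_norm_curve_bounded:
  assumes "sup_norm_curve T V" "t \<in> {0..T}"
  shows "\<exists>B. \<forall>x. \<bar>V t x\<bar> \<le> B"
  using assms unfolding sup_norm_curve_def by blast

lemma sup_norm_curve_jointly_continuous:
  assumes V: "sup_norm_curve T V" and c: "\<And>t. t \<in> {0..T} \<Longrightarrow> continuous_on UNIV (V t)"
  shows "continuous_on ({0..T} \<times> UNIV) (\<lambda>(t, x). V t x)"
proof (unfold continuous_on_def, intro ballI)
  fix z :: "real \<times> real" assume z: "z \<in> {0..T} \<times> UNIV"
  obtain t x where tx: "z = (t, x)" by (cases z)
  let ?F = "at (t, x) within {0..T} \<times> UNIV"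
  have t: "t \<in> {0..T}" using z tx by auto
  have fl1: "(fst \<longlongrightarrow> t) ?F" and fl2: "(snd \<longlongrightarrow> x) ?F"
    by (auto intro!: tendsto_eq_intros)
  have dom: "\<forall>\<^sub>F w in ?F. fst w \<in> {0..T}"
    unfolding eventually_at_filter by (rule always_eventually) auto
  have "((\<lambda>w. V (fst w) (snd w) - V t (snd w)) \<longlongrightarrow> 0) ?F"
  proof (rule tendstoI)
    fix e :: real assume "e > 0"
    with V t have "\<forall>\<^sub>F \<tau> in at t within {0..T}. \<forall>x. \<bar>V \<tau> x - V t x\<bar> < e"
      by (auto simp: sup_norm_curve_def)
    then have ev: "\<forall>\<^sub>F \<tau> in nhds t. \<tau> \<in> {0..T} \<longrightarrow> (\<forall>x. \<bar>V \<tau> x - V t x\<bar> < e)"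
      unfolding eventually_at_filter by eventually_elim (use \<open>e > 0\<close> in auto)
    from filterlim_iff[THEN iffD1, OF fl1, rule_format, OF ev] dom
    show "\<forall>\<^sub>F w in ?F. dist (V (fst w) (snd w) - V t (snd w)) 0 < e"
      by eventually_elim (auto simp: dist_norm)
  qed
  moreover have "((\<lambda>w. V t (snd w)) \<longlongrightarrow> V t x) ?F"
    using c[OF t] by (intro isCont_tendsto_compose[OF _ fl2]) (simp add: continuous_on_eq_continuous_at)
  ultimately have "((\<lambda>w. (V (fst w) (snd w) - V t (snd w)) + V t (snd w)) \<longlongrightarrow> 0 + V t x) ?F"
    by (rule tendsto_add)
  then show "((\<lambda>(t, x). V t x) \<longlongrightarrow> (case z of (t, x) \<Rightarrow> V t x)) (at z within {0..T} \<times> UNIV)"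
    by (simp add: tx case_prod_unfold)
qed

lemma bbm_curve_facts:
  assumes bbm: "bbm_classical T U"
    and U: "sup_norm_curve T U" and Ux: "sup_norm_curve T (\<lambda>t. D_x (U t))"
  shows "t \<in> {0..T} \<Longrightarrow> (U t has_real_derivative D_x (U t) x) (at x)"
    and "continuous_on ({0..T} \<times> UNIV) (\<lambda>(t, x). U t x)"
    and "continuous_on ({0..T} \<times> UNIV) (\<lambda>(t, x). D_x (U t) x)"
proof -
  have sm: "smooth_fun (U \<tau>)" if "\<tau> \<in> {0..T}" for \<tau>
    using bbm that by (auto simp: bbm_classical_def)
  have d1: "(U \<tau> has_real_derivative D_x (U \<tau>) x) (at x)" if "\<tau> \<in> {0..T}" for \<tau> x
    using smooth_fun_has_derivative[OF sm[OF that], of 0 x]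
    by (simp add: has_real_derivative_iff_has_vector_derivative)
  have d2: "(D_x (U \<tau>) has_real_derivative D_x (D_x (U \<tau>)) x) (at x)" if "\<tau> \<in> {0..T}" for \<tau> x
    using smooth_fun_has_derivative[OF sm[OF that], of 1 x]
    by (simp add: has_real_derivative_iff_has_vector_derivative)
  show "t \<in> {0..T} \<Longrightarrow> (U t has_real_derivative D_x (U t) x) (at x)" by (rule d1)
  show "continuous_on ({0..T} \<times> UNIV) (\<lambda>(t, x). U t x)"
    by (rule sup_norm_curve_jointly_continuous[OF U]) (use d1 in \<open>auto intro: DERIV_continuous_on\<close>)
  show "continuous_on ({0..T} \<times> UNIV) (\<lambda>(t, x). D_x (U t) x)"
    by (rule sup_norm_curve_jointly_continuous[OF Ux]) (use d2 in \<open>auto intro: DERIV_continuous_on\<close>)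
qed

lemma bbm_flux_time_integrable:
  assumes "bbm_classical T U" "sup_norm_curve T U" "sup_norm_curve T (\<lambda>t. D_x (U t))" "t \<in> {0..T}"
  shows "(\<lambda>\<tau>. bbm_flux U \<tau> x) integrable_on {0..t}"
proof -
  have "continuous_on {0..t} (\<lambda>\<tau>. case (\<tau>, x) of (\<tau>, x) \<Rightarrow> U \<tau> x)"
    by (rule continuous_on_compose2[OF bbm_curve_facts(2)[OF assms(1-3)]])
       (use assms(4) in \<open>auto intro!: continuous_intros\<close>)
  then show ?thesis
    unfolding bbm_flux_def by (intro integrable_continuous_interval) (auto intro!: continuous_intros)
qed

lemma bbm_impulse_approx:
  assumes "bbm_classical T U" "sup_norm_curve T U" "sup_norm_curve T (\<lambda>t. D_x (U t))" "t \<in> {0..T}"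
    and b: "\<And>\<tau>. \<tau> \<in> {0..t} \<Longrightarrow> \<bar>bbm_flux U \<tau> x - c\<bar> \<le> S"
  shows "\<bar>bbm_impulse U t x - t * c\<bar> \<le> t * S"
proof -
  have i: "(\<lambda>\<tau>. bbm_flux U \<tau> x) integrable_on {0..t}"
    by (rule bbm_flux_time_integrable[OF assms(1-4)])
  have "((\<lambda>\<tau>. bbm_flux U \<tau> x - c) has_integral bbm_impulse U t x - t * c) {0..t}"
    unfolding bbm_impulse_def using assms(4) has_integral_const_real[of c 0 t]
    by (intro has_integral_diff integrable_integral i) auto
  moreover have "0 \<le> S" using b[of 0] assms(4) by fastforce
  ultimately have "norm (bbm_impulse U t x - t * c) \<le> S * Sigma_Algebra.measure lborel {0..t}"
    by (intro has_integral_bound_real[where f = "\<lambda>\<tau>. bbm_flux U \<tau> x - c"]) (use b in auto)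
  then show ?thesis using assms(4) by (simp add: mult.commute)
qed

lemma bbm_sup_bound:
  assumes bbm: "bbm_classical T U" and U: "sup_norm_curve T U"
    and Ux: "sup_norm_curve T (\<lambda>t. D_x (U t))" and t: "t \<in> {0..T}"
    and S: "\<And>\<tau> x. \<tau> \<in> {0..t} \<Longrightarrow> \<bar>bbm_flux U \<tau> x\<bar> \<le> S"
  shows "\<bar>U t x - U 0 x\<bar> \<le> t * S"
proof -
  note facts = bbm_curve_facts[OF bbm U Ux]
  have 0: "0 \<in> {0..T}" using t by auto
  have \<Gamma>: "\<bar>bbm_impulse U t x\<bar> \<le> t * S" for x
    using bbm_impulse_approx[OF bbm U Ux t, of x 0 S] S by simp
  obtain B1 where B1: "\<And>x. \<bar>D_x (U t) x\<bar> \<le> B1" using sup_norm_curve_bounded[OF Ux t] by blast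
  obtain B2 where B2: "\<And>x. \<bar>D_x (U 0) x\<bar> \<le> B2" using sup_norm_curve_bounded[OF Ux 0] by blast
  obtain B3 where B3: "\<And>x. \<bar>U t x\<bar> \<le> B3" using sup_norm_curve_bounded[OF U t] by blast
  obtain B4 where B4: "\<And>x. \<bar>U 0 x\<bar> \<le> B4" using sup_norm_curve_bounded[OF U 0] by blast
  show ?thesis
  proof (rule elliptic_sup_bound[where q = "\<lambda>x. U t x - U 0 x" and p = "\<lambda>x. D_x (U t) x - D_x (U 0) x - bbm_impulse U t x"
        and \<Gamma> = "bbm_impulse U t" and B = "B1 + B2 + t * S" and B' = "B3 + B4"])
    show "((\<lambda>x. U t x - U 0 x) has_real_derivative
        D_x (U t) x - D_x (U 0) x - bbm_impulse U t x + bbm_impulse U t x) (at x)" for x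
      using DERIV_diff[OF facts(1)[OF t] facts(1)[OF 0]] by simp
    show "\<bar>D_x (U t) x - D_x (U 0) x - bbm_impulse U t x\<bar> \<le> B1 + B2 + t * S" for x
      using B1[of x] B2[of x] \<Gamma>[of x] by linarith
    show "\<bar>U t x - U 0 x\<bar> \<le> B3 + B4" for x
      using B3[of x] B4[of x] by linarith
  qed (use bbm_time_integrated[OF bbm facts(2,3) t] \<Gamma> in auto)
qed

text \<open>As long as \<open>U - h\<close> is at most \<open>M\<close>, the flux is at most \<open>(M + H) + (M + H)\<^sup>2 / 2\<close>, so
  that up to time \<open>t\<close> the solution moves by at most \<open>t\<close> times this bound and \<open>U - h\<close> stays
  below \<open>M\<close>.\<close>

lemma bbm_bootstrap:
  assumes bbm: "bbm_classical T U" and U: "sup_norm_curve T U"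
    and Ux: "sup_norm_curve T (\<lambda>t. D_x (U t))" and t: "t \<in> {0..T}"
    and h: "\<And>x. \<bar>h x\<bar> \<le> H" and W: "\<And>x. \<bar>U 0 x - h x\<bar> \<le> W"
    and M: "0 \<le> M" and small: "W + t * ((M + H) + (M + H)\<^sup>2 / 2) < M"
    and \<tau>: "\<tau> \<in> {0..t}"
  shows "\<bar>U \<tau> x - h x\<bar> \<le> M"
proof -
  define g where "g s = (SUP x. \<bar>U s x - h x\<bar>)" for s
  have bdd: "bdd_above (range (\<lambda>x. \<bar>U s x - h x\<bar>))" if s: "s \<in> {0..T}" for s
  proof -
    obtain B where "\<And>x. \<bar>U s x\<bar> \<le> B" using sup_norm_curve_bounded[OF U s] by blast
    then show ?thesis
      using h by (intro bdd_aboveI[of _ "B + H"])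
        (auto intro!: order_trans[OF abs_triangle_ineq4] add_mono)
  qed
  have g_upper: "\<bar>U s x - h x\<bar> \<le> g s" if "s \<in> {0..T}" for s x
    unfolding g_def by (rule cSUP_upper[OF _ bdd[OF that]]) simp
  have g_least: "g s \<le> c" if "\<And>x. \<bar>U s x - h x\<bar> \<le> c" for s c
    unfolding g_def by (rule cSUP_least) (use that in auto)
  have g_lip: "\<bar>g s - g r\<bar> \<le> e" if "s \<in> {0..T}" "r \<in> {0..T}" "\<And>x. \<bar>U s x - U r x\<bar> \<le> e" for s r e
  proof -
    have "g s \<le> g r + e"
    proof (rule g_least)
      fix x show "\<bar>U s x - h x\<bar> \<le> g r + e" using g_upper[OF that(2), of x] that(3)[of x] by linarith
    qed
    moreover have "g r \<le> g s + e"
    proof (rule g_least)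
      fix x show "\<bar>U r x - h x\<bar> \<le> g s + e" using g_upper[OF that(1), of x] that(3)[of x] by linarith
    qed
    ultimately show ?thesis by linarith
  qed
  have cont: "continuous_on {0..T} g"
  proof (unfold continuous_on_def, intro ballI tendstoI)
    fix s e :: real assume s: "s \<in> {0..T}" and e: "e > 0"
    have "\<forall>\<^sub>F r in at s within {0..T}. \<forall>x. \<bar>U r x - U s x\<bar> < e / 2"
      using U s half_gt_zero[OF e] unfolding sup_norm_curve_def by blast
    moreover have "\<forall>\<^sub>F r in at s within {0..T}. r \<in> {0..T}"
      unfolding eventually_at_filter by (rule always_eventually) auto
    ultimately show "\<forall>\<^sub>F r in at s within {0..T}. dist (g r) (g s) < e"
    proof eventually_elim
      case (elim r)
      have "\<bar>g r - g s\<bar> \<le> e / 2" by (rule g_lip) (use elim s in \<open>auto intro: less_imp_le\<close>)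
      then show ?case using e by (simp add: dist_real_def)
    qed
  qed
  have H0: "0 \<le> H" using h[of 0] by linarith
  have W0: "0 \<le> W" using W[of 0] by linarith
  have "0 \<le> t * ((M + H) + (M + H)\<^sup>2 / 2)" using t M H0 by auto
  then have "W < M" using small by linarith
  have "g \<tau> < M"
  proof (rule bootstrap_principle[of t g M \<tau>])
    show "continuous_on {0..t} g" by (rule continuous_on_subset[OF cont]) (use t in auto)
    show "g 0 < M" using g_least[of 0 W] W \<open>W < M\<close> by fastforce
    fix s assume s: "s \<in> {0..t}" and IH: "\<And>\<tau>. \<tau> \<in> {0..s} \<Longrightarrow> g \<tau> \<le> M"
    have sT: "s \<in> {0..T}" using s t by auto
    have "\<bar>U s x - U 0 x\<bar> \<le> s * ((M + H) + (M + H)\<^sup>2 / 2)" for x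
    proof (rule bbm_sup_bound[OF bbm U Ux sT])
      fix r x assume r: "r \<in> {0..s}"
      then have rT: "r \<in> {0..T}" using sT by auto
      have b: "\<bar>U r x\<bar> \<le> M + H"
        using g_upper[OF rT, of x] IH[OF r] h[of x] by linarith
      have "\<bar>bbm_flux U r x\<bar> \<le> \<bar>U r x\<bar> + \<bar>U r x\<bar>\<^sup>2 / 2"
        unfolding bbm_flux_def by (rule order_trans[OF abs_triangle_ineq]) simp
      also have "\<dots> \<le> (M + H) + (M + H)\<^sup>2 / 2"
        using b by (intro add_mono divide_right_mono power_mono) auto
      finally show "\<bar>bbm_flux U r x\<bar> \<le> (M + H) + (M + H)\<^sup>2 / 2" .
    qed
    moreover have "s * ((M + H) + (M + H)\<^sup>2 / 2) \<le> t * ((M + H) + (M + H)\<^sup>2 / 2)"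
      using s \<open>W < M\<close> H0 W0 by (intro mult_right_mono) auto
    ultimately have "\<bar>U s x - h x\<bar> \<le> W + t * ((M + H) + (M + H)\<^sup>2 / 2)" for x
      using W[of x] by (smt (verit, best))
    then show "g s < M" using g_least small by fastforce
  qed (rule \<tau>)
  moreover have "\<tau> \<in> {0..T}" using \<tau> t by auto
  ultimately show ?thesis using g_upper[of \<tau> x] by fastforce
qed

text \<open>Triples \<open>\<psi>, \<psi>', \<psi>''\<close> whose boundary terms vanish when they are integrated by parts
  against bounded (on the torus: periodic) functions.\<close>

definition flux_test ::
  "domain \<Rightarrow> (real \<Rightarrow> real) \<Rightarrow> (real \<Rightarrow> real) \<Rightarrow> (real \<Rightarrow> real) \<Rightarrow> bool" where
  "flux_test M \<psi> \<psi>1 \<psi>2 \<longleftrightarrow>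
     (\<forall>x. (\<psi> has_real_derivative \<psi>1 x) (at x)) \<and> (\<forall>x. (\<psi>1 has_real_derivative \<psi>2 x) (at x)) \<and>
     set_integrable lborel (fun_domain M) (\<lambda>x. \<psi> x - \<psi>2 x) \<and> set_integrable lborel (fun_domain M) \<psi>1 \<and>
     (case M of
        Real_Line \<Rightarrow> (\<forall>F\<in>{at_top, at_bot}. (\<psi> \<longlongrightarrow> 0) F \<and> (\<psi>1 \<longlongrightarrow> 0) F)
      | Torus \<Rightarrow> \<psi> (2 * pi) = \<psi> 0 \<and> \<psi>1 (2 * pi) = \<psi>1 0)"

lemma D_x_periodic:
  assumes "\<And>x. f (x + c) = f x" shows "D_x f (x + c) = D_x f x"
proof -
  have shift: "((\<lambda>y. g (y + a)) has_vector_derivative d) (at z)"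
    if "(g has_vector_derivative d) (at (z + a))" for g :: "real \<Rightarrow> 'a" and a d z
  proof -
    have "((\<lambda>y. y + a) has_vector_derivative 1) (at z)"
      by (auto intro!: derivative_eq_intros)
    from vector_diff_chain_at[OF this that] show ?thesis by (simp add: comp_def)
  qed
  have "(f has_vector_derivative d) (at (x + c)) \<longleftrightarrow> (f has_vector_derivative d) (at x)" for d
  proof
    assume "(f has_vector_derivative d) (at (x + c))"
    then show "(f has_vector_derivative d) (at x)" using shift[of f d x c] assms by simp
  next
    assume "(f has_vector_derivative d) (at x)"
    moreover have "f (y - c) = f y" for y using assms[of "y - c"] by simp
    ultimately show "(f has_vector_derivative d) (at (x + c))" using shift[of f d "x + c" "- c"] by simp
  qed
  then show ?thesis by (simp add: D_x_def vector_derivative_def)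
qed

lemma integral_real_line_zero_flux:
  fixes f w :: "real \<Rightarrow> 'a::euclidean_space"
  assumes f: "integrable lborel f" and w: "\<And>x. (w has_vector_derivative f x) (at x)"
    and lim: "(w \<longlongrightarrow> 0) at_top" "(w \<longlongrightarrow> 0) at_bot"
  shows "(LINT x|lborel. f x) = 0"
proof -
  have "(\<lambda>n. LINT x|lborel. indicator {- real n..real n} x *\<^sub>R f x) \<longlonglongrightarrow> (LINT x|lborel. f x)"
  proof (rule integral_dominated_convergence[where w = "\<lambda>x. norm (f x)"])
    show "AE x in lborel. (\<lambda>n. indicator {- real n..real n} x *\<^sub>R f x) \<longlonglongrightarrow> f x"
    proof (rule AE_I2, rule tendsto_eventually)
      fix x :: real
      obtain N :: nat where "\<bar>x\<bar> \<le> real N" using real_arch_simple by blast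
      then show "\<forall>\<^sub>F n in sequentially. indicator {- real n..real n} x *\<^sub>R f x = f x"
        by (auto simp: eventually_sequentially indicator_def intro!: exI[of _ N])
    qed
  qed (use f in \<open>auto simp: indicator_def\<close>)
  moreover have "(LINT x|lborel. indicator {- real n..real n} x *\<^sub>R f x) = w (real n) - w (- real n)" for n
  proof -
    have "set_integrable lborel {- real n..real n} f"
      unfolding set_integrable_def by (rule integrable_mult_indicator) (use f in auto)
    moreover have "(f has_integral w (real n) - w (- real n)) {- real n..real n}"
      by (rule fundamental_theorem_of_calculus) (use w in \<open>auto intro: has_vector_derivative_at_within\<close>)
    ultimately show ?thesis
      using set_borel_integral_eq_integral(2)[of "{- real n..real n}" f]
      by (simp add: integral_unique set_lebesgue_integral_def)
  qed
  ultimately have 1: "(\<lambda>n. w (real n) - w (- real n)) \<longlonglongrightarrow> (LINT x|lborel. f x)" by simp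
  have 2: "(\<lambda>n. w (real n) - w (- real n)) \<longlonglongrightarrow> 0 - 0"
    by (intro tendsto_diff filterlim_compose[OF lim(1)] filterlim_compose[OF lim(2)]
        filterlim_real_sequentially filterlim_compose[OF filterlim_uminus_at_bot_at_top])
  show ?thesis using LIMSEQ_unique[OF 1 2] by simp
qed

lemma tendsto_bounded_mult_zero:
  fixes f g :: "'a \<Rightarrow> real"
  assumes "\<And>x. \<bar>f x\<bar> \<le> B" "(g \<longlongrightarrow> 0) F"
  shows "((\<lambda>x. f x * g x) \<longlongrightarrow> 0) F"
proof (rule Lim_null_comparison)
  show "\<forall>\<^sub>F x in F. norm (f x * g x) \<le> B * \<bar>g x\<bar>"
    using assms(1) by (intro always_eventually) (auto simp: abs_mult intro: mult_right_mono)
  show "((\<lambda>x. B * \<bar>g x\<bar>) \<longlongrightarrow> 0) F"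
    using tendsto_mult_right_zero[OF tendsto_rabs_zero[OF assms(2)]] .
qed

lemma set_integrable_bounded_mult:
  fixes f g :: "real \<Rightarrow> real"
  assumes g: "set_integrable lborel A g" and f: "f \<in> borel_measurable lborel"
    and b: "\<And>x. \<bar>f x\<bar> \<le> B"
  shows "set_integrable lborel A (\<lambda>x. f x * g x)"
proof -
  have "integrable lborel (\<lambda>x. f x * (indicator A x *\<^sub>R g x))"
  proof (rule Bochner_Integration.integrable_bound[where f = "\<lambda>x. B * (indicator A x *\<^sub>R g x)"])
    show "integrable lborel (\<lambda>x. B * (indicator A x *\<^sub>R g x))"
      using g by (simp add: set_integrable_def)
    have "0 \<le> B" using b[of 0] by linarith
    then show "AE x in lborel. norm (f x * (indicator A x *\<^sub>R g x)) \<le> norm (B * (indicator A x *\<^sub>R g x))"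
      using b by (intro AE_I2) (auto simp: abs_mult intro!: mult_right_mono)
  qed (use g f in \<open>auto simp: set_integrable_def intro!: borel_measurable_times\<close>)
  then show ?thesis by (simp add: set_integrable_def mult_ac)
qed

lemma continuous_on_UNIV_borel:
  "continuous_on UNIV f \<Longrightarrow> f \<in> borel_measurable lborel" for f :: "real \<Rightarrow> real"
  using borel_measurable_continuous_onI by simp

text \<open>With \<open>q = U t - U 0\<close> and \<open>p = q' - \<Gamma>\<close> the integrand \<open>q * (\<psi> - \<psi>'') - \<Gamma> * \<psi>'\<close> is the
  derivative of \<open>p * \<psi> - q * \<psi>'\<close>.\<close>

lemma bbm_weak_identity:
  assumes bbm: "bbm_classical T U" and U: "sup_norm_curve T U"
    and Ux: "sup_norm_curve T (\<lambda>t. D_x (U t))" and t: "t \<in> {0..T}"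
    and per: "M = Torus \<Longrightarrow> (\<forall>\<tau>\<in>{0..T}. \<forall>x. U \<tau> (x + 2 * pi) = U \<tau> x)"
    and \<psi>: "flux_test M \<psi> \<psi>1 \<psi>2"
    and S: "\<And>\<tau> x. \<tau> \<in> {0..t} \<Longrightarrow> \<bar>bbm_flux U \<tau> x\<bar> \<le> S"
  shows "set_integrable lborel (fun_domain M) (\<lambda>x. bbm_impulse U t x * \<psi>1 x)"
    and "(LINT x:fun_domain M|lborel. (U t x - U 0 x) * (\<psi> x - \<psi>2 x)) =
         (LINT x:fun_domain M|lborel. bbm_impulse U t x * \<psi>1 x)"
proof -
  note facts = bbm_curve_facts[OF bbm U Ux]
  have 0: "0 \<in> {0..T}" using t by auto
  define q where "q x = U t x - U 0 x" for x
  define p where "p x = D_x (U t) x - D_x (U 0) x - bbm_impulse U t x" for x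
  have p': "(p has_real_derivative q x) (at x)" for x
    using bbm_time_integrated[OF bbm facts(2,3) t] by (simp add: p_def[abs_def] q_def)
  have q': "(q has_real_derivative p x + bbm_impulse U t x) (at x)" for x
    using DERIV_diff[OF facts(1)[OF t] facts(1)[OF 0], of x] by (simp add: p_def q_def[abs_def])
  have \<Gamma>: "\<bar>bbm_impulse U t x\<bar> \<le> t * S" for x
    using bbm_impulse_approx[OF bbm U Ux t, of x 0 S] S by simp
  obtain B1 where B1: "\<And>x. \<bar>D_x (U t) x\<bar> \<le> B1" using sup_norm_curve_bounded[OF Ux t] by blast
  obtain B2 where B2: "\<And>x. \<bar>D_x (U 0) x\<bar> \<le> B2" using sup_norm_curve_bounded[OF Ux 0] by blast
  obtain B3 where B3: "\<And>x. \<bar>U t x\<bar> \<le> B3" using sup_norm_curve_bounded[OF U t] by blast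
  obtain B4 where B4: "\<And>x. \<bar>U 0 x\<bar> \<le> B4" using sup_norm_curve_bounded[OF U 0] by blast
  have pb: "\<bar>p x\<bar> \<le> B1 + B2 + t * S" for x
    using B1[of x] B2[of x] \<Gamma>[of x] unfolding p_def by linarith
  have qb: "\<bar>q x\<bar> \<le> B3 + B4" for x
    using B3[of x] B4[of x] unfolding q_def by linarith
  have cont: "continuous_on UNIV (\<lambda>x. D_x (U \<tau>) x)" if "\<tau> \<in> {0..T}" for \<tau>
  proof -
    have "continuous_on UNIV (\<lambda>x. case (\<tau>, x) of (t, x) \<Rightarrow> D_x (U t) x)"
      by (rule continuous_on_compose2[OF facts(3)]) (use that in \<open>auto intro!: continuous_intros\<close>)
    then show ?thesis by simp
  qed
  have "continuous_on UNIV (\<lambda>x. D_x (U t) x - D_x (U 0) x - p x)"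
    by (intro continuous_on_diff cont t 0 DERIV_continuous_on[of UNIV p q])
       (use p' in \<open>simp add: has_field_derivative_at_within\<close>)
  then have \<Gamma>m: "bbm_impulse U t \<in> borel_measurable lborel"
    by (intro continuous_on_UNIV_borel) (simp add: p_def)
  have qm: "q \<in> borel_measurable lborel"
    by (intro continuous_on_UNIV_borel DERIV_continuous_on[of UNIV q]) (use q' in auto)
  have d0: "(\<psi> has_real_derivative \<psi>1 x) (at x)" and d1: "(\<psi>1 has_real_derivative \<psi>2 x) (at x)" for x
    using \<psi> by (auto simp: flux_test_def)
  show i1: "set_integrable lborel (fun_domain M) (\<lambda>x. bbm_impulse U t x * \<psi>1 x)"
    by (rule set_integrable_bounded_mult[OF _ \<Gamma>m \<Gamma>]) (use \<psi> in \<open>simp add: flux_test_def\<close>)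
  have i2: "set_integrable lborel (fun_domain M) (\<lambda>x. q x * (\<psi> x - \<psi>2 x))"
    by (rule set_integrable_bounded_mult[OF _ qm qb]) (use \<psi> in \<open>simp add: flux_test_def\<close>)
  define f where "f x = q x * (\<psi> x - \<psi>2 x) - bbm_impulse U t x * \<psi>1 x" for x
  define w where "w x = p x * \<psi> x - q x * \<psi>1 x" for x
  have w': "(w has_real_derivative f x) (at x)" for x
    unfolding w_def[abs_def]
    using DERIV_diff[OF DERIV_mult[OF p' d0] DERIV_mult[OF q' d1], of x]
    by (simp add: f_def algebra_simps)
  have fi: "set_integrable lborel (fun_domain M) f"
    unfolding f_def[abs_def] by (rule set_integral_diff(1)[OF i2 i1])
  have "(LINT x:fun_domain M|lborel. f x) = 0"
  proof (cases M)
    case Real_Line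
    have lim: "(w \<longlongrightarrow> 0) F" if "F \<in> {at_top, at_bot}" for F
    proof -
      have "(\<psi> \<longlongrightarrow> 0) F" "(\<psi>1 \<longlongrightarrow> 0) F"
        using \<psi> Real_Line that by (auto simp: flux_test_def)
      then have "(w \<longlongrightarrow> 0 - 0) F"
        unfolding w_def[abs_def] by (intro tendsto_diff tendsto_bounded_mult_zero[OF pb] tendsto_bounded_mult_zero[OF qb])
      then show ?thesis by simp
    qed
    have "integrable lborel f"
      using fi Real_Line by (simp add: fun_domain_def set_integrable_def)
    then show ?thesis
      using integral_real_line_zero_flux[OF _ w'[unfolded has_real_derivative_iff_has_vector_derivative] lim lim] Real_Line
      by (simp add: fun_domain_def set_lebesgue_integral_def)
  next
    case Torus
    have perU: "U \<tau> (2 * pi) = U \<tau> 0" "D_x (U \<tau>) (2 * pi) = D_x (U \<tau>) 0" if "\<tau> \<in> {0..T}" for \<tau>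
      using per[OF Torus] that D_x_periodic[of "U \<tau>" "2 * pi" 0] by (metis add.left_neutral)+
    have "bbm_impulse U t (2 * pi) = bbm_impulse U t 0"
      unfolding bbm_impulse_def bbm_flux_def
      by (rule integral_cong) (use perU(1) t in auto)
    then have "w (2 * pi) = w 0"
      using \<psi> Torus perU[OF t] perU[OF 0] by (simp add: flux_test_def w_def p_def q_def)
    moreover have "(f has_integral w (2 * pi) - w 0) {0..2 * pi}"
      by (rule fundamental_theorem_of_calculus)
         (use w' in \<open>auto simp: has_real_derivative_iff_has_vector_derivative
            intro: has_vector_derivative_at_within\<close>)
    ultimately show ?thesis
      using fi Torus by (simp add: fun_domain_def set_borel_integral_eq_integral(2) integral_unique)
  qed
  then show "(LINT x:fun_domain M|lborel. (U t x - U 0 x) * (\<psi> x - \<psi>2 x)) =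
         (LINT x:fun_domain M|lborel. bbm_impulse U t x * \<psi>1 x)"
    using set_integral_diff(2)[OF i2 i1] by (simp add: f_def q_def)
qed

text \<open>In terms of \<open>r = U \<tau> - h\<close> the flux is \<open>h\<^sup>2 / 2 + (r + h + r\<^sup>2 / 2 + r * h)\<close>, and the
  bracket is at most linear in the size \<open>H\<close> of \<open>h\<close>.\<close>

lemma bbm_pairing_growth:
  assumes bbm: "bbm_classical T U" and U: "sup_norm_curve T U"
    and Ux: "sup_norm_curve T (\<lambda>t. D_x (U t))" and t: "t \<in> {0..T}"
    and per: "M = Torus \<Longrightarrow> (\<forall>\<tau>\<in>{0..T}. \<forall>x. U \<tau> (x + 2 * pi) = U \<tau> x)"
    and \<psi>: "flux_test M \<psi> \<psi>1 \<psi>2"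
    and h: "\<And>x. \<bar>h x\<bar> \<le> H" and hm: "h \<in> borel_measurable lborel"
    and z: "\<And>\<tau> x. \<tau> \<in> {0..t} \<Longrightarrow> \<bar>U \<tau> x - h x\<bar> \<le> B"
  shows "\<bar>(LINT x:fun_domain M|lborel. (U t x - U 0 x) * (\<psi> x - \<psi>2 x))
          - t / 2 * (LINT x:fun_domain M|lborel. (h x)\<^sup>2 * \<psi>1 x)\<bar>
       \<le> t * (B + H + B\<^sup>2 / 2 + B * H) * (LINT x:fun_domain M|lborel. \<bar>\<psi>1 x\<bar>)"
proof -
  let ?D = "fun_domain M"
  define C where "C = B + H + B\<^sup>2 / 2 + B * H"
  have t0: "0 \<in> {0..t}" "0 \<le> t" using t by auto
  have B0: "0 \<le> B" using z[OF t0(1), of 0] by linarith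
  have H0: "0 \<le> H" using h[of 0] by linarith
  have flux: "\<bar>bbm_flux U \<tau> x - (h x)\<^sup>2 / 2\<bar> \<le> C" if "\<tau> \<in> {0..t}" for \<tau> x
  proof -
    define r where "r = U \<tau> x - h x"
    have r: "\<bar>r\<bar> \<le> B" using z[OF that, of x] by (simp add: r_def)
    have "bbm_flux U \<tau> x - (h x)\<^sup>2 / 2 = r + h x + r\<^sup>2 / 2 + r * h x"
      by (simp add: bbm_flux_def r_def power2_eq_square field_simps)
    also have "\<bar>\<dots>\<bar> \<le> \<bar>r\<bar> + \<bar>h x\<bar> + \<bar>r\<bar>\<^sup>2 / 2 + \<bar>r\<bar> * \<bar>h x\<bar>"
      unfolding abs_mult[symmetric] power2_abs by (smt (verit) zero_le_power2 field_sum_of_halves)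
    also have "\<dots> \<le> C"
      unfolding C_def using r h[of x] B0 H0
      by (intro add_mono divide_right_mono power_mono mult_mono) auto
    finally show ?thesis .
  qed
  have flux': "\<bar>bbm_flux U \<tau> x\<bar> \<le> C + H\<^sup>2 / 2" if "\<tau> \<in> {0..t}" for \<tau> x
  proof -
    have "(h x)\<^sup>2 \<le> H\<^sup>2" using h[of x] by (simp add: abs_le_square_iff[symmetric])
    then show ?thesis using flux[OF that, of x] zero_le_power2[of "h x"] unfolding abs_le_iff by linarith
  qed
  note weak = bbm_weak_identity[OF bbm U Ux t per \<psi> flux']
  have i\<psi>: "set_integrable lborel ?D \<psi>1" using \<psi> by (simp add: flux_test_def)
  have h2: "\<bar>t / 2 * (h x)\<^sup>2\<bar> \<le> t / 2 * H\<^sup>2" for x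
    using h[of x] t0 by (auto simp: abs_mult abs_le_square_iff[symmetric] intro!: mult_left_mono)
  have ih: "set_integrable lborel ?D (\<lambda>x. (t / 2 * (h x)\<^sup>2) * \<psi>1 x)"
    by (rule set_integrable_bounded_mult[OF i\<psi> _ h2]) (use hm in measurable)
  have "(LINT x:?D|lborel. (U t x - U 0 x) * (\<psi> x - \<psi>2 x)) - t / 2 * (LINT x:?D|lborel. (h x)\<^sup>2 * \<psi>1 x)
      = (LINT x:?D|lborel. bbm_impulse U t x * \<psi>1 x) - (LINT x:?D|lborel. (t / 2 * (h x)\<^sup>2) * \<psi>1 x)"
    using weak(2) by (simp add: mult.assoc)
  also have "\<dots> = (LINT x:?D|lborel. bbm_impulse U t x * \<psi>1 x - (t / 2 * (h x)\<^sup>2) * \<psi>1 x)"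
    by (rule set_integral_diff(2)[symmetric, OF weak(1) ih]) auto
  also have "\<bar>\<dots>\<bar> \<le> (LINT x:?D|lborel. t * C * \<bar>\<psi>1 x\<bar>)"
  proof -
    let ?f = "\<lambda>x. bbm_impulse U t x * \<psi>1 x - (t / 2 * (h x)\<^sup>2) * \<psi>1 x"
    have fi: "set_integrable lborel ?D ?f"
      by (rule set_integral_diff(1)[OF weak(1) ih]) auto
    have "\<bar>LINT x:?D|lborel. ?f x\<bar> \<le> (LINT x:?D|lborel. \<bar>?f x\<bar>)"
      using set_integral_norm_bound[OF fi] by simp
    also have "\<dots> \<le> (LINT x:?D|lborel. t * C * \<bar>\<psi>1 x\<bar>)"
    proof (rule set_integral_mono)
      show "set_integrable lborel ?D (\<lambda>x. \<bar>?f x\<bar>)" by (rule set_integrable_abs[OF fi])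
      show "set_integrable lborel ?D (\<lambda>x. t * C * \<bar>\<psi>1 x\<bar>)"
        by (intro set_integrable_mult_right set_integrable_abs i\<psi>)
      fix x
      have "\<bar>bbm_impulse U t x - t * ((h x)\<^sup>2 / 2)\<bar> \<le> t * C"
        by (rule bbm_impulse_approx[OF bbm U Ux t flux])
      then have "\<bar>(bbm_impulse U t x - t * ((h x)\<^sup>2 / 2)) * \<psi>1 x\<bar> \<le> t * C * \<bar>\<psi>1 x\<bar>"
        unfolding abs_mult by (rule mult_right_mono) simp
      then show "\<bar>?f x\<bar> \<le> t * C * \<bar>\<psi>1 x\<bar>" by (simp add: algebra_simps)
    qed
    finally show ?thesis .
  qed
  finally show ?thesis by (simp add: C_def)
qed

section \<open>Weighted square-integrable functions of frequency\<close>

fun freq_measure :: "domain \<Rightarrow> real measure" where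
  "freq_measure Real_Line = lborel"
| "freq_measure Torus = distr (count_space (UNIV :: int set)) borel real_of_int"

lemma sets_freq_measure [measurable_cong, simp]: "sets (freq_measure M) = sets borel"
  by (cases M) auto

lemma space_freq_measure [simp]: "space (freq_measure M) = UNIV"
  by (cases M) auto

lemma integral_freq_Torus:
  fixes f :: "real \<Rightarrow> 'a::{banach,second_countable_topology}"
  assumes "f \<in> borel_measurable borel"
  shows "(LINT \<xi>|freq_measure Torus. f \<xi>) = (LINT k|count_space UNIV. f (real_of_int k))"
  using assms by (simp add: integral_distr)

lemma integrable_freq_Torus:
  fixes f :: "real \<Rightarrow> 'a::{banach,second_countable_topology}"
  assumes "f \<in> borel_measurable borel"
  shows "integrable (freq_measure Torus) f \<longleftrightarrow> integrable (count_space UNIV) (\<lambda>k::int. f (real_of_int k))"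
  using assms by (simp add: integrable_distr_eq)

lemma sigma_finite_freq_measure: "sigma_finite_measure (freq_measure M)"
proof (cases M)
  case Real_Line
  then show ?thesis using lborel.sigma_finite_measure_axioms by simp
next
  case Torus
  show ?thesis unfolding Torus
  proof (rule sigma_finite_measure.intro)
    let ?A = "range (\<lambda>n::nat. {- real n..real n})"
    have "emeasure (freq_measure Torus) {- real n..real n} \<noteq> \<infinity>" for n
    proof -
      have "real_of_int -` {- real n..real n} = {- int n..int n}"
        by (auto simp: Int.of_int_le_iff[where 'a = real, symmetric])
      then show ?thesis by (simp add: emeasure_distr)
    qed
    moreover have "\<Union>?A = UNIV"
    proof -
      have "\<exists>n. x \<in> {- real n..real n}" for x :: real
        using real_arch_simple[of "\<bar>x\<bar>"] by (auto simp: abs_le_iff minus_le_iff)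
      then show ?thesis by auto
    qed
    ultimately show "\<exists>A. countable A \<and> A \<subseteq> sets (freq_measure Torus) \<and> \<Union>A = space (freq_measure Torus) \<and>
        (\<forall>a\<in>A. emeasure (freq_measure Torus) a \<noteq> \<infinity>)"
      by (intro exI[of _ ?A]) (auto simp del: freq_measure.simps)
  qed
qed

text \<open>Together with its analogue on the line, this is the integrability of \<open>(1 + \<xi>\<^sup>2)\<^sup>-\<^sup>1\<close>
  behind the Sobolev embedding.\<close>

lemma summable_on_int_inverse_square: "(\<lambda>k::int. inverse (1 + (real_of_int k)\<^sup>2)) summable_on UNIV"
proof -
  have nat: "(\<lambda>n. inverse (1 + (real n)\<^sup>2)) summable_on UNIV"
  proof -
    have "summable (\<lambda>n. inverse (1 + (real n)\<^sup>2))"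
    proof (rule summable_comparison_test[OF exI[of _ 1]])
      show "\<forall>n\<ge>1. norm (inverse (1 + (real n)\<^sup>2)) \<le> inverse (real n ^ 2)"
        by (auto intro!: le_imp_inverse_le)
      show "summable (\<lambda>n. inverse (real n ^ 2))"
        using inverse_power_summable[of 2, where 'a = real] by simp
    qed
    then show ?thesis by (simp add: summable_on_UNIV_nonneg_real_iff)
  qed
  have p: "(\<lambda>k::int. inverse (1 + (real_of_int k)\<^sup>2)) summable_on range int"
    using nat by (subst summable_on_reindex) (auto simp: comp_def)
  have m: "(\<lambda>k::int. inverse (1 + (real_of_int k)\<^sup>2)) summable_on range (\<lambda>n. - int n)"
    using nat by (subst summable_on_reindex) (auto simp: comp_def inj_on_def)
  have "UNIV = range int \<union> (range (\<lambda>n. - int n) - range int)"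
  proof -
    have "k \<in> range int \<or> k \<in> range (\<lambda>n. - int n)" for k :: int
      by (cases k rule: int_cases2) auto
    then show ?thesis by auto
  qed
  moreover have "(\<lambda>k::int. inverse (1 + (real_of_int k)\<^sup>2)) summable_on (range int \<union> (range (\<lambda>n. - int n) - range int))"
    by (rule summable_on_Un_disjoint[OF p summable_on_subset_banach[OF m]]) auto
  ultimately show ?thesis by simp
qed

lemma integrable_inverse_square_freq: "integrable (freq_measure M) (\<lambda>\<xi>. inverse (1 + \<xi>\<^sup>2))"
proof (cases M)
  case Real_Line
  have "set_integrable lborel UNIV (\<lambda>x. inverse (1 + x\<^sup>2) :: real)"
    using integrable_inverse_1_plus_square by (simp only: einterval_eq_UNIV)
  then show ?thesis
    by (simp only: set_integrable_def indicator_UNIV scaleR_one Real_Line freq_measure.simps)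
next
  case Torus
  have "Infinite_Sum.abs_summable_on (\<lambda>k::int. inverse (1 + (real_of_int k)\<^sup>2)) UNIV"
    by (rule summable_on_iff_abs_summable_on_real[THEN iffD1, OF summable_on_int_inverse_square])
  then have "integrable (count_space UNIV) (\<lambda>k::int. inverse (1 + (real_of_int k)\<^sup>2))"
    unfolding abs_summable_equivalent Infinite_Set_Sum.abs_summable_on_def .
  then show ?thesis unfolding Torus by (subst integrable_freq_Torus) auto
qed

lemma cauchy_schwarz_integrable:
  fixes f g :: "'a \<Rightarrow> real"
  assumes f[measurable]: "f \<in> borel_measurable N" and g[measurable]: "g \<in> borel_measurable N"
    and f2: "integrable N (\<lambda>x. (f x)\<^sup>2)" and g2: "integrable N (\<lambda>x. (g x)\<^sup>2)"
  shows "integrable N (\<lambda>x. f x * g x)"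
    and "(LINT x|N. \<bar>f x * g x\<bar>) \<le> sqrt (LINT x|N. (f x)\<^sup>2) * sqrt (LINT x|N. (g x)\<^sup>2)"
proof -
  show i: "integrable N (\<lambda>x. f x * g x)"
  proof (rule Bochner_Integration.integrable_bound[of N "\<lambda>x. (f x)\<^sup>2 + (g x)\<^sup>2"])
    show "AE x in N. norm (f x * g x) \<le> norm ((f x)\<^sup>2 + (g x)\<^sup>2)"
    proof (rule AE_I2)
      fix x
      have "0 \<le> (\<bar>f x\<bar> - \<bar>g x\<bar>)\<^sup>2" by simp
      then have "2 * (\<bar>f x\<bar> * \<bar>g x\<bar>) \<le> (f x)\<^sup>2 + (g x)\<^sup>2" by (simp add: power2_diff)
      moreover have "0 \<le> \<bar>f x\<bar> * \<bar>g x\<bar>" by simp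
      ultimately have "\<bar>f x\<bar> * \<bar>g x\<bar> \<le> (f x)\<^sup>2 + (g x)\<^sup>2" by linarith
      then show "norm (f x * g x) \<le> norm ((f x)\<^sup>2 + (g x)\<^sup>2)" by (simp add: abs_mult)
    qed
  qed (use f2 g2 in auto)
  let ?a = "LINT x|N. \<bar>f x * g x\<bar>" and ?F = "LINT x|N. (f x)\<^sup>2" and ?G = "LINT x|N. (g x)\<^sup>2"
  have "(\<integral>\<^sup>+x. ennreal \<bar>f x\<bar> * ennreal \<bar>g x\<bar> \<partial>N)\<^sup>2 \<le>
      (\<integral>\<^sup>+x. ennreal \<bar>f x\<bar> ^ 2 \<partial>N) * (\<integral>\<^sup>+x. ennreal \<bar>g x\<bar> ^ 2 \<partial>N)"
    by (rule Cauchy_Schwarz_nn_integral) auto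
  moreover have "(\<integral>\<^sup>+x. ennreal \<bar>f x\<bar> * ennreal \<bar>g x\<bar> \<partial>N) = ennreal ?a"
    using i by (simp add: ennreal_mult[symmetric] abs_mult[symmetric] nn_integral_eq_integral)
  moreover have "(\<integral>\<^sup>+x. ennreal \<bar>f x\<bar> ^ 2 \<partial>N) = ennreal ?F"
    using f2 by (simp add: ennreal_power nn_integral_eq_integral)
  moreover have "(\<integral>\<^sup>+x. ennreal \<bar>g x\<bar> ^ 2 \<partial>N) = ennreal ?G"
    using g2 by (simp add: ennreal_power nn_integral_eq_integral)
  ultimately have "ennreal (?a\<^sup>2) \<le> ennreal (?F * ?G)"
    by (simp add: ennreal_power ennreal_mult)
  then have "?a\<^sup>2 \<le> ?F * ?G" by (subst (asm) ennreal_le_iff) auto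
  then show "?a \<le> sqrt ?F * sqrt ?G"
    unfolding real_sqrt_mult[symmetric] by (rule real_le_rsqrt)
qed

definition weighted_L2 :: "domain \<Rightarrow> real \<Rightarrow> (real \<Rightarrow> complex) \<Rightarrow> bool" where
  "weighted_L2 M \<sigma> g \<longleftrightarrow> g \<in> borel_measurable borel \<and>
     integrable (freq_measure M) (\<lambda>\<xi>. (1 + \<xi>\<^sup>2) powr \<sigma> * (cmod (g \<xi>))\<^sup>2)"

definition weighted_norm :: "domain \<Rightarrow> real \<Rightarrow> (real \<Rightarrow> complex) \<Rightarrow> real" where
  "weighted_norm M \<sigma> g = sqrt (LINT \<xi>|freq_measure M. (1 + \<xi>\<^sup>2) powr \<sigma> * (cmod (g \<xi>))\<^sup>2)"

lemma one_plus_square_pos [simp]: "0 < 1 + (\<xi>::real)\<^sup>2" "1 + (\<xi>::real)\<^sup>2 \<noteq> 0"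
proof -
  show "0 < 1 + \<xi>\<^sup>2" by (rule add_pos_nonneg) auto
  then show "1 + \<xi>\<^sup>2 \<noteq> 0" by linarith
qed

lemma weighted_norm_nonneg [simp]: "0 \<le> weighted_norm M \<sigma> g"
  by (simp add: weighted_norm_def)

lemma weight_sqrt_square: "((1 + (\<xi>::real)\<^sup>2) powr (\<sigma> / 2) * c)\<^sup>2 = (1 + \<xi>\<^sup>2) powr \<sigma> * c\<^sup>2"
proof -
  have "((1 + \<xi>\<^sup>2) powr (\<sigma> / 2))\<^sup>2 = (1 + \<xi>\<^sup>2) powr \<sigma>"
    unfolding power2_eq_square by (simp only: powr_add[symmetric] field_sum_of_halves)
  then show ?thesis by (simp add: power_mult_distrib)
qed

text \<open>The duality between \<open>H\<^sup>\<sigma>\<close> and \<open>H\<^sup>-\<^sup>\<sigma>\<close> on the frequency side.\<close>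

lemma weighted_pairing:
  assumes g: "weighted_L2 M \<sigma> g" and k: "weighted_L2 M (- \<sigma>) k"
  shows "integrable (freq_measure M) (\<lambda>\<xi>. g \<xi> * k \<xi>)"
    and "(LINT \<xi>|freq_measure M. cmod (g \<xi> * k \<xi>)) \<le> weighted_norm M \<sigma> g * weighted_norm M (- \<sigma>) k"
proof -
  have [measurable]: "g \<in> borel_measurable borel" "k \<in> borel_measurable borel"
    using g k by (auto simp: weighted_L2_def)
  let ?a = "\<lambda>\<xi>. (1 + \<xi>\<^sup>2) powr (\<sigma> / 2) * cmod (g \<xi>)"
  let ?b = "\<lambda>\<xi>. (1 + \<xi>\<^sup>2) powr (- \<sigma> / 2) * cmod (k \<xi>)"
  have ab: "?a \<xi> * ?b \<xi> = cmod (g \<xi> * k \<xi>)" for \<xi>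
  proof -
    have "(1 + \<xi>\<^sup>2) powr (\<sigma> / 2) * (1 + \<xi>\<^sup>2) powr (- \<sigma> / 2) = 1"
      by (simp add: powr_add[symmetric])
    then show ?thesis by (simp add: norm_mult mult.assoc mult.left_commute)
  qed
  have a: "?a \<in> borel_measurable (freq_measure M)" and b: "?b \<in> borel_measurable (freq_measure M)"
    by measurable
  have a2: "integrable (freq_measure M) (\<lambda>\<xi>. (?a \<xi>)\<^sup>2)" and b2: "integrable (freq_measure M) (\<lambda>\<xi>. (?b \<xi>)\<^sup>2)"
    using g k unfolding weighted_L2_def weight_sqrt_square by blast+
  note cs = cauchy_schwarz_integrable[OF a b a2 b2]
  show "integrable (freq_measure M) (\<lambda>\<xi>. g \<xi> * k \<xi>)"
    using cs(1) unfolding ab by (rule integrable_norm_cancel) measurable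
  show "(LINT \<xi>|freq_measure M. cmod (g \<xi> * k \<xi>)) \<le> weighted_norm M \<sigma> g * weighted_norm M (- \<sigma>) k"
    using cs(2) unfolding ab weight_sqrt_square weighted_norm_def abs_norm_cancel .
qed

section \<open>Schwartz functions\<close>

lemma smooth_fun_coinduct:
  fixes f :: "real \<Rightarrow> 'a::real_normed_vector"
  assumes f: "f \<in> X"
    and X: "\<And>f. f \<in> X \<Longrightarrow> \<exists>f'\<in>X. \<forall>x. (f has_vector_derivative f' x) (at x)"
  shows "smooth_fun f" and "(D_x ^^ n) f \<in> X"
proof -
  have D: "D_x g \<in> X" if g: "g \<in> X" for g
  proof -
    obtain g' where g': "g' \<in> X" "\<And>x. (g has_vector_derivative g' x) (at x)" using X[OF g] by blast
    then have "D_x g = g'" by (auto simp: D_x_def fun_eq_iff intro!: vector_derivative_at)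
    then show ?thesis using g'(1) by simp
  qed
  show n: "(D_x ^^ n) f \<in> X" for n by (induction n) (use f D in auto)
  show "smooth_fun f"
    unfolding smooth_fun_def
  proof (intro allI)
    fix n x
    show "(D_x ^^ n) f differentiable (at x)"
      using X[OF n[of n]] by (meson differentiableI_vector)
  qed
qed

lemma smooth_fun_D_x: "smooth_fun f \<Longrightarrow> smooth_fun (D_x f)"
  by (simp add: smooth_fun_def funpow_Suc_right[symmetric, unfolded comp_def, THEN fun_cong, symmetric])
     (metis comp_apply funpow_Suc_right)

lemma smooth_fun_derivative_exists:
  assumes "smooth_fun f" shows "\<exists>f'. smooth_fun f' \<and> (\<forall>x. (f has_vector_derivative f' x) (at x))"
  using smooth_fun_D_x[OF assms] smooth_fun_has_derivative[OF assms, of 0] by auto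

abbreviation schwartz :: "(real \<Rightarrow> complex) set" where "schwartz \<equiv> test_fun Real_Line"

definition rapidly_decreasing :: "(real \<Rightarrow> complex) \<Rightarrow> bool" where
  "rapidly_decreasing f \<longleftrightarrow> (\<forall>k::nat. \<exists>C. \<forall>x. \<bar>x\<bar> ^ k * cmod (f x) \<le> C)"

text \<open>To be a Schwartz function it suffices to lie in some class of rapidly decreasing
  functions that is closed under differentiation.\<close>

lemma schwartz_coinduct:
  assumes f: "f \<in> X"
    and X: "\<And>f. f \<in> X \<Longrightarrow> \<exists>f'\<in>X. \<forall>x. (f has_vector_derivative f' x) (at x)"
    and bdd: "\<And>f. f \<in> X \<Longrightarrow> rapidly_decreasing f"
  shows "f \<in> schwartz"
  using smooth_fun_coinduct[OF f X] bdd by (auto simp: rapidly_decreasing_def)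

lemma schwartz_derivative:
  assumes "\<phi> \<in> schwartz"
  shows "D_x \<phi> \<in> schwartz" and "(\<phi> has_vector_derivative D_x \<phi> x) (at x)"
    and "rapidly_decreasing \<phi>"
proof -
  have s: "smooth_fun \<phi>" and b: "\<And>k n. \<exists>C. \<forall>x. \<bar>x\<bar> ^ k * cmod ((D_x ^^ n) \<phi> x) \<le> C"
    using assms by auto
  show "(\<phi> has_vector_derivative D_x \<phi> x) (at x)" using smooth_fun_has_derivative[OF s, of 0] by simp
  have "\<exists>C. \<forall>x. \<bar>x\<bar> ^ k * cmod ((D_x ^^ n) (D_x \<phi>) x) \<le> C" for k n
    using b[of k "Suc n"] by (simp add: funpow_swap1)
  then show "D_x \<phi> \<in> schwartz" using smooth_fun_D_x[OF s] by simp
  show "rapidly_decreasing \<phi>" using b[of _ 0] by (simp add: rapidly_decreasing_def)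
qed

lemma rapidly_decreasing_add:
  assumes "rapidly_decreasing f" "rapidly_decreasing g" shows "rapidly_decreasing (\<lambda>x. f x + g x)"
  unfolding rapidly_decreasing_def
proof
  fix k :: nat
  obtain C D where "\<And>x. \<bar>x\<bar> ^ k * cmod (f x) \<le> C" "\<And>x. \<bar>x\<bar> ^ k * cmod (g x) \<le> D"
    using assms unfolding rapidly_decreasing_def by meson
  then have "\<bar>x\<bar> ^ k * (cmod (f x) + cmod (g x)) \<le> C + D" for x
    unfolding distrib_left by (rule add_mono)
  moreover have "\<bar>x\<bar> ^ k * cmod (f x + g x) \<le> \<bar>x\<bar> ^ k * (cmod (f x) + cmod (g x))" for x
    by (rule mult_left_mono[OF norm_triangle_ineq]) simp
  ultimately have "\<bar>x\<bar> ^ k * cmod (f x + g x) \<le> C + D" for x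
    by (rule order_trans[rotated])
  then show "\<exists>C. \<forall>x. \<bar>x\<bar> ^ k * cmod (f x + g x) \<le> C" by blast
qed

lemma rapidly_decreasing_mono:
  assumes "rapidly_decreasing f" "\<And>x. cmod (g x) \<le> B * cmod (f x)" "0 \<le> B" shows "rapidly_decreasing g"
  unfolding rapidly_decreasing_def
proof
  fix k :: nat
  obtain C where C: "\<And>x. \<bar>x\<bar> ^ k * cmod (f x) \<le> C"
    using assms unfolding rapidly_decreasing_def by meson
  have "\<bar>x\<bar> ^ k * cmod (g x) \<le> B * C" for x
  proof -
    have "\<bar>x\<bar> ^ k * cmod (g x) \<le> \<bar>x\<bar> ^ k * (B * cmod (f x))" by (intro mult_left_mono assms) auto
    also have "\<dots> = B * (\<bar>x\<bar> ^ k * cmod (f x))" by simp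
    also have "\<dots> \<le> B * C" by (intro mult_left_mono C assms)
    finally show ?thesis .
  qed
  then show "\<exists>C. \<forall>x. \<bar>x\<bar> ^ k * cmod (g x) \<le> C" by blast
qed

lemma rapidly_decreasing_times:
  assumes "rapidly_decreasing f" shows "rapidly_decreasing (\<lambda>x. of_real x * f x)"
  unfolding rapidly_decreasing_def
proof
  fix k :: nat
  obtain C where "\<And>x. \<bar>x\<bar> ^ Suc k * cmod (f x) \<le> C"
    using assms unfolding rapidly_decreasing_def by meson
  then show "\<exists>C. \<forall>x. \<bar>x\<bar> ^ k * cmod (of_real x * f x) \<le> C"
    by (intro exI[of _ C]) (simp add: norm_mult mult_ac)
qed

text \<open>Used with the Schwartz functions themselves, a single Gaussian, and the Fourier
  transforms of Schwartz functions as \<open>B\<close>. Differentiation is not among the rules: it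
  preserves the closure as soon as it maps \<open>B\<close> into the closure.\<close>

inductive_set schwartz_closure :: "(real \<Rightarrow> complex) set \<Rightarrow> (real \<Rightarrow> complex) set"
  for B :: "(real \<Rightarrow> complex) set" where
  base: "f \<in> B \<Longrightarrow> f \<in> schwartz_closure B"
| add: "f \<in> schwartz_closure B \<Longrightarrow> g \<in> schwartz_closure B \<Longrightarrow> (\<lambda>x. f x + g x) \<in> schwartz_closure B"
| scale: "f \<in> schwartz_closure B \<Longrightarrow> (\<lambda>x. c * f x) \<in> schwartz_closure B"
| times: "f \<in> schwartz_closure B \<Longrightarrow> (\<lambda>x. of_real x * f x) \<in> schwartz_closure B"
| modulate: "f \<in> schwartz_closure B \<Longrightarrow> (\<lambda>x. cis (a * x) * f x) \<in> schwartz_closure B"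
| conj: "f \<in> schwartz_closure B \<Longrightarrow> (\<lambda>x. cnj (f x)) \<in> schwartz_closure B"
| reflect: "f \<in> schwartz_closure B \<Longrightarrow> (\<lambda>x. f (- x)) \<in> schwartz_closure B"

lemma schwartz_closure_subset:
  assumes f: "f \<in> schwartz_closure B"
    and B: "\<And>f. f \<in> B \<Longrightarrow> \<exists>f'\<in>schwartz_closure B. \<forall>x. (f has_vector_derivative f' x) (at x)"
    and bdd: "\<And>f. f \<in> B \<Longrightarrow> rapidly_decreasing f"
  shows "f \<in> schwartz"
proof (rule schwartz_coinduct[OF f])
  note intros = schwartz_closure.intros(2-)
  fix f assume "f \<in> schwartz_closure B"
  then show "rapidly_decreasing f"
  proof induction
    case (base f) then show ?case by (rule bdd)
  next
    case (add f g) then show ?case by (intro rapidly_decreasing_add)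
  next
    case (scale f c) show ?case
      by (rule rapidly_decreasing_mono[OF scale.IH, of _ "cmod c"]) (auto simp: norm_mult)
  next
    case (times f) show ?case by (rule rapidly_decreasing_times[OF times.IH])
  next
    case (modulate f a) show ?case
      by (rule rapidly_decreasing_mono[OF modulate.IH, of _ 1]) (auto simp: norm_mult)
  next
    case (conj f) show ?case
      by (rule rapidly_decreasing_mono[OF conj.IH, of _ 1]) auto
  next
    case (reflect f)
    show ?case unfolding rapidly_decreasing_def
    proof
      fix k
      obtain C where C: "\<And>x. \<bar>x\<bar> ^ k * cmod (f x) \<le> C"
        using reflect unfolding rapidly_decreasing_def by meson
      show "\<exists>C. \<forall>x. \<bar>x\<bar> ^ k * cmod (f (- x)) \<le> C"
        using C[of "- x" for x] by (intro exI[of _ C]) simp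
    qed
  qed
next
  note intros = schwartz_closure.intros(2-)
  fix f assume "f \<in> schwartz_closure B"
  then show "\<exists>f'\<in>schwartz_closure B. \<forall>x. (f has_vector_derivative f' x) (at x)"
  proof induction
    case (base f) then show ?case by (rule B)
  next
    case (add f g)
    then obtain f' g' where "f' \<in> schwartz_closure B" "g' \<in> schwartz_closure B"
      "\<And>x. (f has_vector_derivative f' x) (at x)" "\<And>x. (g has_vector_derivative g' x) (at x)" by metis
    then show ?case
      by (intro bexI[of _ "\<lambda>x. f' x + g' x"] intros) (auto intro: has_vector_derivative_add)
  next
    case (scale f c)
    then obtain f' where "f' \<in> schwartz_closure B" "\<And>x. (f has_vector_derivative f' x) (at x)" by metis
    then show ?case
      by (intro bexI[of _ "\<lambda>x. c * f' x"] intros) (auto intro: has_vector_derivative_mult_right)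
  next
    case (times f)
    then obtain f' where f': "f' \<in> schwartz_closure B" "\<And>x. (f has_vector_derivative f' x) (at x)" by metis
    have "((\<lambda>x. of_real x * f x) has_vector_derivative f x + of_real x * f' x) (at x)" for x
    proof -
      have "(complex_of_real has_vector_derivative 1) (at x)"
        by (auto simp: has_vector_derivative_complex_iff intro!: derivative_eq_intros)
      from has_vector_derivative_mult[OF this f'(2)[of x]] show ?thesis by (simp add: add.commute)
    qed
    then show ?case using times f' by (intro bexI[of _ "\<lambda>x. f x + of_real x * f' x"] intros) auto
  next
    case (modulate f a)
    then obtain f' where f': "f' \<in> schwartz_closure B" "\<And>x. (f has_vector_derivative f' x) (at x)" by metis
    have "((\<lambda>x. cis (a * x) * f x) has_vector_derivative
        (\<i> * of_real a) * (cis (a * x) * f x) + cis (a * x) * f' x) (at x)" for x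
    proof -
      have "((\<lambda>x. cis (a * x)) has_vector_derivative \<i> * of_real a * cis (a * x)) (at x)"
        by (auto simp: has_vector_derivative_complex_iff intro!: derivative_eq_intros)
      from has_vector_derivative_mult[OF this f'(2)[of x]] show ?thesis by (simp add: algebra_simps)
    qed
    then show ?case
      using modulate f' by (intro bexI[of _ "\<lambda>x. (\<i> * of_real a) * (cis (a * x) * f x) + cis (a * x) * f' x"] intros) auto
  next
    case (conj f)
    then obtain f' where "f' \<in> schwartz_closure B" "\<And>x. (f has_vector_derivative f' x) (at x)" by metis
    then show ?case
      by (intro bexI[of _ "\<lambda>x. cnj (f' x)"] intros) (auto intro: has_vector_derivative_cnj)
  next
    case (reflect f)
    then obtain f' where f': "f' \<in> schwartz_closure B" "\<And>x. (f has_vector_derivative f' x) (at x)" by metis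
    have "((\<lambda>x. f (- x)) has_vector_derivative (- 1) * f' (- x)) (at x)" for x
    proof -
      have "(uminus has_vector_derivative (- 1)) (at x)"
        by (auto intro!: derivative_eq_intros)
      from vector_diff_chain_at[OF this f'(2)] show ?thesis by (simp add: comp_def)
    qed
    then show ?case using f' by (intro bexI[of _ "\<lambda>x. (- 1) * f' (- x)"] intros) auto
  qed
qed

lemma schwartz_closure_schwartz: "f \<in> schwartz_closure schwartz \<Longrightarrow> f \<in> schwartz"
  by (rule schwartz_closure_subset)
     (auto intro!: schwartz_derivative bexI[OF _ schwartz_closure.base] simp del: test_fun.simps)

lemma schwartz_intros:
  assumes "f \<in> schwartz"
  shows "g \<in> schwartz \<Longrightarrow> (\<lambda>x. f x + g x) \<in> schwartz" and "(\<lambda>x. c * f x) \<in> schwartz"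
    and "(\<lambda>x. of_real x * f x) \<in> schwartz" and "(\<lambda>x. cis (a * x) * f x) \<in> schwartz"
    and "(\<lambda>x. cnj (f x)) \<in> schwartz" and "(\<lambda>x. f (- x)) \<in> schwartz"
  using assms schwartz_closure.intros(1)[of _ schwartz]
  by (auto intro!: schwartz_closure_schwartz schwartz_closure.intros(2-) simp del: test_fun.simps)

text \<open>The bound on \<open>\<bar>x\<bar> ^ k * exp (- (a * x\<^sup>2) + b * x)\<close> comes from
  \<open>\<bar>x\<bar> ^ k \<le> fact k * exp \<bar>x\<bar>\<close> and completing the square.\<close>

lemma schwartz_gaussian:
  assumes "a > 0"
  shows "(\<lambda>x. complex_of_real (exp (- (a * x\<^sup>2) + b * x))) \<in> schwartz" (is "?G \<in> _")
proof (rule schwartz_closure_subset[OF schwartz_closure.base[of ?G "{?G}"]])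
  fix f assume "f \<in> {?G}"
  then have f: "f = ?G" by simp
  have "(\<lambda>x. of_real (- 2 * a) * (of_real x * ?G x) + of_real b * ?G x) \<in> schwartz_closure {?G}"
    by (intro schwartz_closure.intros) auto
  moreover have "(?G has_vector_derivative of_real (- 2 * a) * (of_real x * ?G x) + of_real b * ?G x) (at x)" for x
  proof -
    have "((\<lambda>x. exp (- (a * x\<^sup>2) + b * x)) has_real_derivative
        - 2 * a * (x * exp (- (a * x\<^sup>2) + b * x)) + b * exp (- (a * x\<^sup>2) + b * x)) (at x)"
      by (auto intro!: derivative_eq_intros simp: algebra_simps)
    then show ?thesis
      by (auto dest!: has_vector_derivative_of_real[where 'a = complex])
  qed
  ultimately show "\<exists>f'\<in>schwartz_closure {?G}. \<forall>x. (f has_vector_derivative f' x) (at x)"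
    unfolding f by (intro bexI allI)
  show "rapidly_decreasing f"
    unfolding f rapidly_decreasing_def
  proof
    fix k :: nat
    define c where "c = (1 + \<bar>b\<bar>)\<^sup>2 / (4 * a)"
    have "\<bar>x\<bar> ^ k * exp (- (a * x\<^sup>2) + b * x) \<le> fact k * exp c" for x
    proof -
      have "\<bar>x\<bar> ^ k / fact k \<le> exp \<bar>x\<bar>"
        using sum_le_suminf[OF sums_summable[OF exp_converges[of "\<bar>x\<bar>"]], of "{k}"]
          sums_unique[OF exp_converges[of "\<bar>x\<bar>"]] by (simp add: divide_inverse mult.commute)
      then have "\<bar>x\<bar> ^ k \<le> fact k * exp \<bar>x\<bar>" by (simp add: field_simps)
      then have "\<bar>x\<bar> ^ k * exp (- (a * x\<^sup>2) + b * x) \<le> fact k * exp \<bar>x\<bar> * exp (- (a * x\<^sup>2) + b * x)"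
        by (rule mult_right_mono) simp
      also have "\<dots> = fact k * exp (\<bar>x\<bar> + (- (a * x\<^sup>2) + b * x))" by (simp add: exp_add)
      also have "\<bar>x\<bar> + (- (a * x\<^sup>2) + b * x) \<le> c"
      proof -
        have "b * x \<le> \<bar>b\<bar> * \<bar>x\<bar>" by (simp add: abs_mult[symmetric])
        then have "\<bar>x\<bar> + (- (a * x\<^sup>2) + b * x) \<le> (1 + \<bar>b\<bar>) * \<bar>x\<bar> - a * \<bar>x\<bar>\<^sup>2" by (simp add: algebra_simps)
        also have "\<dots> = c - a * (\<bar>x\<bar> - (1 + \<bar>b\<bar>) / (2 * a))\<^sup>2"
          using assms by (simp add: c_def field_simps power2_eq_square)
        also have "\<dots> \<le> c" using assms by simp
        finally show ?thesis .
      qed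
      finally show ?thesis by simp
    qed
    then show "\<exists>C. \<forall>x. \<bar>x\<bar> ^ k * cmod (?G x) \<le> C" by auto
  qed
qed simp

lemma rapidly_decreasing_bound:
  assumes "rapidly_decreasing f"
  shows "\<exists>C\<ge>0. \<forall>x. cmod (f x) \<le> C * inverse (1 + x\<^sup>2)"
proof -
  obtain C0 C2 where C: "\<And>x. \<bar>x\<bar> ^ 0 * cmod (f x) \<le> C0" "\<And>x. \<bar>x\<bar> ^ 2 * cmod (f x) \<le> C2"
    using assms unfolding rapidly_decreasing_def by meson
  have "cmod (f x) \<le> (C0 + C2) * inverse (1 + x\<^sup>2)" for x
  proof -
    have "cmod (f x) * (1 + x\<^sup>2) \<le> C0 + C2" using C(1)[of x] C(2)[of x] by (simp add: algebra_simps)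
    then show ?thesis by (simp add: field_simps)
  qed
  moreover have "0 \<le> C0 + C2"
    using C(1)[of 0] C(2)[of 0] norm_ge_zero[of "f 0"] order_trans[of 0 "cmod (f 0)" C0] by simp
  ultimately show ?thesis by blast
qed

lemma integrable_inverse_square: "integrable lborel (\<lambda>x::real. inverse (1 + x\<^sup>2))"
  using integrable_inverse_square_freq[of Real_Line] by simp

lemma schwartz_measurable: "\<phi> \<in> schwartz \<Longrightarrow> \<phi> \<in> borel_measurable borel"
  using schwartz_derivative(2)
  by (intro borel_measurable_continuous_onI continuous_at_imp_continuous_on)
     (auto dest!: has_vector_derivative_continuous simp del: test_fun.simps)

lemma schwartz_integrable:
  assumes "\<phi> \<in> schwartz" shows "integrable lborel \<phi>"
proof -
  obtain C where C: "0 \<le> C" "\<And>x. cmod (\<phi> x) \<le> C * inverse (1 + x\<^sup>2)"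
    using rapidly_decreasing_bound[OF schwartz_derivative(3)[OF assms]] by blast
  show ?thesis
    by (rule Bochner_Integration.integrable_bound[OF integrable_mult_right[OF integrable_inverse_square, of C]])
       (use C schwartz_measurable[OF assms] in auto)
qed

lemma schwartz_tendsto_zero:
  assumes "\<phi> \<in> schwartz" shows "(\<phi> \<longlongrightarrow> 0) at_top" and "(\<phi> \<longlongrightarrow> 0) at_bot"
proof -
  have *: "(\<phi> \<longlongrightarrow> 0) at_top" if \<phi>: "\<phi> \<in> schwartz" for \<phi>
  proof -
    obtain C where C: "0 \<le> C" "\<And>x. cmod (\<phi> x) \<le> C * inverse (1 + x\<^sup>2)"
      using rapidly_decreasing_bound[OF schwartz_derivative(3)[OF \<phi>]] by blast
    have "filterlim (\<lambda>x::real. x\<^sup>2) at_top at_top"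
      by (rule filterlim_pow_at_top[OF _ filterlim_ident]) simp
    then have "filterlim (\<lambda>x::real. 1 + x\<^sup>2) at_top at_top"
      by (rule filterlim_tendsto_add_at_top[OF tendsto_const])
    then have "((\<lambda>x. inverse (1 + x\<^sup>2) :: real) \<longlongrightarrow> 0) at_top"
      by (rule tendsto_inverse_0_at_top)
    then have lim: "((\<lambda>x. C * inverse (1 + x\<^sup>2)) \<longlongrightarrow> 0) at_top"
      by (rule tendsto_mult_right_zero)
    show ?thesis
      by (rule Lim_null_comparison[OF _ lim]) (use C(2) in simp)
  qed
  show "(\<phi> \<longlongrightarrow> 0) at_top" by (rule *[OF assms])
  show "(\<phi> \<longlongrightarrow> 0) at_bot"
    using *[OF schwartz_intros(6)[OF assms]] by (simp add: filterlim_at_bot_mirror)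
qed

section \<open>Synthesis from frequencies\<close>

definition spectral :: "real measure \<Rightarrow> (real \<Rightarrow> complex) \<Rightarrow> real \<Rightarrow> complex" where
  "spectral \<nu> g x = (LINT \<xi>|\<nu>. cis (\<xi> * x) * g \<xi>)"

lemma cis_measurable [measurable]: "cis \<in> borel_measurable borel"
  by (intro borel_measurable_continuous_onI continuous_intros)

lemma spectral_integrable:
  assumes "integrable \<nu> g" "sets \<nu> = sets borel"
  shows "integrable \<nu> (\<lambda>\<xi>. cis (\<xi> * x) * g \<xi>)"
proof (rule Bochner_Integration.integrable_bound[OF assms(1)])
  have [measurable]: "g \<in> borel_measurable \<nu>" using assms(1) by (rule borel_measurable_integrable)
  have [measurable]: "(\<lambda>\<xi>. cis (\<xi> * x)) \<in> borel_measurable \<nu>"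
    unfolding measurable_cong_sets[OF assms(2) refl] by measurable
  show "(\<lambda>\<xi>. cis (\<xi> * x) * g \<xi>) \<in> borel_measurable \<nu>" by measurable
qed (auto simp: norm_mult)

lemma spectral_bound:
  shows "cmod (spectral \<nu> g x) \<le> (LINT \<xi>|\<nu>. cmod (g \<xi>))"
proof -
  have "cmod (spectral \<nu> g x) \<le> (LINT \<xi>|\<nu>. cmod (cis (\<xi> * x) * g \<xi>))"
    unfolding spectral_def by (rule integral_norm_bound)
  then show ?thesis by (simp add: norm_mult)
qed

lemma cis_diff_bound: "cmod (cis a - cis b) \<le> \<bar>a - b\<bar>"
proof -
  have "(cmod (cis a - cis b))\<^sup>2 = 2 - 2 * cos (a - b)"
    by (simp add: cmod_power2 cos_diff power2_diff) (simp add: sin_squared_eq algebra_simps)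
  also have "\<dots> = (2 * sin ((a - b) / 2))\<^sup>2"
  proof -
    have e: "2 * ((a - b) / 2) = a - b" by simp
    show ?thesis using cos_double_sin[of "(a - b) / 2"] unfolding e by (simp add: power_mult_distrib)
  qed
  also have "\<dots> \<le> (\<bar>a - b\<bar>)\<^sup>2"
  proof -
    have "\<bar>2 * sin ((a - b) / 2)\<bar> \<le> \<bar>a - b\<bar>"
      using abs_sin_x_le_abs_x[of "(a - b) / 2"] by simp
    then show ?thesis by (metis abs_le_square_iff abs_idempotent)
  qed
  finally show ?thesis by (rule power2_le_imp_le) simp
qed

lemma spectral_has_vector_derivative:
  assumes \<nu>: "sets \<nu> = sets borel" and g: "g \<in> borel_measurable borel"
    and i: "integrable \<nu> (\<lambda>\<xi>. (1 + \<xi>\<^sup>2) * cmod (g \<xi>))"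
  shows "(spectral \<nu> g has_vector_derivative spectral \<nu> (\<lambda>\<xi>. \<i> * of_real \<xi> * g \<xi>) x) (at x)"
proof -
  note [measurable_cong] = \<nu>
  note [measurable] = g
  have b: "norm (g \<xi>) \<le> norm ((1 + \<xi>\<^sup>2) * cmod (g \<xi>))" for \<xi>
    using mult_right_mono[of 1 "1 + \<xi>\<^sup>2" "cmod (g \<xi>)"] by (simp add: abs_mult)
  have b1: "norm (\<bar>\<xi>\<bar> * cmod (g \<xi>)) \<le> norm ((1 + \<xi>\<^sup>2) * cmod (g \<xi>))" for \<xi>
  proof -
    have "0 \<le> (\<bar>\<xi>\<bar> - 1)\<^sup>2 + \<xi>\<^sup>2 + 1" by simp
    then have "\<bar>\<xi>\<bar> \<le> 1 + \<xi>\<^sup>2" by (simp add: power2_diff)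
    from mult_right_mono[OF this, of "cmod (g \<xi>)"] show ?thesis by (simp add: abs_mult)
  qed
  have gi: "integrable \<nu> g" by (rule Bochner_Integration.integrable_bound[OF i]) (use b in auto)
  have gi1: "integrable \<nu> (\<lambda>\<xi>. \<bar>\<xi>\<bar> * cmod (g \<xi>))"
    by (rule Bochner_Integration.integrable_bound[OF i]) (use b1 in \<open>auto simp del: norm_mult real_norm_def\<close>)
  define q where "q h = (spectral \<nu> g (x + h) - spectral \<nu> g x) / of_real h" for h
  define D where "D = spectral \<nu> (\<lambda>\<xi>. \<i> * of_real \<xi> * g \<xi>) x"
  have "(q \<longlongrightarrow> D) (at 0)"
    unfolding tendsto_at_iff_sequentially
  proof (intro allI impI)
    fix X :: "nat \<Rightarrow> real" assume X: "\<forall>i. X i \<in> UNIV - {0}" "X \<longlonglongrightarrow> 0"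
    let ?q = "\<lambda>n \<xi>. (cis (\<xi> * (x + X n)) - cis (\<xi> * x)) / of_real (X n)"
    have "(\<lambda>n. LINT \<xi>|\<nu>. ?q n \<xi> * g \<xi>) \<longlonglongrightarrow> (LINT \<xi>|\<nu>. \<i> * of_real \<xi> * cis (\<xi> * x) * g \<xi>)"
    proof (rule integral_dominated_convergence[OF _ _ gi1])
      show "(\<lambda>\<xi>. \<i> * of_real \<xi> * cis (\<xi> * x) * g \<xi>) \<in> borel_measurable \<nu>" by measurable
      show "(\<lambda>\<xi>. ?q n \<xi> * g \<xi>) \<in> borel_measurable \<nu>" for n by measurable
      show "AE \<xi> in \<nu>. norm (?q n \<xi> * g \<xi>) \<le> \<bar>\<xi>\<bar> * cmod (g \<xi>)" for n
      proof (rule AE_I2)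
        fix \<xi>
        have "cmod (?q n \<xi>) \<le> \<bar>\<xi>\<bar>"
          using cis_diff_bound[of "\<xi> * (x + X n)" "\<xi> * x"] X(1)
          by (simp add: norm_divide divide_le_eq abs_mult[symmetric] algebra_simps)
        then show "norm (?q n \<xi> * g \<xi>) \<le> \<bar>\<xi>\<bar> * cmod (g \<xi>)"
          unfolding norm_mult by (rule mult_right_mono) simp
      qed
      show "AE \<xi> in \<nu>. (\<lambda>n. ?q n \<xi> * g \<xi>) \<longlonglongrightarrow> \<i> * of_real \<xi> * cis (\<xi> * x) * g \<xi>"
      proof (rule AE_I2)
        fix \<xi>
        have c: "((\<lambda>h. (cos (\<xi> * (x + h)) - cos (\<xi> * x)) / h) \<longlongrightarrow> - sin (\<xi> * x) * \<xi>) (at 0)"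
          using DERIV_chain2[OF DERIV_cos DERIV_cmult_Id[of \<xi>], of x UNIV] by (simp add: DERIV_def)
        have s: "((\<lambda>h. (sin (\<xi> * (x + h)) - sin (\<xi> * x)) / h) \<longlongrightarrow> cos (\<xi> * x) * \<xi>) (at 0)"
          using DERIV_chain2[OF DERIV_sin DERIV_cmult_Id[of \<xi>], of x UNIV] by (simp add: DERIV_def)
        have "((\<lambda>h. (cis (\<xi> * (x + h)) - cis (\<xi> * x)) / of_real h) \<longlongrightarrow> \<i> * of_real \<xi> * cis (\<xi> * x)) (at 0)"
          using c s by (simp add: tendsto_complex_iff mult_ac)
        then have "(\<lambda>n. ?q n \<xi>) \<longlonglongrightarrow> \<i> * of_real \<xi> * cis (\<xi> * x)"
          using X unfolding tendsto_at_iff_sequentially comp_def by blast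
        then show "(\<lambda>n. ?q n \<xi> * g \<xi>) \<longlonglongrightarrow> \<i> * of_real \<xi> * cis (\<xi> * x) * g \<xi>"
          by (intro tendsto_intros)
      qed
    qed
    moreover have "(LINT \<xi>|\<nu>. ?q n \<xi> * g \<xi>) = q (X n)" for n
    proof -
      have "q (X n) = (LINT \<xi>|\<nu>. cis (\<xi> * (x + X n)) * g \<xi> - cis (\<xi> * x) * g \<xi>) / of_real (X n)"
        unfolding q_def spectral_def
        by (subst Bochner_Integration.integral_diff) (auto intro!: spectral_integrable gi \<nu>)
      also have "\<dots> = (LINT \<xi>|\<nu>. (cis (\<xi> * (x + X n)) * g \<xi> - cis (\<xi> * x) * g \<xi>) / of_real (X n))"
        by simp
      also have "\<dots> = (LINT \<xi>|\<nu>. ?q n \<xi> * g \<xi>)"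
        by (rule Bochner_Integration.integral_cong) (auto simp: diff_divide_distrib algebra_simps)
      finally show ?thesis by simp
    qed
    moreover have "(LINT \<xi>|\<nu>. \<i> * of_real \<xi> * cis (\<xi> * x) * g \<xi>) = D"
      unfolding D_def spectral_def by (simp add: mult_ac)
    ultimately show "(q \<circ> X) \<longlonglongrightarrow> D" by (simp add: comp_def)
  qed
  then have "((\<lambda>h. (Re (spectral \<nu> g (x + h)) - Re (spectral \<nu> g x)) / h) \<longlongrightarrow> Re D) (at 0)"
    and "((\<lambda>h. (Im (spectral \<nu> g (x + h)) - Im (spectral \<nu> g x)) / h) \<longlongrightarrow> Im D) (at 0)"
    by (auto simp: tendsto_complex_iff q_def)
  then show ?thesis
    unfolding has_vector_derivative_complex_iff D_def DERIV_def by simp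
qed

lemma spectral_continuous:
  assumes \<nu>: "sets \<nu> = sets borel" and g: "integrable \<nu> g"
  shows "continuous_on UNIV (spectral \<nu> g)"
proof -
  have "isCont (spectral \<nu> g) x" for x
    unfolding isCont_def tendsto_at_iff_sequentially
  proof (intro allI impI)
    fix X :: "nat \<Rightarrow> real" assume X: "X \<longlonglongrightarrow> x"
    have "(\<lambda>n. LINT \<xi>|\<nu>. cis (\<xi> * X n) * g \<xi>) \<longlonglongrightarrow> (LINT \<xi>|\<nu>. cis (\<xi> * x) * g \<xi>)"
    proof (rule integral_dominated_convergence[OF _ _ integrable_norm[OF g]])
      show "AE \<xi> in \<nu>. (\<lambda>n. cis (\<xi> * X n) * g \<xi>) \<longlonglongrightarrow> cis (\<xi> * x) * g \<xi>"
        using X by (intro AE_I2 tendsto_intros)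
    qed (auto simp: norm_mult intro!: borel_measurable_integrable spectral_integrable g \<nu>)
    then show "(spectral \<nu> g \<circ> X) \<longlonglongrightarrow> spectral \<nu> g x" by (simp add: spectral_def comp_def)
  qed
  then show ?thesis by (simp add: continuous_at_imp_continuous_on)
qed

text \<open>The multiplication formula: synthesis is its own transpose.\<close>

lemma spectral_Fubini:
  assumes \<nu>: "sets \<nu> = sets borel" and sf: "sigma_finite_measure \<nu>"
    and g: "integrable \<nu> g" and \<phi>: "integrable lborel \<phi>"
  shows "(LINT x|lborel. spectral \<nu> g x * \<phi> x) = (LINT \<xi>|\<nu>. g \<xi> * spectral lborel \<phi> \<xi>)"
proof -
  interpret pair_sigma_finite \<nu> lborel
    by (intro pair_sigma_finite.intro sf lborel.sigma_finite_measure_axioms)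
  note [measurable_cong] = \<nu>
  have [measurable]: "g \<in> borel_measurable \<nu>" "\<phi> \<in> borel_measurable lborel"
    using g \<phi> by auto
  have gm[measurable]: "g \<in> borel_measurable borel" using \<open>g \<in> borel_measurable \<nu>\<close> by measurable
  have \<phi>m[measurable]: "\<phi> \<in> borel_measurable borel" using \<open>\<phi> \<in> borel_measurable lborel\<close> by simp
  let ?f = "\<lambda>\<xi> x. cis (\<xi> * x) * g \<xi> * \<phi> x"
  have "integrable (\<nu> \<Otimes>\<^sub>M lborel) (\<lambda>(\<xi>, x). ?f \<xi> x)"
  proof (rule Fubini_integrable)
    show "(\<lambda>(\<xi>, x). ?f \<xi> x) \<in> borel_measurable (\<nu> \<Otimes>\<^sub>M lborel)" by measurable
    show "integrable \<nu> (\<lambda>\<xi>. LINT x|lborel. norm (case (\<xi>, x) of (\<xi>, x) \<Rightarrow> ?f \<xi> x))"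
      using g by (simp add: norm_mult)
    show "AE \<xi> in \<nu>. integrable lborel (\<lambda>x. case (\<xi>, x) of (\<xi>, x) \<Rightarrow> ?f \<xi> x)"
    proof (rule AE_I2)
      fix \<xi>
      have "integrable lborel (\<lambda>x. g \<xi> * (cis (x * \<xi>) * \<phi> x))"
        by (intro integrable_mult_right spectral_integrable \<phi>) simp
      then show "integrable lborel (\<lambda>x. case (\<xi>, x) of (\<xi>, x) \<Rightarrow> ?f \<xi> x)"
        by (simp add: mult_ac)
    qed
  qed
  from Fubini_integral[OF this]
  have fub: "(LINT x|lborel. LINT \<xi>|\<nu>. ?f \<xi> x) = (LINT \<xi>|\<nu>. LINT x|lborel. ?f \<xi> x)" .
  have e1: "(LINT \<xi>|\<nu>. ?f \<xi> x) = spectral \<nu> g x * \<phi> x" for x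
    unfolding spectral_def by simp
  have e2: "(LINT x|lborel. ?f \<xi> x) = g \<xi> * spectral lborel \<phi> \<xi>" for \<xi>
  proof -
    have "(LINT x|lborel. ?f \<xi> x) = (LINT x|lborel. g \<xi> * (cis (x * \<xi>) * \<phi> x))"
      by (simp add: mult_ac)
    then show ?thesis unfolding spectral_def by simp
  qed
  show ?thesis using fub unfolding e1 e2 .
qed

section \<open>The Fourier transform on the line\<close>

declare test_fun.simps [simp del]

lemma fourier_eq_spectral: "fourier \<phi> x = spectral lborel \<phi> (- x)"
  by (simp add: fourier_def spectral_def mult.commute)

lemma schwartz_weighted_integrable:
  assumes "\<phi> \<in> schwartz" shows "integrable lborel (\<lambda>\<xi>. (1 + \<xi>\<^sup>2) * cmod (\<phi> \<xi>))"
proof -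
  have "(\<lambda>\<xi>. \<phi> \<xi> + of_real \<xi> * (of_real \<xi> * \<phi> \<xi>)) \<in> schwartz"
    by (intro schwartz_intros assms)
  then have "integrable lborel (\<lambda>\<xi>. cmod (\<phi> \<xi> + of_real \<xi> * (of_real \<xi> * \<phi> \<xi>)))"
    by (intro integrable_norm schwartz_integrable)
  moreover have "cmod (\<phi> \<xi> + of_real \<xi> * (of_real \<xi> * \<phi> \<xi>)) = (1 + \<xi>\<^sup>2) * cmod (\<phi> \<xi>)" for \<xi>
  proof -
    have "\<phi> \<xi> + of_real \<xi> * (of_real \<xi> * \<phi> \<xi>) = of_real (1 + \<xi>\<^sup>2) * \<phi> \<xi>"
      by (simp add: power2_eq_square algebra_simps)
    then show ?thesis by (simp add: norm_mult del: of_real_add of_real_power)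
  qed
  ultimately show ?thesis by simp
qed

lemma fourier_has_vector_derivative:
  assumes "\<phi> \<in> schwartz"
  shows "(fourier \<phi> has_vector_derivative fourier (\<lambda>\<xi>. (- \<i>) * (of_real \<xi> * \<phi> \<xi>)) x) (at x)"
proof -
  have "(spectral lborel \<phi> has_vector_derivative spectral lborel (\<lambda>\<xi>. \<i> * of_real \<xi> * \<phi> \<xi>) (- x)) (at (- x))"
    by (rule spectral_has_vector_derivative)
       (auto intro: schwartz_measurable schwartz_weighted_integrable assms)
  moreover have "(uminus has_vector_derivative (- 1)) (at x)"
    by (auto intro!: derivative_eq_intros)
  ultimately have "((spectral lborel \<phi> \<circ> uminus) has_vector_derivative
      (- 1) *\<^sub>R spectral lborel (\<lambda>\<xi>. \<i> * of_real \<xi> * \<phi> \<xi>) (- x)) (at x)"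
    by (intro vector_diff_chain_at)
  moreover have "spectral lborel \<phi> \<circ> uminus = fourier \<phi>"
    by (auto simp: fourier_eq_spectral)
  moreover have "(- 1) *\<^sub>R spectral lborel (\<lambda>\<xi>. \<i> * of_real \<xi> * \<phi> \<xi>) (- x) =
      fourier (\<lambda>\<xi>. (- \<i>) * (of_real \<xi> * \<phi> \<xi>)) x"
    by (simp add: fourier_eq_spectral spectral_def mult_ac)
  ultimately show ?thesis by metis
qed

lemma fourier_D_x:
  assumes "\<phi> \<in> schwartz"
  shows "fourier (D_x \<phi>) x = \<i> * of_real x * fourier \<phi> x"
proof -
  have D: "D_x \<phi> \<in> schwartz" "\<And>\<xi>. (\<phi> has_vector_derivative D_x \<phi> \<xi>) (at \<xi>)"
    using schwartz_derivative[OF assms] by auto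
  let ?w = "\<lambda>\<xi>. cis ((- x) * \<xi>) * \<phi> \<xi>"
  let ?f = "\<lambda>\<xi>. cis ((- x) * \<xi>) * D_x \<phi> \<xi> + (- \<i> * of_real x) * (cis ((- x) * \<xi>) * \<phi> \<xi>)"
  have w: "?w \<in> schwartz" by (rule schwartz_intros(4)[OF assms])
  have i1: "integrable lborel (\<lambda>\<xi>. cis ((- x) * \<xi>) * D_x \<phi> \<xi>)"
    by (rule schwartz_integrable[OF schwartz_intros(4)[OF D(1)]])
  have i2: "integrable lborel (\<lambda>\<xi>. (- \<i> * of_real x) * (cis ((- x) * \<xi>) * \<phi> \<xi>))"
    by (rule schwartz_integrable[OF schwartz_intros(2)[OF w]])
  have "(LINT \<xi>|lborel. ?f \<xi>) = 0"
  proof (rule integral_real_line_zero_flux[OF _ _ schwartz_tendsto_zero[OF w]])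
    show "integrable lborel ?f" by (rule Bochner_Integration.integrable_add[OF i1 i2])
    fix \<xi>
    have "((\<lambda>\<xi>. cis ((- x) * \<xi>)) has_vector_derivative - \<i> * of_real x * cis ((- x) * \<xi>)) (at \<xi>)"
      by (auto simp: has_vector_derivative_complex_iff intro!: derivative_eq_intros)
    from has_vector_derivative_mult[OF this D(2)[of \<xi>]]
    show "(?w has_vector_derivative ?f \<xi>) (at \<xi>)" by (simp add: algebra_simps)
  qed
  then have "(LINT \<xi>|lborel. cis ((- x) * \<xi>) * D_x \<phi> \<xi>) + (- \<i> * of_real x) * (LINT \<xi>|lborel. cis ((- x) * \<xi>) * \<phi> \<xi>) = 0"
    using Bochner_Integration.integral_add[OF i1 i2] by simp
  then show ?thesis by (simp add: fourier_def add_eq_0_iff)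
qed

lemma fourier_bounded: "cmod (fourier \<phi> x) \<le> (LINT \<xi>|lborel. cmod (\<phi> \<xi>))"
  unfolding fourier_eq_spectral by (rule spectral_bound)

text \<open>Differentiation multiplies the transform by the frequency and vice versa, so the
  transforms of Schwartz functions are again closed under differentiation and rapidly
  decreasing.\<close>

lemma fourier_schwartz:
  assumes "\<phi> \<in> schwartz" shows "fourier \<phi> \<in> schwartz"
proof (rule schwartz_closure_subset[of _ "fourier ` schwartz"])
  show "fourier \<phi> \<in> schwartz_closure (fourier ` schwartz)"
    using assms by (intro schwartz_closure.base) auto
  fix f assume "f \<in> fourier ` schwartz"
  then obtain \<phi> where f: "f = fourier \<phi>" and \<phi>: "\<phi> \<in> schwartz" by auto
  have "fourier (\<lambda>\<xi>. (- \<i>) * (of_real \<xi> * \<phi> \<xi>)) \<in> schwartz_closure (fourier ` schwartz)"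
    by (intro schwartz_closure.base imageI schwartz_intros \<phi>)
  then show "\<exists>f'\<in>schwartz_closure (fourier ` schwartz). \<forall>x. (f has_vector_derivative f' x) (at x)"
    unfolding f using fourier_has_vector_derivative[OF \<phi>] by blast
  have "\<exists>C. \<forall>x. \<bar>x\<bar> ^ k * cmod (fourier \<phi> x) \<le> C" for k
    using \<phi>
  proof (induction k arbitrary: \<phi>)
    case 0
    then show ?case using fourier_bounded by auto
  next
    case (Suc k)
    obtain C where C: "\<And>x. \<bar>x\<bar> ^ k * cmod (fourier (D_x \<phi>) x) \<le> C"
      using Suc.IH[OF schwartz_derivative(1)[OF Suc.prems]] by blast
    have eq: "\<bar>x\<bar> ^ Suc k * cmod (fourier \<phi> x) = \<bar>x\<bar> ^ k * cmod (fourier (D_x \<phi>) x)" for x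
      unfolding fourier_D_x[OF Suc.prems] by (simp add: norm_mult)
    show ?case unfolding eq using C by blast
  qed
  then show "rapidly_decreasing f" by (simp add: rapidly_decreasing_def f)
qed

lemma gaussian_eq_density: "exp (- (x\<^sup>2 / 2)) = sqrt (2 * pi) * std_normal_density x"
  by (simp add: std_normal_density_def)

lemma gaussian_integrable: "integrable lborel (\<lambda>x::real. exp (- (x\<^sup>2 / 2)))"
  unfolding gaussian_eq_density by (intro integrable_mult_right integrable_normal_density) simp

lemma gaussian_integral: "(LINT x|lborel. exp (- (x\<^sup>2 / 2))) = sqrt (2 * pi)"
  unfolding gaussian_eq_density by (simp add: integral_normal_density)

lemma fourier_gaussian:
  "fourier (\<lambda>\<xi>. of_real (exp (- (\<xi>\<^sup>2 / 2)))) x = of_real (sqrt (2 * pi) * exp (- (x\<^sup>2 / 2)))"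
proof -
  have "(LINT \<xi>|std_normal_distribution. cis ((- x) * \<xi>)) = char std_normal_distribution (- x)"
    unfolding char_def by (simp add: cis_conv_exp mult_ac)
  also have "\<dots> = of_real (exp (- (x\<^sup>2 / 2)))"
    unfolding char_std_normal_distribution by simp
  also have "(LINT \<xi>|std_normal_distribution. cis ((- x) * \<xi>)) =
      (LINT \<xi>|lborel. std_normal_density \<xi> *\<^sub>R cis ((- x) * \<xi>))"
    by (rule integral_density) (auto simp: normal_density_nonneg)
  finally have "(LINT \<xi>|lborel. std_normal_density \<xi> *\<^sub>R cis ((- x) * \<xi>)) = of_real (exp (- (x\<^sup>2 / 2)))" .
  then have "of_real (sqrt (2 * pi)) * (LINT \<xi>|lborel. std_normal_density \<xi> *\<^sub>R cis ((- x) * \<xi>))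
      = of_real (sqrt (2 * pi) * exp (- (x\<^sup>2 / 2)))" by simp
  moreover have "fourier (\<lambda>\<xi>. of_real (exp (- (\<xi>\<^sup>2 / 2)))) x =
      of_real (sqrt (2 * pi)) * (LINT \<xi>|lborel. std_normal_density \<xi> *\<^sub>R cis ((- x) * \<xi>))"
    unfolding fourier_def gaussian_eq_density integral_mult_right_zero[symmetric]
    by (rule Bochner_Integration.integral_cong) (auto simp: scaleR_conv_of_real mult_ac)
  ultimately show ?thesis by simp
qed

lemma fourier_gaussian_scaled:
  assumes "\<epsilon> > 0"
  shows "(LINT x|lborel. cis (x * y) * of_real (exp (- ((\<epsilon> * x)\<^sup>2 / 2)))) =
     of_real (sqrt (2 * pi) / \<epsilon> * exp (- ((y / \<epsilon>)\<^sup>2 / 2)))"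
proof -
  have "(LINT x|lborel. cis (x * y) * of_real (exp (- ((\<epsilon> * x)\<^sup>2 / 2)))) =
      \<bar>1 / \<epsilon>\<bar> *\<^sub>R (LINT x|lborel. cis ((0 + 1 / \<epsilon> * x) * y) * of_real (exp (- ((\<epsilon> * (0 + 1 / \<epsilon> * x))\<^sup>2 / 2))))"
    using assms by (intro lborel_integral_real_affine) simp
  also have "(LINT x|lborel. cis ((0 + 1 / \<epsilon> * x) * y) * of_real (exp (- ((\<epsilon> * (0 + 1 / \<epsilon> * x))\<^sup>2 / 2)))) =
      fourier (\<lambda>\<xi>. of_real (exp (- (\<xi>\<^sup>2 / 2)))) (- (y / \<epsilon>))"
    unfolding fourier_def by (rule Bochner_Integration.integral_cong) (use assms in \<open>auto simp: mult_ac\<close>)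
  finally show ?thesis using assms unfolding fourier_gaussian by (simp add: scaleR_conv_of_real)
qed

text \<open>The Gaussian factor makes the double integral absolutely convergent even if
  \<open>fourier \<phi>\<close> is not integrable; by Fubini, inversion with this factor averages \<open>\<phi>\<close> over a
  Gaussian of width \<open>\<epsilon>\<close>.\<close>

lemma gaussian_regularized_inversion:
  assumes \<phi>i: "integrable lborel \<phi>" and e0: "\<epsilon> > 0"
  shows "spectral lborel (\<lambda>x. fourier \<phi> x * of_real (exp (- ((\<epsilon> * x)\<^sup>2 / 2)))) \<xi> =
      of_real (sqrt (2 * pi)) * (LINT y|lborel. \<phi> (\<xi> + \<epsilon> * y) * of_real (exp (- (y\<^sup>2 / 2))))"
proof -
  define G where "G x = exp (- ((\<epsilon> * x)\<^sup>2 / 2))" for x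
  let ?\<psi> = "\<lambda>x. cis (x * \<xi>) * of_real (G x)"
  have G0: "integrable lborel (\<lambda>x. of_real (G x) :: complex)"
  proof -
    have "(\<lambda>x. complex_of_real (exp (- (\<epsilon>\<^sup>2 / 2 * x\<^sup>2) + 0 * x))) \<in> schwartz"
      by (rule schwartz_gaussian) (use e0 in simp)
    from schwartz_integrable[OF this] show ?thesis by (simp add: G_def power_mult_distrib)
  qed
  have \<psi>i: "integrable lborel ?\<psi>" by (rule spectral_integrable[OF G0]) simp
  have \<psi>r: "integrable lborel (\<lambda>x. ?\<psi> (- x))"
    using lborel_integrable_real_affine[OF \<psi>i, of "- 1" 0] by simp
  have kernel: "spectral lborel (\<lambda>x. ?\<psi> (- x)) \<eta> =
      of_real (sqrt (2 * pi) / \<epsilon> * exp (- (((\<eta> - \<xi>) / \<epsilon>)\<^sup>2 / 2)))" for \<eta>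
  proof -
    have "spectral lborel (\<lambda>x. ?\<psi> (- x)) \<eta> =
        (LINT x|lborel. cis (x * (\<eta> - \<xi>)) * of_real (exp (- ((\<epsilon> * x)\<^sup>2 / 2))))"
      unfolding spectral_def
      by (rule Bochner_Integration.integral_cong) (auto simp: G_def mult.assoc[symmetric] cis_mult algebra_simps)
    then show ?thesis unfolding fourier_gaussian_scaled[OF e0] .
  qed
  have "spectral lborel (\<lambda>x. fourier \<phi> x * of_real (G x)) \<xi> =
      (LINT x|lborel. spectral lborel \<phi> (- x) * ?\<psi> x)"
    unfolding spectral_def[of _ _ \<xi>] by (simp add: fourier_eq_spectral mult_ac)
  also have "\<dots> = (LINT x|lborel. spectral lborel \<phi> x * ?\<psi> (- x))"
    using lborel_integral_real_affine[of "- 1" "\<lambda>x. spectral lborel \<phi> (- x) * ?\<psi> x" 0] by simp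
  also have "\<dots> = (LINT \<eta>|lborel. \<phi> \<eta> * spectral lborel (\<lambda>x. ?\<psi> (- x)) \<eta>)"
    by (rule spectral_Fubini[OF _ _ \<phi>i \<psi>r]) (auto intro: lborel.sigma_finite_measure_axioms)
  also have "\<dots> = (LINT \<eta>|lborel. \<phi> \<eta> * of_real (sqrt (2 * pi) / \<epsilon> * exp (- (((\<eta> - \<xi>) / \<epsilon>)\<^sup>2 / 2))))"
    unfolding kernel ..
  also have "\<dots> = \<bar>\<epsilon>\<bar> *\<^sub>R (LINT y|lborel. \<phi> (\<xi> + \<epsilon> * y) *
        of_real (sqrt (2 * pi) / \<epsilon> * exp (- (((\<xi> + \<epsilon> * y - \<xi>) / \<epsilon>)\<^sup>2 / 2))))"
    by (rule lborel_integral_real_affine) (use e0 in simp)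
  also have "\<dots> = (LINT y|lborel. of_real (sqrt (2 * pi)) * (\<phi> (\<xi> + \<epsilon> * y) * of_real (exp (- (y\<^sup>2 / 2)))))"
    unfolding integral_scaleR_right[symmetric]
    by (rule Bochner_Integration.integral_cong) (use e0 in \<open>auto simp: scaleR_conv_of_real\<close>)
  finally show ?thesis by (simp add: G_def)
qed

text \<open>Let \<open>\<epsilon> \<rightarrow> 0\<close> in the regularised formula.\<close>

theorem fourier_inversion:
  fixes \<phi> :: "real \<Rightarrow> complex"
  assumes "\<phi> \<in> schwartz"
  shows "spectral lborel (fourier \<phi>) \<xi> = 2 * pi * \<phi> \<xi>"
proof -
  define G where "G n x = exp (- ((inverse (real (Suc n)) * x)\<^sup>2 / 2))" for n x
  have \<phi>i: "integrable lborel \<phi>" and \<phi>m[measurable]: "\<phi> \<in> borel_measurable borel"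
    using schwartz_integrable schwartz_measurable assms by auto
  have Fi: "integrable lborel (fourier \<phi>)" and Fm[measurable]: "fourier \<phi> \<in> borel_measurable borel"
    using schwartz_integrable schwartz_measurable fourier_schwartz[OF assms] by auto
  have e0: "inverse (real (Suc n)) > 0" for n by simp
  have eps: "(\<lambda>n. inverse (real (Suc n))) \<longlonglongrightarrow> 0"
    by (rule LIMSEQ_inverse_real_of_nat)
  have lhs: "(\<lambda>n. LINT x|lborel. cis (x * \<xi>) * fourier \<phi> x * of_real (G n x))
      \<longlonglongrightarrow> (LINT x|lborel. cis (x * \<xi>) * fourier \<phi> x)"
  proof (rule integral_dominated_convergence[OF _ _ integrable_norm[OF Fi]])
    show "AE x in lborel. (\<lambda>n. cis (x * \<xi>) * fourier \<phi> x * of_real (G n x)) \<longlonglongrightarrow> cis (x * \<xi>) * fourier \<phi> x"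
    proof (rule AE_I2)
      fix x :: real
      have "(\<lambda>n. G n x) \<longlonglongrightarrow> exp (- ((0 * x)\<^sup>2 / 2))"
        unfolding G_def by (intro tendsto_intros eps) auto
      then have "(\<lambda>n. of_real (G n x) :: complex) \<longlonglongrightarrow> of_real 1" by (intro tendsto_of_real) simp
      from tendsto_mult_left[OF this, of "cis (x * \<xi>) * fourier \<phi> x"]
      show "(\<lambda>n. cis (x * \<xi>) * fourier \<phi> x * of_real (G n x)) \<longlonglongrightarrow> cis (x * \<xi>) * fourier \<phi> x"
        by simp
    qed
    show "AE x in lborel. norm (cis (x * \<xi>) * fourier \<phi> x * of_real (G n x)) \<le> norm (fourier \<phi> x)" for n
      by (rule AE_I2) (auto simp: norm_mult G_def intro!: mult_left_le)
  qed (auto simp: G_def)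
  have step: "(LINT x|lborel. cis (x * \<xi>) * fourier \<phi> x * of_real (G n x)) =
      of_real (sqrt (2 * pi)) * (LINT y|lborel. \<phi> (\<xi> + inverse (real (Suc n)) * y) * of_real (exp (- (y\<^sup>2 / 2))))" for n
    using gaussian_regularized_inversion[OF \<phi>i e0] unfolding spectral_def G_def mult.assoc .
  obtain C where C: "\<And>x. cmod (\<phi> x) \<le> C"
    using schwartz_derivative(3)[OF assms] unfolding rapidly_decreasing_def by (metis mult_1 power_0)
  have "(\<lambda>n. LINT y|lborel. \<phi> (\<xi> + inverse (real (Suc n)) * y) * of_real (exp (- (y\<^sup>2 / 2))))
      \<longlonglongrightarrow> (LINT y|lborel. \<phi> \<xi> * of_real (exp (- (y\<^sup>2 / 2))))"
  proof (rule integral_dominated_convergence[where w = "\<lambda>y. C * exp (- (y\<^sup>2 / 2))"])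
    show "integrable lborel (\<lambda>y::real. C * exp (- (y\<^sup>2 / 2)))"
      by (rule integrable_mult_right[OF gaussian_integrable])
    show "AE y in lborel. norm (\<phi> (\<xi> + inverse (real (Suc n)) * y) * of_real (exp (- (y\<^sup>2 / 2)))) \<le> C * exp (- (y\<^sup>2 / 2))" for n
      using C by (intro AE_I2) (simp add: norm_mult)
    show "AE y in lborel. (\<lambda>n. \<phi> (\<xi> + inverse (real (Suc n)) * y) * of_real (exp (- (y\<^sup>2 / 2))))
        \<longlonglongrightarrow> \<phi> \<xi> * of_real (exp (- (y\<^sup>2 / 2)))"
    proof (rule AE_I2)
      fix y :: real
      have "(\<lambda>n. \<xi> + inverse (real (Suc n)) * y) \<longlonglongrightarrow> \<xi> + 0 * y"
        by (intro tendsto_intros eps)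
      moreover have "isCont \<phi> \<xi>"
        using schwartz_derivative(2)[OF assms] by (rule has_vector_derivative_continuous)
      ultimately have "(\<lambda>n. \<phi> (\<xi> + inverse (real (Suc n)) * y)) \<longlonglongrightarrow> \<phi> \<xi>"
        by (intro isCont_tendsto_compose[of \<xi> \<phi>]) auto
      then show "(\<lambda>n. \<phi> (\<xi> + inverse (real (Suc n)) * y) * of_real (exp (- (y\<^sup>2 / 2))))
        \<longlonglongrightarrow> \<phi> \<xi> * of_real (exp (- (y\<^sup>2 / 2)))" by (rule tendsto_mult_right)
    qed
  qed measurable
  from tendsto_mult_left[OF this, of "of_real (sqrt (2 * pi))"]
  have "(\<lambda>n. LINT x|lborel. cis (x * \<xi>) * fourier \<phi> x * of_real (G n x))
      \<longlonglongrightarrow> of_real (sqrt (2 * pi)) * (LINT y|lborel. \<phi> \<xi> * of_real (exp (- (y\<^sup>2 / 2))))"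
    unfolding step .
  from LIMSEQ_unique[OF lhs this]
  have "spectral lborel (fourier \<phi>) \<xi> = of_real (sqrt (2 * pi)) * (\<phi> \<xi> * of_real (LINT y|lborel. exp (- (y\<^sup>2 / 2))))"
    by (simp add: spectral_def)
  also have "\<dots> = of_real (sqrt (2 * pi) * sqrt (2 * pi)) * \<phi> \<xi>"
    unfolding gaussian_integral by (simp only: of_real_mult mult_ac)
  also have "sqrt (2 * pi) * sqrt (2 * pi) = 2 * pi" by simp
  finally show ?thesis by simp
qed

text \<open>The sets over which \<open>m\<close> integrates to \<open>0\<close> form a Dynkin system that contains the
  intervals.\<close>

lemma AE_zero_if_interval_integrals_zero:
  fixes m :: "real \<Rightarrow> complex"
  assumes m: "integrable lborel m"
    and z: "\<And>c d. (LINT x|lborel. indicator {c..d} x *\<^sub>R m x) = 0"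
  shows "AE x in lborel. m x = 0"
proof (rule sigma_finite_measure.density_zero[OF lborel.sigma_finite_measure_axioms m])
  have int: "integrable lborel (\<lambda>x. indicator A x *\<^sub>R m x)" if "A \<in> sets borel" for A
    by (rule integrable_mult_indicator) (use that m in auto)
  have total: "(LINT x|lborel. m x) = 0"
  proof -
    have "(\<lambda>n. LINT x|lborel. indicator {- real n..real n} x *\<^sub>R m x) \<longlonglongrightarrow> (LINT x|lborel. m x)"
    proof (rule integral_dominated_convergence[OF _ _ integrable_norm[OF m]])
      show "AE x in lborel. (\<lambda>n. indicator {- real n..real n} x *\<^sub>R m x) \<longlonglongrightarrow> m x"
      proof (rule AE_I2, rule tendsto_eventually)
        fix x :: real
        obtain N :: nat where "\<bar>x\<bar> \<le> real N" using real_arch_simple by blast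
        then show "\<forall>\<^sub>F n in sequentially. indicator {- real n..real n} x *\<^sub>R m x = m x"
          by (auto simp: eventually_sequentially indicator_def intro!: exI[of _ N])
      qed
    qed (use m int in \<open>auto simp: indicator_def\<close>)
    then show ?thesis unfolding z by (simp add: LIMSEQ_const_iff)
  qed
  fix A :: "real set" assume "A \<in> sets lborel"
  then have A: "A \<in> sigma_sets UNIV (range (\<lambda>(a, b). {a..b}))"
    by (simp add: borel_eq_atLeastAtMost)
  have S: "sigma_sets UNIV (range (\<lambda>(a, b). {a..b})) = sets (borel :: real measure)"
    by (simp add: borel_eq_atLeastAtMost)
  have I: "Int_stable (range (\<lambda>(a, b). {a..b :: real}))"
  proof (rule Int_stableI_image)
    fix i j :: "real \<times> real"
    show "\<exists>k\<in>UNIV. (case i of (a, b) \<Rightarrow> {a..b}) \<inter> (case j of (a, b) \<Rightarrow> {a..b}) = (case k of (a, b) \<Rightarrow> {a..b})"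
      by (intro bexI[of _ "(max (fst i) (fst j), min (snd i) (snd j))"]) (auto split: prod.splits)
  qed
  have P: "range (\<lambda>(a, b). {a..b :: real}) \<subseteq> Pow UNIV" by simp
  from I P A have "(LINT x|lborel. indicator A x *\<^sub>R m x) = 0"
  proof (induction rule: sigma_sets_induct_disjoint)
    case (basic A)
    then show ?case using z by auto
  next
    case (compl A)
    have "(LINT x|lborel. indicator (UNIV - A) x *\<^sub>R m x) = (LINT x|lborel. m x - indicator A x *\<^sub>R m x)"
      by (rule Bochner_Integration.integral_cong) (auto simp: indicator_def)
    also have "\<dots> = (LINT x|lborel. m x) - (LINT x|lborel. indicator A x *\<^sub>R m x)"
      by (rule Bochner_Integration.integral_diff[OF m int]) (use compl S in auto)
    finally show ?case using total compl by simp
  next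
    case (union A)
    have "set_lebesgue_integral lborel (\<Union>i. A i) m = (\<Sum>i. set_lebesgue_integral lborel (A i) m)"
    proof (rule lebesgue_integral_countable_add)
      show "\<And>i. A i \<in> sets lborel" using union S by auto
      show "\<And>i j. i \<noteq> j \<Longrightarrow> A i \<inter> A j = {}" using union by (auto simp: disjoint_family_on_def)
      show "set_integrable lborel (\<Union>i. A i) m"
        unfolding set_integrable_def by (rule int) (use union S in auto)
    qed
    then show ?case using union by (simp add: set_lebesgue_integral_def)
  qed auto
  then show "set_lebesgue_integral lborel A m = 0" by (simp add: set_lebesgue_integral_def)
qed

text \<open>By the multiplication formula \<open>m\<close> is orthogonal to the transform of every integrable
  function. The Gaussian averages \<open>K n\<close> of an indicator function are such transforms, and
  they converge to the indicator function.\<close>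

lemma fourier_uniqueness:
  assumes m: "integrable lborel m" and z: "\<And>x. spectral lborel m x = 0"
  shows "AE x in lborel. m x = 0"
proof (rule AE_zero_if_interval_integrals_zero[OF m])
  fix c d :: real
  have [measurable]: "m \<in> borel_measurable borel" using m by auto
  let ?I = "\<lambda>x. indicator {c..d} x :: complex"
  have Ii: "integrable lborel ?I"
  proof (rule Bochner_Integration.integrable_bound)
    show "integrable lborel (indicator {c..d} :: real \<Rightarrow> real)"
      by (rule integrable_real_indicator) (auto simp: emeasure_lborel_Icc_eq)
  qed (auto simp: indicator_def)
  define K where "K n \<xi> = (LINT y|lborel. ?I (\<xi> + inverse (real (Suc n)) * y) * of_real (exp (- (y\<^sup>2 / 2))))" for n \<xi>
  have eps: "(\<lambda>n. inverse (real (Suc n))) \<longlonglongrightarrow> 0" by (rule LIMSEQ_inverse_real_of_nat)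
  let ?\<phi> = "\<lambda>n x. fourier ?I x * of_real (exp (- ((inverse (real (Suc n)) * x)\<^sup>2 / 2)))"
  have KS: "spectral lborel (?\<phi> n) \<xi> = of_real (sqrt (2 * pi)) * K n \<xi>" for n \<xi>
    unfolding K_def by (rule gaussian_regularized_inversion[OF Ii]) simp
  have Fc: "continuous_on UNIV (fourier ?I)"
  proof -
    have "continuous_on UNIV (\<lambda>x. spectral lborel ?I (- x))"
      by (rule continuous_on_compose2[OF spectral_continuous[OF _ Ii]]) (auto intro!: continuous_intros)
    then show ?thesis by (simp add: fourier_eq_spectral[abs_def])
  qed
  have [measurable]: "fourier ?I \<in> borel_measurable borel"
    by (rule borel_measurable_continuous_onI[OF Fc])
  have \<phi>i: "integrable lborel (?\<phi> n)" for n
  proof (rule Bochner_Integration.integrable_bound)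
    have "(\<lambda>x. complex_of_real (exp (- ((inverse (real (Suc n)))\<^sup>2 / 2 * x\<^sup>2) + 0 * x))) \<in> schwartz"
      by (rule schwartz_gaussian) simp
    from integrable_mult_right[OF schwartz_integrable[OF this], of "of_real (LINT \<xi>|lborel. cmod (?I \<xi>))"]
    show "integrable lborel (\<lambda>x. of_real (LINT \<xi>|lborel. cmod (?I \<xi>)) * complex_of_real (exp (- ((inverse (real (Suc n)) * x)\<^sup>2 / 2))))"
      by (simp add: power_mult_distrib del: of_nat_Suc)
    show "AE x in lborel. norm (?\<phi> n x) \<le> norm (of_real (LINT \<xi>|lborel. cmod (?I \<xi>)) * complex_of_real (exp (- ((inverse (real (Suc n)) * x)\<^sup>2 / 2))))"
      unfolding norm_mult by (intro AE_I2 mult_right_mono) (use fourier_bounded[of ?I] in auto)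
  qed measurable
  have zero: "(LINT \<xi>|lborel. m \<xi> * K n \<xi>) = 0" for n
  proof -
    have "(LINT x|lborel. spectral lborel m x * ?\<phi> n x) = (LINT \<xi>|lborel. m \<xi> * spectral lborel (?\<phi> n) \<xi>)"
      by (rule spectral_Fubini[OF _ _ m \<phi>i]) (auto intro: lborel.sigma_finite_measure_axioms)
    also have "\<dots> = (LINT \<xi>|lborel. of_real (sqrt (2 * pi)) * (m \<xi> * K n \<xi>))"
      unfolding KS by (simp add: mult_ac)
    finally show ?thesis using z by simp
  qed
  have [measurable]: "K n \<in> borel_measurable borel" for n
    unfolding K_def[abs_def] by measurable
  have Kb: "cmod (K n \<xi>) \<le> sqrt (2 * pi)" for n \<xi>
  proof -
    have "cmod (K n \<xi>) \<le> (LINT y|lborel. cmod (?I (\<xi> + inverse (real (Suc n)) * y) * of_real (exp (- (y\<^sup>2 / 2)))))"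
      unfolding K_def by (rule integral_norm_bound)
    also have "\<dots> \<le> (LINT y|lborel. exp (- (y\<^sup>2 / 2)))"
    proof (rule integral_mono_AE'[OF gaussian_integrable])
      show "AE y in lborel. cmod (?I (\<xi> + inverse (real (Suc n)) * y) * of_real (exp (- (y\<^sup>2 / 2)))) \<le> exp (- (y\<^sup>2 / 2))"
        by (rule AE_I2) (simp add: norm_mult indicator_def)
    qed auto
    finally show ?thesis unfolding gaussian_integral .
  qed
  have Klim: "(\<lambda>n. K n \<xi>) \<longlonglongrightarrow> of_real (sqrt (2 * pi)) * ?I \<xi>" if "\<xi> \<noteq> c" "\<xi> \<noteq> d" for \<xi>
  proof -
    have "(\<lambda>n. K n \<xi>) \<longlonglongrightarrow> (LINT y|lborel. ?I \<xi> * of_real (exp (- (y\<^sup>2 / 2))))"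
      unfolding K_def
    proof (rule integral_dominated_convergence[OF _ _ gaussian_integrable])
      show "AE y in lborel. (\<lambda>n. ?I (\<xi> + inverse (real (Suc n)) * y) * of_real (exp (- (y\<^sup>2 / 2))))
          \<longlonglongrightarrow> ?I \<xi> * of_real (exp (- (y\<^sup>2 / 2)))"
      proof (rule AE_I2, rule tendsto_mult_right)
        fix y :: real
        have "(\<lambda>n. \<xi> + inverse (real (Suc n)) * y) \<longlonglongrightarrow> \<xi> + 0 * y" by (intro tendsto_intros eps)
        then have l: "(\<lambda>n. \<xi> + inverse (real (Suc n)) * y) \<longlonglongrightarrow> \<xi>" by simp
        show "(\<lambda>n. ?I (\<xi> + inverse (real (Suc n)) * y)) \<longlonglongrightarrow> ?I \<xi>"
        proof (cases "\<xi> \<in> {c..d}")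
          case True
          then have "\<xi> \<in> {c<..<d}" using that by auto
          from topological_tendstoD[OF l open_greaterThanLessThan this] True
          show ?thesis by (intro tendsto_eventually) (auto elim!: eventually_mono)
        next
          case False
          then have "\<xi> \<in> - {c..d}" by auto
          from topological_tendstoD[OF l _ this] False
          show ?thesis by (intro tendsto_eventually) (auto elim!: eventually_mono simp: open_Compl)
        qed
      qed
    qed (auto simp: norm_mult indicator_def)
    also have "(LINT y|lborel. ?I \<xi> * of_real (exp (- (y\<^sup>2 / 2)))) = of_real (sqrt (2 * pi)) * ?I \<xi>"
      by (simp add: gaussian_integral)
    finally show ?thesis .
  qed
  have "(\<lambda>n. LINT \<xi>|lborel. m \<xi> * K n \<xi>) \<longlonglongrightarrow> (LINT \<xi>|lborel. m \<xi> * (of_real (sqrt (2 * pi)) * ?I \<xi>))"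
  proof (rule integral_dominated_convergence[where w = "\<lambda>\<xi>. cmod (m \<xi>) * sqrt (2 * pi)"])
    show "integrable lborel (\<lambda>\<xi>. cmod (m \<xi>) * sqrt (2 * pi))"
      using m by (intro integrable_mult_left integrable_norm)
    show "AE \<xi> in lborel. norm (m \<xi> * K n \<xi>) \<le> cmod (m \<xi>) * sqrt (2 * pi)" for n
      unfolding norm_mult by (intro AE_I2 mult_left_mono Kb) auto
    have "AE \<xi> in lborel. \<xi> \<noteq> c \<and> \<xi> \<noteq> d"
      by (intro AE_conjI AE_lborel_singleton)
    then show "AE \<xi> in lborel. (\<lambda>n. m \<xi> * K n \<xi>) \<longlonglongrightarrow> m \<xi> * (of_real (sqrt (2 * pi)) * ?I \<xi>)"
      by eventually_elim (intro tendsto_mult_left Klim; simp)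
  qed measurable
  then have "0 = (LINT \<xi>|lborel. m \<xi> * (of_real (sqrt (2 * pi)) * ?I \<xi>))"
    unfolding zero LIMSEQ_const_iff .
  also have "\<dots> = of_real (sqrt (2 * pi)) * (LINT \<xi>|lborel. indicator {c..d} \<xi> *\<^sub>R m \<xi>)"
    unfolding integral_mult_right_zero[symmetric]
    by (rule Bochner_Integration.integral_cong) (auto simp: indicator_def)
  finally show "(LINT x|lborel. indicator {c..d} x *\<^sub>R m x) = 0" by simp
qed

text \<open>Since \<open>k\<close> need not be integrable, the previous lemma is applied to its product with
  a Gaussian.\<close>

lemma schwartz_dual_uniqueness:
  assumes [measurable]: "k \<in> borel_measurable borel"
    and i: "\<And>\<phi>. \<phi> \<in> schwartz \<Longrightarrow> integrable lborel (\<lambda>x. k x * \<phi> x)"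
    and z: "\<And>\<phi>. \<phi> \<in> schwartz \<Longrightarrow> (LINT x|lborel. k x * \<phi> x) = 0"
  shows "AE x in lborel. k x = 0"
proof -
  have G: "(\<lambda>x. of_real (exp (- (x\<^sup>2 / 2)))) \<in> schwartz"
    using schwartz_gaussian[of "1/2" 0] by simp
  have "AE x in lborel. k x * of_real (exp (- (x\<^sup>2 / 2))) = 0"
  proof (rule fourier_uniqueness[OF i[OF G]])
    fix x
    have "(\<lambda>\<xi>. cis (x * \<xi>) * of_real (exp (- (\<xi>\<^sup>2 / 2)))) \<in> schwartz"
      by (rule schwartz_intros(4)[OF G])
    from z[OF this] show "spectral lborel (\<lambda>x. k x * of_real (exp (- (x\<^sup>2 / 2)))) x = 0"
      by (simp add: spectral_def mult_ac)
  qed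
  then show ?thesis by eventually_elim simp
qed

lemma has_fourier_unique:
  assumes "has_fourier u g" "has_fourier u g'" shows "AE \<xi> in lborel. g \<xi> = g' \<xi>"
proof -
  have [measurable]: "g \<in> borel_measurable borel" "g' \<in> borel_measurable borel"
    using assms by (auto simp: has_fourier_def)
  have "AE \<xi> in lborel. g \<xi> - g' \<xi> = 0"
    by (rule schwartz_dual_uniqueness)
       (use assms in \<open>auto simp: has_fourier_def left_diff_distrib\<close>)
  then show ?thesis by eventually_elim simp
qed

lemma continuous_AE_zero_imp_zero:
  fixes k :: "real \<Rightarrow> complex"
  assumes c: "continuous_on UNIV k" and z: "AE x in lborel. k x = 0"
  shows "k x = 0"
proof (rule ccontr)
  assume "k x \<noteq> 0"
  have o: "open {x. k x \<noteq> 0}"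
    using open_Collect_neq[OF c continuous_on_const] by simp
  have [measurable]: "k \<in> borel_measurable borel" by (rule borel_measurable_continuous_onI[OF c])
  have "{x. k x \<noteq> 0} \<in> null_sets lborel"
    using z AE_iff_null[of lborel "\<lambda>x. k x = 0"] borel_open[OF o] by simp
  then have "negligible {x. k x \<noteq> 0}"
    by (simp add: negligible_iff_null_sets null_sets_completionI)
  with open_not_negligible[OF o] \<open>k x \<noteq> 0\<close> show False by auto
qed

text \<open>Every Schwartz function \<open>\<psi>\<close> is the transform of some \<open>\<phi>\<close>, so \<open>u \<psi>\<close> can be computed
  from \<open>U\<close> and from \<open>g\<close>. Hence \<open>U\<close> and the synthesis of \<open>g\<close> agree almost everywhere, and
  both are continuous.\<close>

lemma line_fourier_representation:
  assumes rep: "represents Real_Line U u" and c: "continuous_on UNIV U"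
    and g: "has_fourier u g" and gi: "integrable lborel g"
  shows "of_real (U x) = of_real (1 / (2 * pi)) * spectral lborel g x"
proof -
  let ?W = "\<lambda>x. of_real (1 / (2 * pi)) * spectral lborel g x"
  let ?k = "\<lambda>x. of_real (U x) - ?W x"
  have cW: "continuous_on UNIV ?W"
    by (intro continuous_intros spectral_continuous gi) simp
  have ck: "continuous_on UNIV ?k"
    by (intro continuous_intros c spectral_continuous gi) simp
  have [measurable]: "?W \<in> borel_measurable borel" by (rule borel_measurable_continuous_onI[OF cW])
  have "AE x in lborel. ?k x = 0"
  proof (rule schwartz_dual_uniqueness)
    show "?k \<in> borel_measurable borel" by (rule borel_measurable_continuous_onI[OF ck])
    fix \<psi> assume \<psi>: "\<psi> \<in> schwartz"
    have [measurable]: "\<psi> \<in> borel_measurable borel" by (rule schwartz_measurable[OF \<psi>])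
    have \<psi>i: "integrable lborel \<psi>" by (rule schwartz_integrable[OF \<psi>])
    have iU: "integrable lborel (\<lambda>x. of_real (U x) * \<psi> x)" and uU: "u \<psi> = (LINT x|lborel. of_real (U x) * \<psi> x)"
      using rep \<psi> by (auto simp: represents_def fun_domain_def set_integrable_def set_lebesgue_integral_def)
    have iW: "integrable lborel (\<lambda>x. ?W x * \<psi> x)"
    proof (rule Bochner_Integration.integrable_bound)
      show "integrable lborel (\<lambda>x. of_real (1 / (2 * pi) * (LINT \<xi>|lborel. cmod (g \<xi>))) * \<psi> x)"
        by (rule integrable_mult_right[OF \<psi>i])
      show "AE x in lborel. norm (?W x * \<psi> x) \<le> norm (of_real (1 / (2 * pi) * (LINT \<xi>|lborel. cmod (g \<xi>))) * \<psi> x)"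
        unfolding norm_mult
        by (intro AE_I2 mult_right_mono) (use spectral_bound[of lborel g] in \<open>auto simp: norm_divide divide_right_mono\<close>)
    qed measurable
    let ?\<phi> = "\<lambda>\<xi>. of_real (1 / (2 * pi)) * fourier \<psi> (- \<xi>)"
    have \<phi>: "?\<phi> \<in> schwartz"
      by (rule schwartz_intros(2)[OF schwartz_intros(6)[OF fourier_schwartz[OF \<psi>]]])
    have "fourier ?\<phi> = \<psi>"
    proof
      fix x
      have "fourier ?\<phi> x = of_real (1 / (2 * pi)) * (LINT \<xi>|lborel. cis (- (x * \<xi>)) * fourier \<psi> (- \<xi>))"
        unfolding fourier_def[of ?\<phi>] by (simp add: mult.left_commute)
      also have "(LINT \<xi>|lborel. cis (- (x * \<xi>)) * fourier \<psi> (- \<xi>)) = spectral lborel (fourier \<psi>) x"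
        using lborel_integral_real_affine[of "- 1" "\<lambda>\<xi>. cis (\<xi> * x) * fourier \<psi> \<xi>" 0]
        by (simp add: spectral_def mult.commute)
      finally show "fourier ?\<phi> x = \<psi> x" unfolding fourier_inversion[OF \<psi>] by simp
    qed
    then have "u \<psi> = (LINT \<xi>|lborel. g \<xi> * ?\<phi> \<xi>)"
      using g \<phi> unfolding has_fourier_def by metis
    also have "\<dots> = of_real (1 / (2 * pi)) * (LINT \<xi>|lborel. g \<xi> * spectral lborel \<psi> \<xi>)"
      unfolding integral_mult_right_zero[symmetric]
      by (rule Bochner_Integration.integral_cong) (auto simp: fourier_eq_spectral)
    also have "(LINT \<xi>|lborel. g \<xi> * spectral lborel \<psi> \<xi>) = (LINT x|lborel. spectral lborel g x * \<psi> x)"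
      by (rule spectral_Fubini[symmetric, OF _ _ gi \<psi>i]) (auto intro: lborel.sigma_finite_measure_axioms)
    finally have uW: "u \<psi> = (LINT x|lborel. ?W x * \<psi> x)"
      unfolding integral_mult_right_zero[symmetric] by (simp add: mult.assoc)
    show "integrable lborel (\<lambda>x. ?k x * \<psi> x)"
      unfolding left_diff_distrib by (rule Bochner_Integration.integrable_diff[OF iU iW])
    show "(LINT x|lborel. ?k x * \<psi> x) = 0"
      unfolding left_diff_distrib Bochner_Integration.integral_diff[OF iU iW] using uU uW by simp
  qed
  from continuous_AE_zero_imp_zero[OF ck this, of x] show ?thesis by simp
qed

lemma has_fourier_of_synthesis:
  assumes gi: "integrable lborel g" and gm: "g \<in> borel_measurable borel"
    and u: "\<And>\<phi>. \<phi> \<in> schwartz \<Longrightarrow> u \<phi> = of_real (1 / (2 * pi)) * (LINT x|lborel. spectral lborel g x * \<phi> x)"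
  shows "has_fourier u g"
  unfolding has_fourier_def
proof (intro conjI ballI)
  show "g \<in> borel_measurable lborel" using gm by simp
  fix \<phi> assume \<phi>: "\<phi> \<in> schwartz"
  have [measurable]: "\<phi> \<in> borel_measurable borel" by (rule schwartz_measurable[OF \<phi>])
  note [measurable] = gm
  obtain C where C: "\<And>x. cmod (\<phi> x) \<le> C"
    using schwartz_derivative(3)[OF \<phi>] unfolding rapidly_decreasing_def by (metis mult_1 power_0)
  have C0: "0 \<le> C" using C[of 0] norm_ge_zero order_trans by blast
  show "integrable lborel (\<lambda>\<xi>. g \<xi> * \<phi> \<xi>)"
  proof (rule Bochner_Integration.integrable_bound[OF integrable_mult_left[OF gi, of "of_real C"]])
    show "AE \<xi> in lborel. norm (g \<xi> * \<phi> \<xi>) \<le> norm (g \<xi> * of_real C)"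
      unfolding norm_mult by (intro AE_I2 mult_left_mono) (use C C0 in auto)
  qed measurable
  have "u (fourier \<phi>) = of_real (1 / (2 * pi)) * (LINT x|lborel. spectral lborel g x * fourier \<phi> x)"
    by (rule u[OF fourier_schwartz[OF \<phi>]])
  also have "(LINT x|lborel. spectral lborel g x * fourier \<phi> x) = (LINT \<xi>|lborel. g \<xi> * spectral lborel (fourier \<phi>) \<xi>)"
    by (rule spectral_Fubini[OF _ _ gi schwartz_integrable[OF fourier_schwartz[OF \<phi>]]])
       (auto intro: lborel.sigma_finite_measure_axioms)
  also have "\<dots> = (LINT \<xi>|lborel. of_real (2 * pi) * (g \<xi> * \<phi> \<xi>))"
    unfolding fourier_inversion[OF \<phi>] by (simp add: mult_ac)
  finally show "u (fourier \<phi>) = (LINT \<xi>|lborel. g \<xi> * \<phi> \<xi>)" by simp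
qed

section \<open>Fourier series on the torus\<close>

lemma cis_has_vector_derivative:
  "((\<lambda>x. c * cis (a * x)) has_vector_derivative (c * \<i> * of_real a) * cis (a * x)) (at x)"
proof -
  have "((\<lambda>x. cis (a * x)) has_vector_derivative \<i> * of_real a * cis (a * x)) (at x)"
    by (auto simp: has_vector_derivative_complex_iff intro!: derivative_eq_intros)
  from has_vector_derivative_mult_right[OF this, of c] show ?thesis by (simp add: mult.assoc)
qed

lemma smooth_fun_cis: "smooth_fun (\<lambda>x. c * cis (a * x))"
proof (rule smooth_fun_coinduct(1))
  show "(\<lambda>x. c * cis (a * x)) \<in> range (\<lambda>c x. c * cis (a * x))" by auto
  fix f :: "real \<Rightarrow> complex" assume "f \<in> range (\<lambda>c x. c * cis (a * x))"
  then obtain c where "f = (\<lambda>x. c * cis (a * x))" by auto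
  then show "\<exists>f'\<in>range (\<lambda>c x. c * cis (a * x)). \<forall>x. (f has_vector_derivative f' x) (at x)"
    using cis_has_vector_derivative[of c a]
    by (intro bexI[of _ "\<lambda>x. (c * \<i> * of_real a) * cis (a * x)"]) auto
qed

lemma cis_periodic: "cis (of_int k * (x + 2 * pi)) = cis (of_int k * x)"
proof -
  have "cis (of_int k * (x + 2 * pi)) = cis (of_int k * x) * cis (2 * pi * of_int k)"
    by (simp add: cis_mult algebra_simps)
  then show ?thesis by (simp add: cis_multiple_2pi)
qed

lemma cis_test_fun_Torus: "(\<lambda>x. c * cis (of_int k * x)) \<in> test_fun Torus"
  unfolding test_fun.simps using smooth_fun_cis[of c "of_int k"] cis_periodic[of k] by simp

lemma integral_cis_period:
  "(LINT x:{0..2 * pi}|lborel. cis (of_int n * x)) = (if n = 0 then of_real (2 * pi) else 0)"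
proof -
  have si: "set_integrable lborel {0..2 * pi} (\<lambda>x. cis (of_int n * x))"
    by (rule borel_integrable_atLeastAtMost') (intro continuous_intros)
  have "(LINT x:{0..2 * pi}|lborel. cis (of_int n * x)) = integral {0..2 * pi} (\<lambda>x. cis (of_int n * x))"
    by (rule set_borel_integral_eq_integral(2)[OF si])
  also have "\<dots> = (if n = 0 then of_real (2 * pi) else 0)"
  proof (cases "n = 0")
    case False
    have "((\<lambda>x. cis (of_int n * x)) has_integral
        (1 / (\<i> * of_int n)) * cis (of_int n * (2 * pi)) - (1 / (\<i> * of_int n)) * cis (of_int n * 0)) {0..2 * pi}"
    proof (rule fundamental_theorem_of_calculus)
      fix x
      show "((\<lambda>x. (1 / (\<i> * of_int n)) * cis (of_int n * x)) has_vector_derivative cis (of_int n * x)) (at x within {0..2 * pi})"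
        using cis_has_vector_derivative[of "1 / (\<i> * of_int n)" "of_int n" x] False
        by (auto intro: has_vector_derivative_at_within)
    qed simp
    then show ?thesis using False cis_periodic[of n 0] by (simp add: integral_unique)
  qed (simp add: scaleR_conv_of_real)
  finally show ?thesis .
qed

lemma torus_coefficient_of_synthesis:
  assumes gm[measurable]: "g \<in> borel_measurable borel" and gi: "integrable (freq_measure Torus) g"
  shows "(LINT x:{0..2 * pi}|lborel. spectral (freq_measure Torus) g x * cis (- (of_int k * x)))
     = of_real (2 * pi) * g (of_int k)"
proof -
  let ?\<nu> = "freq_measure Torus"
  let ?\<phi> = "\<lambda>x. indicator {0..2 * pi} x *\<^sub>R cis (- (of_int k * x))"
  have \<phi>i: "integrable lborel ?\<phi>"
    unfolding set_integrable_def[symmetric]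
    by (rule borel_integrable_atLeastAtMost') (intro continuous_intros)
  have S: "spectral lborel ?\<phi> (of_int j) = (if j = k then of_real (2 * pi) else 0)" for j
  proof -
    have "spectral lborel ?\<phi> (of_int j) = (LINT x:{0..2 * pi}|lborel. cis (of_int (j - k) * x))"
      unfolding spectral_def set_lebesgue_integral_def
      by (rule Bochner_Integration.integral_cong) (auto simp: indicator_def cis_mult algebra_simps)
    then show ?thesis unfolding integral_cis_period by simp
  qed
  have [measurable]: "spectral lborel ?\<phi> \<in> borel_measurable borel"
    by (rule borel_measurable_continuous_onI[OF spectral_continuous[OF _ \<phi>i]]) simp
  have "(LINT x:{0..2 * pi}|lborel. spectral ?\<nu> g x * cis (- (of_int k * x)))
      = (LINT x|lborel. spectral ?\<nu> g x * ?\<phi> x)"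
    unfolding set_lebesgue_integral_def by (rule Bochner_Integration.integral_cong) (auto simp: indicator_def)
  also have "\<dots> = (LINT \<xi>|?\<nu>. g \<xi> * spectral lborel ?\<phi> \<xi>)"
    by (rule spectral_Fubini[OF _ sigma_finite_freq_measure gi \<phi>i]) simp
  also have "\<dots> = (LINT j|count_space UNIV. g (of_int j) * spectral lborel ?\<phi> (of_int j))"
    by (rule integral_freq_Torus) measurable
  also have "\<dots> = (\<Sum>j | j \<in> UNIV \<and> g (of_int j) * spectral lborel ?\<phi> (of_int j) \<noteq> 0. g (of_int j) * spectral lborel ?\<phi> (of_int j))"
  proof (rule lebesgue_integral_count_space_finite_support)
    show "finite {j \<in> UNIV. g (of_int j) * spectral lborel ?\<phi> (of_int j) \<noteq> 0}"
      by (rule finite_subset[of _ "{k}"]) (auto simp: S split: if_splits)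
  qed
  also have "\<dots> = (\<Sum>j\<in>{k}. g (of_int j) * spectral lborel ?\<phi> (of_int j))"
    by (rule sum.mono_neutral_left) (auto simp: S split: if_splits)
  finally show ?thesis by (simp add: S)
qed

text \<open>The trigonometric polynomials \<open>((1 + cos (y - x0)) / 2) ^ n\<close> are nonnegative and
  concentrate at \<open>x0\<close>, while \<open>D\<close> is orthogonal to all of them. If \<open>D x0 \<noteq> 0\<close>, then the
  contribution of a small interval around \<open>x0\<close>, of order \<open>q1 ^ n\<close>, exceeds that of the
  rest, of order \<open>q2 ^ n\<close> with \<open>q2 < q1\<close>. With \<open>x0\<close> inside the period and \<open>\<delta>\<close> at most its
  distance to the ends, points of the period at distance at least \<open>\<delta>\<close> from \<open>x0\<close> remain so
  modulo \<open>2 * pi\<close>.\<close>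

lemma torus_uniqueness_interior:
  fixes D :: "real \<Rightarrow> complex"
  assumes c: "continuous_on UNIV D"
    and z: "\<And>k. (LINT x:{0..2 * pi}|lborel. D x * cis (- (of_int k * x))) = 0"
    and x0: "x0 \<in> {0<..<2 * pi}"
  shows "D x0 = 0"
proof (rule ccontr)
  assume D0: "D x0 \<noteq> 0"
  define K where "K n y = ((1 + cos (y - x0)) / 2) ^ n" for n and y :: real
  have Kc: "continuous_on UNIV (K n)" for n unfolding K_def by (intro continuous_intros) auto
  have cD: "continuous_on {0..2 * pi} D" by (rule continuous_on_subset[OF c]) simp
  have cK: "continuous_on {0..2 * pi} (K n)" for n by (rule continuous_on_subset[OF Kc]) simp
  have zero: "integral {0..2 * pi} (\<lambda>y. D y * of_real (K n y) * cis (of_int k * y)) = 0" for n k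
  proof (induction n arbitrary: k)
    case 0
    have "set_integrable lborel {0..2 * pi} (\<lambda>y. D y * cis (- (of_int (- k) * y)))"
      by (rule borel_integrable_atLeastAtMost') (intro continuous_intros cD)
    from set_borel_integral_eq_integral(2)[OF this] z[of "- k"]
    show ?case by (simp add: K_def)
  next
    case (Suc n)
    let ?f = "\<lambda>k y. D y * of_real (K n y) * cis (of_int k * y)"
    have i: "?f k integrable_on {0..2 * pi}" for k
      by (intro integrable_continuous_interval continuous_intros cD cK)
    have e: "D y * of_real (K (Suc n) y) * cis (of_int k * y) =
        (1 / 2) * ?f k y + ((cis (- x0) / 4) * ?f (k + 1) y + (cis x0 / 4) * ?f (k - 1) y)" for y
    proof -
      have "of_real (cos (y - x0)) = (cis (- x0) * cis y + cis x0 * cis (- y)) / 2"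
        by (simp add: cis_mult complex_eq_iff cos_diff sin_diff cos_add sin_add algebra_simps)
      then have e1: "(1 + of_real (cos (y - x0))) / 2 = 1 / 2 + cis (- x0) / 4 * cis y + cis x0 / 4 * cis (- y)"
        by (simp add: add_divide_distrib)
      have e2: "complex_of_real (K (Suc n) y) = of_real (K n y) * ((1 + of_real (cos (y - x0))) / 2)"
        by (simp add: K_def mult.commute)
      have e3: "of_real (K (Suc n) y) = of_real (K n y) * (1 / 2 + cis (- x0) / 4 * cis y + cis x0 / 4 * cis (- y))"
        unfolding e2 e1 ..
      have s1: "cis (of_int (k + 1) * y) = cis y * cis (of_int k * y)"
        and s2: "cis (of_int (k - 1) * y) = cis (- y) * cis (of_int k * y)"
        by (simp_all add: cis_mult algebra_simps)
      show ?thesis unfolding e3 s1 s2 by (simp add: algebra_simps)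
    qed
    have "((\<lambda>y. (1 / 2) * ?f k y + ((cis (- x0) / 4) * ?f (k + 1) y + (cis x0 / 4) * ?f (k - 1) y)) has_integral
        (1 / 2) * 0 + ((cis (- x0) / 4) * 0 + (cis x0 / 4) * 0)) {0..2 * pi}"
      by (intro has_integral_add has_integral_mult_right)
         (use integrable_integral[OF i] Suc.IH in \<open>simp_all only:\<close>)
    then show ?case unfolding e by (simp add: integral_unique)
  qed
  define E where "E y = Re (cnj (D x0) * D y)" for y
  have Ec: "continuous_on UNIV E" unfolding E_def by (intro continuous_intros c)
  have E0: "E x0 > 0"
  proof -
    have "cnj (D x0) * D x0 = of_real ((cmod (D x0))\<^sup>2)" using complex_norm_square[of "D x0"] by (simp add: mult.commute)
    then show ?thesis using D0 by (simp add: E_def)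
  qed
  have Ei: "(\<lambda>y. E y * K n y) integrable_on {0..2 * pi}" for n
    by (intro integrable_continuous_interval continuous_intros continuous_on_subset[OF Ec] cK) auto
  have Ezero: "integral {0..2 * pi} (\<lambda>y. E y * K n y) = 0" for n
  proof -
    have "(\<lambda>y. D y * of_real (K n y)) integrable_on {0..2 * pi}"
      by (intro integrable_continuous_interval continuous_intros cD cK)
    moreover have "integral {0..2 * pi} (\<lambda>y. D y * of_real (K n y)) = 0" using zero[of n 0] by simp
    ultimately have "((\<lambda>y. D y * of_real (K n y)) has_integral 0) {0..2 * pi}"
      using integrable_integral by metis
    from has_integral_linear[OF has_integral_mult_right[OF this, of "cnj (D x0)"] bounded_linear_Re]
    have "((\<lambda>y. E y * K n y) has_integral 0) {0..2 * pi}" by (simp add: comp_def E_def algebra_simps)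
    then show ?thesis by (rule integral_unique)
  qed
  obtain \<delta>0 where \<delta>0: "\<delta>0 > 0" "\<And>y. \<bar>y - x0\<bar> < \<delta>0 \<Longrightarrow> \<bar>E y - E x0\<bar> < E x0 / 2"
    using Ec E0 unfolding continuous_on_iff dist_real_def by (metis UNIV_I half_gt_zero)
  define \<delta> where "\<delta> = min (\<delta>0 / 2) (min x0 (2 * pi - x0))"
  have \<delta>: "0 < \<delta>" "\<delta> < \<delta>0" "\<delta> \<le> x0" "\<delta> \<le> 2 * pi - x0" "\<delta> \<le> pi"
    using \<delta>0 x0 by (auto simp: \<delta>_def min_def)
  obtain B where B: "\<And>y. y \<in> {0..2 * pi} \<Longrightarrow> \<bar>E y\<bar> \<le> B" and B0: "0 \<le> B"
  proof -
    have "bounded (E ` {0..2 * pi})"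
      by (intro compact_imp_bounded compact_continuous_image continuous_on_subset[OF Ec]) auto
    then obtain B where "\<forall>y\<in>{0..2 * pi}. \<bar>E y\<bar> \<le> B" unfolding bounded_iff by auto
    then show thesis using that[of "max B 0"] by fastforce
  qed
  have cos1: "0 \<le> 1 + cos \<theta>" for \<theta> :: real
    using cos_ge_minus_one[of \<theta>] by linarith
  define q1 where "q1 = (1 + cos (\<delta> / 2)) / 2"
  define q2 where "q2 = (1 + cos \<delta>) / 2"
  have q: "0 \<le> q2" "q2 < q1"
  proof -
    show "0 \<le> q2" using cos1[of \<delta>] by (simp add: q2_def)
    have "cos \<delta> < cos (\<delta> / 2)" using \<delta> by (intro cos_monotone_0_pi) auto
    then show "q2 < q1" by (simp add: q1_def q2_def)
  qed
  have half_interval: "\<bar>y - x0\<bar> \<le> \<delta> / 2" if "y \<in> {x0 - \<delta> / 2..x0 + \<delta> / 2}" for y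
    by (rule abs_leI) (use that in \<open>simp_all add: algebra_simps\<close>)
  have lower: "(E x0 / 2 * q1 ^ n) * indicator {x0 - \<delta> / 2..x0 + \<delta> / 2} y - B * q2 ^ n \<le> E y * K n y"
    if y: "y \<in> {0..2 * pi}" for n y
  proof (cases "\<bar>y - x0\<bar> < \<delta>")
    case True
    then have Ey': "\<bar>E y - E x0\<bar> < E x0 / 2" using \<delta>0(2)[of y] \<delta> by linarith
    have "E x0 - E y \<le> \<bar>E y - E x0\<bar>" by linarith
    with Ey' have "E x0 - E y < E x0 / 2" by (rule order.strict_trans1[rotated])
    then have Ey: "E x0 / 2 \<le> E y" by (simp add: field_simps)
    have K0: "0 \<le> K n y" using cos1[of "y - x0"] by (simp add: K_def)
    have P: "0 \<le> B * q2 ^ n" using B0 q by simp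
    have EK: "0 \<le> E y * K n y" using Ey E0 K0 by (intro mult_nonneg_nonneg) auto
    show ?thesis
    proof (cases "\<bar>y - x0\<bar> \<le> \<delta> / 2")
      case in_half: True
      have "cos (\<delta> / 2) \<le> cos \<bar>y - x0\<bar>"
        using in_half \<delta> by (intro cos_monotone_0_pi_le) auto
      then have "q1 ^ n \<le> K n y" unfolding K_def q1_def
        using cos1[of "\<delta> / 2"] by (intro power_mono) auto
      then have "E x0 / 2 * q1 ^ n \<le> E y * K n y" using Ey E0 q by (intro mult_mono) auto
      then show ?thesis using P EK by (auto simp: indicator_def)
    next
      case False
      have "y \<notin> {x0 - \<delta> / 2..x0 + \<delta> / 2}" using False half_interval by blast
      then show ?thesis using P EK by simp
    qed
  next
    case False
    have "cos \<bar>y - x0\<bar> \<le> cos \<delta>"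
    proof (cases "\<bar>y - x0\<bar> \<le> pi")
      case True then show ?thesis using False \<delta> by (intro cos_monotone_0_pi_le) auto
    next
      case big: False
      have "cos \<bar>y - x0\<bar> = cos (2 * pi - \<bar>y - x0\<bar>)" by (simp add: cos_diff)
      also have "\<dots> \<le> cos \<delta>" using big y x0 \<delta> by (intro cos_monotone_0_pi_le) auto
      finally show ?thesis .
    qed
    then have Kq: "K n y \<le> q2 ^ n" unfolding K_def q2_def
      using cos1[of "y - x0"] by (intro power_mono) auto
    have K0: "0 \<le> K n y" using cos1[of "y - x0"] by (simp add: K_def)
    have "\<bar>E y * K n y\<bar> \<le> B * q2 ^ n"
      unfolding abs_mult using B[OF y] Kq K0 B0 by (intro mult_mono) auto
    moreover have "y \<notin> {x0 - \<delta> / 2..x0 + \<delta> / 2}"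
    proof
      assume "y \<in> {x0 - \<delta> / 2..x0 + \<delta> / 2}"
      from half_interval[OF this] have "\<bar>y - x0\<bar> < \<delta>" by (rule le_less_trans) (simp add: \<delta>(1))
      then show False using False by simp
    qed
    ultimately show ?thesis by (simp add: abs_le_iff)
  qed
  have ineq: "E x0 / 2 * \<delta> \<le> 2 * pi * B * (q2 / q1) ^ n" for n
  proof -
    have sub: "{x0 - \<delta> / 2..x0 + \<delta> / 2} \<subseteq> {0..2 * pi}" using \<delta> by auto
    have "((\<lambda>y. E x0 / 2 * q1 ^ n) has_integral (E x0 / 2 * q1 ^ n) * \<delta>) {x0 - \<delta> / 2..x0 + \<delta> / 2}"
      using has_integral_const_real[of "E x0 / 2 * q1 ^ n" "x0 - \<delta> / 2" "x0 + \<delta> / 2"] \<delta> by (simp add: mult.commute)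
    then have "((\<lambda>y. if y \<in> {x0 - \<delta> / 2..x0 + \<delta> / 2} then E x0 / 2 * q1 ^ n else 0) has_integral (E x0 / 2 * q1 ^ n) * \<delta>) {0..2 * pi}"
      unfolding has_integral_restrict[OF sub] .
    then have "((\<lambda>y. (E x0 / 2 * q1 ^ n) * indicator {x0 - \<delta> / 2..x0 + \<delta> / 2} y) has_integral (E x0 / 2 * q1 ^ n) * \<delta>) {0..2 * pi}"
      by (rule has_integral_eq[rotated]) (auto simp: indicator_def)
    from has_integral_diff[OF this has_integral_const_real[of "B * q2 ^ n" 0 "2 * pi"]]
    have "((\<lambda>y. (E x0 / 2 * q1 ^ n) * indicator {x0 - \<delta> / 2..x0 + \<delta> / 2} y - B * q2 ^ n) has_integral
        (E x0 / 2 * q1 ^ n) * \<delta> - 2 * pi * (B * q2 ^ n)) {0..2 * pi}" by simp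
    moreover have "((\<lambda>y. E y * K n y) has_integral 0) {0..2 * pi}"
      using integrable_integral[OF Ei[of n]] Ezero[of n] by simp
    ultimately have "(E x0 / 2 * q1 ^ n) * \<delta> - 2 * pi * (B * q2 ^ n) \<le> 0"
      by (rule has_integral_le) (rule lower)
    moreover have "0 < q1 ^ n" using q by simp
    ultimately show ?thesis by (simp add: power_divide field_simps)
  qed
  have "(\<lambda>n. 2 * pi * B * (q2 / q1) ^ n) \<longlonglongrightarrow> 2 * pi * B * 0"
    using q by (intro tendsto_mult_left LIMSEQ_realpow_zero) auto
  then have "E x0 / 2 * \<delta> \<le> 2 * pi * B * 0"
    by (rule LIMSEQ_le_const) (use ineq in auto)
  then show False using E0 \<delta> by (simp add: mult_le_0_iff)
qed

text \<open>The difference \<open>D\<close> of the two sides has vanishing Fourier coefficients. It therefore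
  vanishes inside \<open>[0, 2 * pi]\<close>, by continuity at the end points, and by periodicity
  everywhere.\<close>

lemma torus_fourier_representation:
  assumes rep: "represents Torus U u" and c: "continuous_on UNIV U"
    and gm: "g \<in> borel_measurable borel" and g: "\<And>k. g (of_int k) = fourier_coeff u k"
    and gi: "integrable (freq_measure Torus) g"
  shows "of_real (U x) = spectral (freq_measure Torus) g x"
proof -
  let ?S = "spectral (freq_measure Torus) g"
  define D where "D x = of_real (U x) - ?S x" for x
  have Sc: "continuous_on UNIV ?S" by (rule spectral_continuous[OF _ gi]) simp
  have Dc: "continuous_on UNIV D" unfolding D_def[abs_def] by (intro continuous_intros c Sc)
  have coeff: "(LINT x:{0..2 * pi}|lborel. D x * cis (- (of_int k * x))) = 0" for k
  proof -
    have t: "(\<lambda>x. cis (- (of_int k * x))) \<in> test_fun Torus"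
      using cis_test_fun_Torus[of 1 "- k"] by simp
    have i1: "set_integrable lborel {0..2 * pi} (\<lambda>x. of_real (U x) * cis (- (of_int k * x)))"
      and u: "u (\<lambda>x. cis (- (of_int k * x))) = (LINT x:{0..2 * pi}|lborel. of_real (U x) * cis (- (of_int k * x)))"
      using rep t by (auto simp: represents_def fun_domain_def)
    have i2: "set_integrable lborel {0..2 * pi} (\<lambda>x. ?S x * cis (- (of_int k * x)))"
      by (rule borel_integrable_atLeastAtMost') (intro continuous_intros continuous_on_subset[OF Sc]; simp)
    have "(LINT x:{0..2 * pi}|lborel. D x * cis (- (of_int k * x))) =
        u (\<lambda>x. cis (- (of_int k * x))) - of_real (2 * pi) * g (of_int k)"
      unfolding D_def left_diff_distrib set_integral_diff(2)[OF i1 i2] u torus_coefficient_of_synthesis[OF gm gi] ..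
    then show ?thesis by (simp add: g fourier_coeff_def)
  qed
  have int: "D x = 0" if "x \<in> {0<..<2 * pi}" for x
    by (rule torus_uniqueness_interior[OF Dc coeff that])
  have closed: "D x = 0" if "x \<in> {0..2 * pi}" for x
    by (rule continuous_constant_on_closure[of "{0<..<2 * pi}" D])
       (use that int in \<open>auto intro: continuous_on_subset[OF Dc]\<close>)
  have per: "D (x + 2 * pi) = D x" for x
  proof -
    have "?S (x + 2 * pi) = ?S x" for x
      unfolding spectral_def using gm
      by (subst (1 2) integral_freq_Torus) (auto simp: cis_periodic intro!: borel_measurable_times measurable_compose[OF _ cis_measurable])
    then show ?thesis using rep by (simp add: D_def represents_def)
  qed
  interpret periodic_fun_simple D "2 * pi" by unfold_locales (rule per)
  define n where "n = \<lfloor>x / (2 * pi)\<rfloor>"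
  have "x - of_int n * (2 * pi) \<in> {0..2 * pi}"
  proof -
    have "of_int n \<le> x / (2 * pi)" "x / (2 * pi) < of_int n + 1"
      unfolding n_def by (auto simp: floor_correct)
    then show ?thesis by (auto simp: field_simps)
  qed
  from closed[OF this] have "D x = 0"
    using plus_of_int[of "x - of_int n * (2 * pi)" n] by simp
  then show ?thesis by (simp add: D_def)
qed

section \<open>Distributions given by bounded functions\<close>

lemma smooth_fun_add:
  fixes f g :: "real \<Rightarrow> complex"
  assumes "smooth_fun f" "smooth_fun g" shows "smooth_fun (\<lambda>x. f x + g x)"
proof (rule smooth_fun_coinduct(1))
  let ?X = "{(\<lambda>x. f x + g x) | f g :: real \<Rightarrow> complex. smooth_fun f \<and> smooth_fun g}"
  show "(\<lambda>x. f x + g x) \<in> ?X" using assms by auto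
  fix h assume "h \<in> ?X"
  then obtain f g where h: "h = (\<lambda>x. f x + g x)" "smooth_fun f" "smooth_fun g" by auto
  obtain f' g' where "smooth_fun f'" "smooth_fun g'"
    "\<And>x. (f has_vector_derivative f' x) (at x)" "\<And>x. (g has_vector_derivative g' x) (at x)"
    using smooth_fun_derivative_exists[OF h(2)] smooth_fun_derivative_exists[OF h(3)] by blast
  then show "\<exists>f'\<in>?X. \<forall>x. (h has_vector_derivative f' x) (at x)"
    unfolding h(1) by (intro bexI[of _ "\<lambda>x. f' x + g' x"]) (auto intro: has_vector_derivative_add)
qed

lemma smooth_fun_linear:
  fixes f :: "real \<Rightarrow> complex"
  assumes L: "bounded_linear L" and "smooth_fun f" shows "smooth_fun (\<lambda>x. L (f x) :: complex)"
proof (rule smooth_fun_coinduct(1))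
  let ?X = "{(\<lambda>x. L (f x)) | f :: real \<Rightarrow> complex. smooth_fun f}"
  show "(\<lambda>x. L (f x)) \<in> ?X" using assms by auto
  fix h assume "h \<in> ?X"
  then obtain f where h: "h = (\<lambda>x. L (f x))" "smooth_fun f" by auto
  obtain f' where "smooth_fun f'" "\<And>x. (f has_vector_derivative f' x) (at x)"
    using smooth_fun_derivative_exists[OF h(2)] by blast
  then show "\<exists>f'\<in>?X. \<forall>x. (h has_vector_derivative f' x) (at x)"
    unfolding h(1) by (intro bexI[of _ "\<lambda>x. L (f' x)"]) (auto intro: bounded_linear.has_vector_derivative[OF L])
qed

lemma test_fun_add: "\<phi> \<in> test_fun M \<Longrightarrow> \<psi> \<in> test_fun M \<Longrightarrow> (\<lambda>x. \<phi> x + \<psi> x) \<in> test_fun M"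
  by (cases M) (use schwartz_intros(1) smooth_fun_add in \<open>auto simp: test_fun.simps(2)\<close>)

lemma test_fun_scale: "\<phi> \<in> test_fun M \<Longrightarrow> (\<lambda>x. c * \<phi> x) \<in> test_fun M"
  by (cases M) (use schwartz_intros(2) smooth_fun_linear[OF bounded_linear_mult_right] in \<open>auto simp: test_fun.simps(2)\<close>)

lemma test_fun_cnj: "\<phi> \<in> test_fun M \<Longrightarrow> (\<lambda>x. cnj (\<phi> x)) \<in> test_fun M"
  by (cases M) (use schwartz_intros(5) smooth_fun_linear[OF bounded_linear_cnj] in \<open>auto simp: test_fun.simps(2)\<close>)

lemma periodic_continuous_bounded:
  fixes f :: "real \<Rightarrow> complex"
  assumes c: "continuous_on UNIV f" and p: "\<And>x. f (x + 2 * pi) = f x"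
  shows "\<exists>B. \<forall>x. cmod (f x) \<le> B"
proof -
  have "bounded (f ` {0..2 * pi})"
    by (intro compact_imp_bounded compact_continuous_image continuous_on_subset[OF c]) auto
  then obtain B where "\<forall>y\<in>f ` {0..2 * pi}. cmod y \<le> B" unfolding bounded_iff by blast
  then have B: "cmod (f x) \<le> B" if "x \<in> {0..2 * pi}" for x using that by blast
  interpret periodic_fun_simple f "2 * pi" by unfold_locales (rule p)
  have "cmod (f x) \<le> B" for x
  proof -
    define n where "n = \<lfloor>x / (2 * pi)\<rfloor>"
    have "of_int n \<le> x / (2 * pi)" "x / (2 * pi) < of_int n + 1"
      unfolding n_def by (auto simp: floor_correct)
    then have "x - of_int n * (2 * pi) \<in> {0..2 * pi}" by (auto simp: field_simps)
    from B[OF this] show ?thesis using plus_of_int[of "x - of_int n * (2 * pi)" n] by simp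
  qed
  then show ?thesis by blast
qed

lemma test_fun_Torus_bounded:
  assumes "\<phi> \<in> test_fun Torus" shows "\<exists>B. \<forall>x. cmod ((D_x ^^ n) \<phi> x) \<le> B"
proof (rule periodic_continuous_bounded)
  have s: "smooth_fun \<phi>" and p: "\<And>x. \<phi> (x + 2 * pi) = \<phi> x" using assms by (auto simp: test_fun.simps(2))
  show "continuous_on UNIV ((D_x ^^ n) \<phi>)"
    using smooth_fun_has_derivative[OF s, of n]
    by (intro continuous_at_imp_continuous_on) (auto dest!: has_vector_derivative_continuous)
  show "(D_x ^^ n) \<phi> (x + 2 * pi) = (D_x ^^ n) \<phi> x" for x
  proof (induction n arbitrary: x)
    case (Suc n)
    show ?case using D_x_periodic[of "(D_x ^^ n) \<phi>" "2 * pi" x] Suc by simp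
  qed (simp add: p)
qed

text \<open>The weight on the left is chosen so that its inverse is integrable over the domain.\<close>

lemma test_fun_pointwise_bound:
  assumes "\<phi> \<in> test_fun M"
  shows "cmod (\<phi> x) * (case M of Real_Line \<Rightarrow> 1 + x\<^sup>2 | Torus \<Rightarrow> 1) \<le> test_seminorm M 2 \<phi>"
proof (cases M)
  case Real_Line
  let ?s = "\<lambda>k n. SUP x. \<bar>x\<bar> ^ k * cmod ((D_x ^^ n) \<phi> x)"
  have bdd: "bdd_above (range (\<lambda>x. \<bar>x\<bar> ^ k * cmod ((D_x ^^ n) \<phi> x)))" for k n
  proof -
    obtain C where "\<And>x. \<bar>x\<bar> ^ k * cmod ((D_x ^^ n) \<phi> x) \<le> C"
      using assms unfolding Real_Line test_fun.simps(1) mem_Collect_eq by blast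
    then show ?thesis by (intro bdd_aboveI[of _ C]) auto
  qed
  have up: "\<bar>x\<bar> ^ k * cmod ((D_x ^^ n) \<phi> x) \<le> ?s k n" for k n x
    by (rule cSUP_upper[OF UNIV_I bdd])
  have nn: "0 \<le> ?s k n" for k n
    by (rule order_trans[OF _ up[of 1 k n]]) simp
  have "cmod (\<phi> x) * (1 + x\<^sup>2) = \<bar>x\<bar> ^ 0 * cmod ((D_x ^^ 0) \<phi> x) + \<bar>x\<bar> ^ 2 * cmod ((D_x ^^ 0) \<phi> x)"
    by (simp add: algebra_simps)
  also have "\<dots> \<le> ?s 0 0 + ?s 2 0" by (intro add_mono up)
  also have "\<dots> \<le> (\<Sum>n\<le>2. ?s 0 n) + (\<Sum>n\<le>2. ?s 2 n)"
    by (intro add_mono member_le_sum[of 0 "{..2}" "?s 0"] member_le_sum[of 0 "{..2}" "?s 2"] nn) auto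
  also have "\<dots> = (\<Sum>k\<in>{0, 2}. \<Sum>n\<le>2. ?s k n)" by simp
  also have "\<dots> \<le> (\<Sum>k\<le>2. \<Sum>n\<le>2. ?s k n)"
    by (rule sum_mono2) (auto intro!: sum_nonneg nn)
  finally show ?thesis using Real_Line by simp
next
  case Torus
  let ?s = "\<lambda>n. SUP x. cmod ((D_x ^^ n) \<phi> x)"
  have bdd: "bdd_above (range (\<lambda>x. cmod ((D_x ^^ n) \<phi> x)))" for n
  proof -
    obtain C where "\<And>x. cmod ((D_x ^^ n) \<phi> x) \<le> C"
      using test_fun_Torus_bounded assms Torus by blast
    then show ?thesis by (intro bdd_aboveI[of _ C]) auto
  qed
  have up: "cmod ((D_x ^^ n) \<phi> x) \<le> ?s n" for n x
    by (rule cSUP_upper[OF UNIV_I bdd])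
  have nn: "0 \<le> ?s n" for n
    using up[of n 0] norm_ge_zero order_trans by blast
  have "cmod (\<phi> x) \<le> ?s 0" using up[of 0] by simp
  also have "\<dots> \<le> (\<Sum>n\<le>2. ?s n)"
    by (rule member_le_sum[of 0 "{..2}" ?s]) (auto intro: nn)
  finally show ?thesis using Torus by simp
qed

lemma test_fun_measurable: "\<phi> \<in> test_fun M \<Longrightarrow> \<phi> \<in> borel_measurable borel"
proof -
  assume "\<phi> \<in> test_fun M"
  then have s: "smooth_fun \<phi>" by (cases M) (auto simp: test_fun.simps)
  show ?thesis
    using smooth_fun_has_derivative[OF s, of 0]
    by (intro borel_measurable_continuous_onI continuous_at_imp_continuous_on)
       (auto dest!: has_vector_derivative_continuous)
qed

lemma fun_domain_measurable [measurable]: "fun_domain M \<in> sets borel"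
  by (cases M) (auto simp: fun_domain_def)

lemma test_fun_integral_bound:
  "\<exists>C\<ge>0. \<forall>\<phi>\<in>test_fun M. set_integrable lborel (fun_domain M) \<phi> \<and>
     (LINT x:fun_domain M|lborel. cmod (\<phi> x)) \<le> C * test_seminorm M 2 \<phi>"
proof -
  define w where "w x = indicator (fun_domain M) x * (case M of Real_Line \<Rightarrow> inverse (1 + x\<^sup>2) | Torus \<Rightarrow> 1)" for x :: real
  have w0: "0 \<le> w x" for x by (cases M) (auto simp: w_def)
  have wi: "integrable lborel w"
  proof (cases M)
    case Real_Line
    then show ?thesis using integrable_inverse_square by (simp add: w_def[abs_def] fun_domain_def)
  next
    case Torus
    then show ?thesis by (simp add: w_def[abs_def] fun_domain_def)
  qed
  have "set_integrable lborel (fun_domain M) \<phi> \<and>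
     (LINT x:fun_domain M|lborel. cmod (\<phi> x)) \<le> (LINT x|lborel. w x) * test_seminorm M 2 \<phi>"
    if \<phi>: "\<phi> \<in> test_fun M" for \<phi>
  proof -
    note [measurable] = test_fun_measurable[OF \<phi>]
    have b: "cmod (indicator (fun_domain M) x *\<^sub>R \<phi> x) \<le> test_seminorm M 2 \<phi> * w x" for x
      using test_fun_pointwise_bound[OF \<phi>, of x]
      by (cases M) (auto simp: w_def indicator_def field_simps)
    have wi': "integrable lborel (\<lambda>x. test_seminorm M 2 \<phi> * w x)" by (rule integrable_mult_right[OF wi])
    have i: "integrable lborel (\<lambda>x. indicator (fun_domain M) x *\<^sub>R \<phi> x)"
    proof (rule Bochner_Integration.integrable_bound[OF wi'])
      show "AE x in lborel. norm (indicator (fun_domain M) x *\<^sub>R \<phi> x) \<le> norm (test_seminorm M 2 \<phi> * w x)"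
        by (rule AE_I2, rule order_trans[OF b]) simp
    qed measurable
    have "(LINT x:fun_domain M|lborel. cmod (\<phi> x)) = (LINT x|lborel. cmod (indicator (fun_domain M) x *\<^sub>R \<phi> x))"
      unfolding set_lebesgue_integral_def by simp
    also have "\<dots> \<le> (LINT x|lborel. test_seminorm M 2 \<phi> * w x)"
      by (rule integral_mono[OF integrable_norm[OF i] wi' b])
    finally show ?thesis using i by (simp add: set_integrable_def mult.commute)
  qed
  moreover have "0 \<le> (LINT x|lborel. w x)" using w0 by simp
  ultimately show ?thesis by blast
qed

text \<open>The value outside the test functions follows the convention for distributions.\<close>

definition fun_dist :: "domain \<Rightarrow> (real \<Rightarrow> real) \<Rightarrow> dist_fun" where
  "fun_dist M W \<phi> = (if \<phi> \<in> test_fun M then LINT x:fun_domain M|lborel. of_real (W x) * \<phi> x else 0)"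

lemma set_integrable_bounded_times:
  fixes W \<phi> :: "real \<Rightarrow> complex"
  assumes \<phi>: "set_integrable lborel A \<phi>" and W: "W \<in> borel_measurable borel"
    and A: "A \<in> sets borel" and \<phi>m: "\<phi> \<in> borel_measurable borel" and b: "\<And>x. cmod (W x) \<le> B"
  shows "set_integrable lborel A (\<lambda>x. W x * \<phi> x)"
proof -
  note [measurable] = W A \<phi>m
  have B0: "0 \<le> B" using b[of 0] norm_ge_zero order_trans by blast
  have "integrable lborel (\<lambda>x. indicator A x *\<^sub>R (W x * \<phi> x))"
  proof (rule Bochner_Integration.integrable_bound)
    show "integrable lborel (\<lambda>x. of_real B * (indicator A x *\<^sub>R \<phi> x))"
      by (rule integrable_mult_right) (use \<phi> in \<open>simp add: set_integrable_def\<close>)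
    show "AE x in lborel. norm (indicator A x *\<^sub>R (W x * \<phi> x)) \<le> norm (of_real B * (indicator A x *\<^sub>R \<phi> x))"
      using b B0 by (intro AE_I2) (auto simp: norm_mult indicator_def intro!: mult_right_mono)
  qed measurable
  then show ?thesis by (simp add: set_integrable_def)
qed

lemma real_distribution_fun_dist:
  assumes W[measurable]: "W \<in> borel_measurable borel" and b: "\<And>x. \<bar>W x\<bar> \<le> B"
  shows "Defs.real_distribution M (fun_dist M W)"
proof -
  let ?D = "fun_domain M"
  obtain C where C: "0 \<le> C" "\<And>\<phi>. \<phi> \<in> test_fun M \<Longrightarrow> set_integrable lborel ?D \<phi>"
      "\<And>\<phi>. \<phi> \<in> test_fun M \<Longrightarrow> (LINT x:?D|lborel. cmod (\<phi> x)) \<le> C * test_seminorm M 2 \<phi>"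
    using test_fun_integral_bound[of M] by blast
  have B0: "0 \<le> B" using b[of 0] by linarith
  have i: "set_integrable lborel ?D (\<lambda>x. of_real (W x) * \<phi> x)" if "\<phi> \<in> test_fun M" for \<phi>
    by (rule set_integrable_bounded_times[OF C(2)[OF that], where B = B])
       (use b in \<open>auto simp: test_fun_measurable[OF that]\<close>)
  have d: "fun_dist M W \<phi> = (LINT x:?D|lborel. of_real (W x) * \<phi> x)" if "\<phi> \<in> test_fun M" for \<phi>
    using that by (simp add: fun_dist_def)
  show ?thesis
    unfolding Defs.real_distribution_def
  proof (intro conjI ballI allI impI)
    fix \<phi> \<psi> assume p: "\<phi> \<in> test_fun M" "\<psi> \<in> test_fun M"
    show "fun_dist M W (\<lambda>x. \<phi> x + \<psi> x) = fun_dist M W \<phi> + fun_dist M W \<psi>"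
      unfolding d[OF p(1)] d[OF p(2)] d[OF test_fun_add[OF p]] distrib_left
      by (rule set_integral_add(2)[OF i i]) (use p in auto)
  next
    fix \<phi> c assume p: "\<phi> \<in> test_fun M"
    show "fun_dist M W (\<lambda>x. c * \<phi> x) = c * fun_dist M W \<phi>"
      unfolding d[OF p] d[OF test_fun_scale[OF p]] by (simp add: mult.left_commute)
  next
    have "cmod (fun_dist M W \<phi>) \<le> (B * C) * test_seminorm M 2 \<phi>" if p: "\<phi> \<in> test_fun M" for \<phi>
    proof -
      have "cmod (fun_dist M W \<phi>) \<le> (LINT x:?D|lborel. norm (of_real (W x) * \<phi> x))"
        unfolding d[OF p] by (rule set_integral_norm_bound[OF i[OF p]])
      also have "\<dots> \<le> (LINT x:?D|lborel. B * norm (\<phi> x))"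
      proof (rule set_integral_mono)
        show "set_integrable lborel ?D (\<lambda>x. norm (of_real (W x) * \<phi> x))"
          using i[OF p] by (rule set_integrable_norm)
        show "set_integrable lborel ?D (\<lambda>x. B * norm (\<phi> x))"
          by (intro set_integrable_mult_right set_integrable_norm C(2) p)
        show "norm (of_real (W x) * \<phi> x) \<le> B * norm (\<phi> x)" for x
          using b[of x] by (simp add: norm_mult mult_right_mono)
      qed
      also have "\<dots> = B * (LINT x:?D|lborel. norm (\<phi> x))" by simp
      also have "\<dots> \<le> B * (C * test_seminorm M 2 \<phi>)" by (intro mult_left_mono C p B0)
      finally show ?thesis by simp
    qed
    then show "\<exists>C N. \<forall>\<phi>\<in>test_fun M. cmod (fun_dist M W \<phi>) \<le> C * test_seminorm M N \<phi>" by blast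
  next
    fix \<phi> assume p: "\<phi> \<in> test_fun M"
    show "fun_dist M W (\<lambda>x. cnj (\<phi> x)) = cnj (fun_dist M W \<phi>)"
      unfolding d[OF p] d[OF test_fun_cnj[OF p]] set_lebesgue_integral_def
      using integral_bounded_linear[OF bounded_linear_cnj i[OF p, unfolded set_integrable_def]]
      by (simp add: scaleR_conv_of_real)
  next
    fix \<phi> assume "\<phi> \<notin> test_fun M"
    then show "fun_dist M W \<phi> = 0" by (simp add: fun_dist_def)
  qed
qed

section \<open>Transforms and Sobolev norms\<close>

lemma cnj_measurable [measurable]: "cnj \<in> borel_measurable borel"
  by (intro borel_measurable_continuous_onI continuous_intros)

lemma borel_measurable_freq [simp]: "borel_measurable (freq_measure M) = borel_measurable borel"
  by (rule measurable_cong_sets) simp_all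

text \<open>The Fourier coefficients on the torus are carried by a function of a real frequency,
  so that both domains share their arguments.\<close>

definition has_transform :: "domain \<Rightarrow> dist_fun \<Rightarrow> (real \<Rightarrow> complex) \<Rightarrow> bool" where
  "has_transform M u g \<longleftrightarrow> g \<in> borel_measurable borel \<and>
     (case M of Real_Line \<Rightarrow> has_fourier u g | Torus \<Rightarrow> (\<forall>k::int. g (of_int k) = fourier_coeff u k))"

text \<open>The normalisation of the inverse transform.\<close>

definition synth_const :: "domain \<Rightarrow> real" where
  "synth_const M = (case M of Real_Line \<Rightarrow> 1 / (2 * pi) | Torus \<Rightarrow> 1)"

lemma synth_const_pos: "0 < synth_const M"
  by (cases M) (auto simp: synth_const_def)

definition synth :: "domain \<Rightarrow> (real \<Rightarrow> complex) \<Rightarrow> real \<Rightarrow> complex" where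
  "synth M g x = of_real (synth_const M) * spectral (freq_measure M) g x"

lemma has_transform_unique:
  assumes "has_transform M u g" "has_transform M u g'" shows "AE \<xi> in freq_measure M. g \<xi> = g' \<xi>"
proof (cases M)
  case Real_Line
  show ?thesis unfolding Real_Line freq_measure.simps
    by (rule has_fourier_unique[of u]) (use assms Real_Line in \<open>simp_all add: has_transform_def\<close>)
next
  case Torus
  have [measurable]: "g \<in> borel_measurable borel" "g' \<in> borel_measurable borel"
    using assms by (auto simp: has_transform_def)
  have "g (of_int k) = g' (of_int k)" for k :: int
    using assms Torus by (simp add: has_transform_def)
  then show ?thesis unfolding Torus freq_measure.simps
    by (subst AE_distr_iff) (simp_all add: AE_count_space)
qed

lemma has_transform_diff:
  assumes "has_transform M u g" "has_transform M v h"
  shows "has_transform M (\<lambda>\<phi>. u \<phi> - v \<phi>) (\<lambda>\<xi>. g \<xi> - h \<xi>)"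
  using assms by (cases M)
    (auto simp: has_transform_def has_fourier_def fourier_coeff_def left_diff_distrib diff_divide_distrib
      intro!: borel_measurable_diff)

lemma sobolev_iff_transform:
  "u \<in> sobolev M \<sigma> \<longleftrightarrow> Defs.real_distribution M u \<and> (\<exists>g. has_transform M u g \<and> weighted_L2 M \<sigma> g)"
proof (cases M)
  case Real_Line
  then show ?thesis by (auto simp: has_transform_def weighted_L2_def has_fourier_def)
next
  case Torus
  have eq: "(\<lambda>k::int. (1 + (of_int k)\<^sup>2) powr \<sigma> * (cmod (fourier_coeff u k))\<^sup>2) summable_on UNIV \<longleftrightarrow> weighted_L2 M \<sigma> g"
    if "has_transform M u g" for g
  proof -
    have [measurable]: "g \<in> borel_measurable borel" and g: "\<And>k. g (of_int k) = fourier_coeff u k"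
      using that Torus by (auto simp: has_transform_def)
    let ?f = "\<lambda>k::int. (1 + (of_int k)\<^sup>2) powr \<sigma> * (cmod (fourier_coeff u k))\<^sup>2"
    have "?f summable_on UNIV \<longleftrightarrow> integrable (count_space UNIV) ?f"
      using summable_on_iff_abs_summable_on_real[of ?f UNIV]
      unfolding abs_summable_equivalent Infinite_Set_Sum.abs_summable_on_def .
    moreover have "weighted_L2 M \<sigma> g \<longleftrightarrow> integrable (count_space UNIV) ?f"
      unfolding weighted_L2_def Torus by (subst integrable_freq_Torus) (auto simp: g)
    ultimately show ?thesis by simp
  qed
  have ex: "\<exists>g. has_transform M u g"
  proof
    have "(\<lambda>\<xi>::real. fourier_coeff u \<lfloor>\<xi>\<rfloor>) \<in> borel_measurable borel"
      by (rule measurable_compose[OF measurable_real_floor]) simp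
    then show "has_transform M u (\<lambda>\<xi>. fourier_coeff u \<lfloor>\<xi>\<rfloor>)" using Torus by (simp add: has_transform_def)
  qed
  show ?thesis using eq ex Torus by auto
qed

lemma sobolev_norm_transform:
  assumes u: "has_transform M u g" and g: "weighted_L2 M \<sigma> g"
  shows "sobolev_norm M \<sigma> u = weighted_norm M \<sigma> g"
proof (cases M)
  case Real_Line
  define g' where "g' = (SOME g. has_fourier u g)"
  have "has_fourier u g" using u Real_Line by (simp add: has_transform_def)
  then have g': "has_fourier u g'" unfolding g'_def by (rule someI[where P = "has_fourier u"])
  have ae: "AE \<xi> in lborel. g' \<xi> = g \<xi>" by (rule has_fourier_unique[OF g' \<open>has_fourier u g\<close>])
  have [measurable]: "g' \<in> borel_measurable borel" "g \<in> borel_measurable borel"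
    using g' g by (auto simp: has_fourier_def weighted_L2_def)
  have "(LINT \<xi>|lborel. (1 + \<xi>\<^sup>2) powr \<sigma> * (cmod (g' \<xi>))\<^sup>2) = (LINT \<xi>|lborel. (1 + \<xi>\<^sup>2) powr \<sigma> * (cmod (g \<xi>))\<^sup>2)"
    by (rule integral_cong_AE) (use ae in auto)
  then show ?thesis unfolding Real_Line sobolev_norm.simps Let_def g'_def[symmetric] weighted_norm_def by simp
next
  case Torus
  have [measurable]: "g \<in> borel_measurable borel" and gk: "\<And>k. g (of_int k) = fourier_coeff u k"
    using u Torus by (auto simp: has_transform_def)
  let ?f = "\<lambda>k::int. (1 + (of_int k)\<^sup>2) powr \<sigma> * (cmod (fourier_coeff u k))\<^sup>2"
  have "integrable (count_space UNIV) ?f"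
    using g unfolding weighted_L2_def Torus by (subst (asm) integrable_freq_Torus) (auto simp: gk)
  then have "Infinite_Set_Sum.abs_summable_on ?f UNIV" by (simp add: Infinite_Set_Sum.abs_summable_on_def)
  from infsetsum_infsum[OF this] have "infsum ?f UNIV = (LINT k|count_space UNIV. ?f k)"
    by (simp add: infsetsum_def)
  also have "\<dots> = (LINT \<xi>|freq_measure Torus. (1 + \<xi>\<^sup>2) powr \<sigma> * (cmod (g \<xi>))\<^sup>2)"
    by (subst integral_freq_Torus) (auto simp: gk)
  finally show ?thesis unfolding Torus sobolev_norm.simps weighted_norm_def by simp
qed

lemma representation_by_synthesis:
  assumes rep: "represents M U u" and c: "continuous_on UNIV U"
    and g: "has_transform M u g" and gi: "integrable (freq_measure M) g"
  shows "of_real (U x) = synth M g x"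
proof (cases M)
  case Real_Line
  then show ?thesis using line_fourier_representation[of U u g x] assms
    by (simp add: synth_def synth_const_def has_transform_def)
next
  case Torus
  then show ?thesis using torus_fourier_representation[of U u g x] assms
    by (simp add: synth_def synth_const_def has_transform_def del: freq_measure.simps)
qed

text \<open>The triangle inequality up to the factor \<open>2\<close>, from the pointwise bound
  \<open>(a + b)\<^sup>2 \<le> 2 * (a\<^sup>2 + b\<^sup>2)\<close>.\<close>

lemma weighted_L2_diff:
  assumes "weighted_L2 M \<sigma> g" "weighted_L2 M \<sigma> h"
  shows "weighted_L2 M \<sigma> (\<lambda>\<xi>. g \<xi> - h \<xi>)"
    and "weighted_norm M \<sigma> (\<lambda>\<xi>. g \<xi> - h \<xi>) \<le> 2 * (weighted_norm M \<sigma> g + weighted_norm M \<sigma> h)"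
proof -
  let ?w = "\<lambda>g \<xi>. (1 + \<xi>\<^sup>2) powr \<sigma> * (cmod (g \<xi>))\<^sup>2"
  have [measurable]: "g \<in> borel_measurable borel" "h \<in> borel_measurable borel" using assms by (auto simp: weighted_L2_def)
  have ig: "integrable (freq_measure M) (?w g)" and ih: "integrable (freq_measure M) (?w h)"
    using assms unfolding weighted_L2_def by blast+
  have b: "?w (\<lambda>\<xi>. g \<xi> - h \<xi>) \<xi> \<le> 2 * (?w g \<xi> + ?w h \<xi>)" for \<xi>
  proof -
    have "(cmod (g \<xi> - h \<xi>))\<^sup>2 \<le> (cmod (g \<xi>) + cmod (h \<xi>))\<^sup>2"
      by (intro power_mono norm_triangle_ineq4) auto
    also have "\<dots> \<le> 2 * ((cmod (g \<xi>))\<^sup>2 + (cmod (h \<xi>))\<^sup>2)"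
      using zero_le_power2[of "cmod (g \<xi>) - cmod (h \<xi>)"] by (simp add: power2_sum power2_diff)
    finally have "(1 + \<xi>\<^sup>2) powr \<sigma> * (cmod (g \<xi> - h \<xi>))\<^sup>2 \<le> (1 + \<xi>\<^sup>2) powr \<sigma> * (2 * ((cmod (g \<xi>))\<^sup>2 + (cmod (h \<xi>))\<^sup>2))"
      by (rule mult_left_mono) simp
    then show ?thesis by (simp add: algebra_simps)
  qed
  have i2: "integrable (freq_measure M) (\<lambda>\<xi>. 2 * (?w g \<xi> + ?w h \<xi>))"
    by (intro integrable_mult_right Bochner_Integration.integrable_add ig ih)
  have i: "integrable (freq_measure M) (?w (\<lambda>\<xi>. g \<xi> - h \<xi>))"
  proof (rule Bochner_Integration.integrable_bound[OF i2])
    show "AE \<xi> in freq_measure M. norm (?w (\<lambda>\<xi>. g \<xi> - h \<xi>) \<xi>) \<le> norm (2 * (?w g \<xi> + ?w h \<xi>))"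
      using b by (intro AE_I2) (simp add: abs_of_nonneg)
  qed measurable
  show "weighted_L2 M \<sigma> (\<lambda>\<xi>. g \<xi> - h \<xi>)" using i unfolding weighted_L2_def by simp
  have "(LINT \<xi>|freq_measure M. ?w (\<lambda>\<xi>. g \<xi> - h \<xi>) \<xi>) \<le> (LINT \<xi>|freq_measure M. 2 * (?w g \<xi> + ?w h \<xi>))"
    by (rule integral_mono[OF i i2 b])
  also have "\<dots> = 2 * ((LINT \<xi>|freq_measure M. ?w g \<xi>) + (LINT \<xi>|freq_measure M. ?w h \<xi>))"
    unfolding integral_mult_right_zero Bochner_Integration.integral_add[OF ig ih] ..
  also have "\<dots> \<le> (2 * (weighted_norm M \<sigma> g + weighted_norm M \<sigma> h))\<^sup>2"
  proof -
    have "(LINT \<xi>|freq_measure M. ?w g \<xi>) = (weighted_norm M \<sigma> g)\<^sup>2" "(LINT \<xi>|freq_measure M. ?w h \<xi>) = (weighted_norm M \<sigma> h)\<^sup>2"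
      unfolding weighted_norm_def by simp_all
    moreover have "0 \<le> weighted_norm M \<sigma> g * weighted_norm M \<sigma> h" by simp
    ultimately show ?thesis
      using zero_le_power2[of "weighted_norm M \<sigma> g"] zero_le_power2[of "weighted_norm M \<sigma> h"]
      by (simp add: power_mult_distrib power2_sum)
  qed
  finally show "weighted_norm M \<sigma> (\<lambda>\<xi>. g \<xi> - h \<xi>) \<le> 2 * (weighted_norm M \<sigma> g + weighted_norm M \<sigma> h)"
    unfolding weighted_norm_def[of M \<sigma> "\<lambda>\<xi>. g \<xi> - h \<xi>"] by (intro real_le_lsqrt) auto
qed

text \<open>Cauchy-Schwarz against \<open>(1 + \<xi>\<^sup>2) ^ m\<close>, which lies in the dual weighted space
  because \<open>(1 + \<xi>\<^sup>2)\<^sup>-\<^sup>1\<close> is integrable.\<close>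

lemma weighted_L2_moment:
  "\<exists>C\<ge>0. \<forall>g. weighted_L2 M (2 * real m + 1) g \<longrightarrow>
     integrable (freq_measure M) (\<lambda>\<xi>. (1 + \<xi>\<^sup>2) ^ m * cmod (g \<xi>)) \<and>
     (LINT \<xi>|freq_measure M. (1 + \<xi>\<^sup>2) ^ m * cmod (g \<xi>)) \<le> C * weighted_norm M (2 * real m + 1) g"
proof -
  let ?k = "\<lambda>\<xi>. of_real ((1 + \<xi>\<^sup>2) ^ m) :: complex"
  have k: "weighted_L2 M (- (2 * real m + 1)) ?k"
  proof -
    have "(1 + \<xi>\<^sup>2) powr (- (2 * real m + 1)) * (cmod (?k \<xi>))\<^sup>2 = inverse (1 + \<xi>\<^sup>2)" for \<xi>
    proof -
      have "(cmod (?k \<xi>))\<^sup>2 = (1 + \<xi>\<^sup>2) powr (2 * real m)"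
      proof -
        have "cmod (?k \<xi>) = (1 + \<xi>\<^sup>2) ^ m" unfolding norm_of_real by simp
        moreover have "(1 + \<xi>\<^sup>2) powr (2 * real m) = (1 + \<xi>\<^sup>2) ^ (m * 2)"
          using powr_realpow[of "1 + \<xi>\<^sup>2" "m * 2"] by (simp add: mult.commute)
        ultimately show ?thesis by (simp only: power_mult)
      qed
      then have "(1 + \<xi>\<^sup>2) powr (- (2 * real m + 1)) * (cmod (?k \<xi>))\<^sup>2 = (1 + \<xi>\<^sup>2) powr (- 1)"
        by (simp only: powr_add[symmetric]) simp
      then show ?thesis by (simp add: powr_minus)
    qed
    then show ?thesis unfolding weighted_L2_def using integrable_inverse_square_freq[of M] by simp
  qed
  have "integrable (freq_measure M) (\<lambda>\<xi>. (1 + \<xi>\<^sup>2) ^ m * cmod (g \<xi>)) \<and>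
     (LINT \<xi>|freq_measure M. (1 + \<xi>\<^sup>2) ^ m * cmod (g \<xi>)) \<le> weighted_norm M (- (2 * real m + 1)) ?k * weighted_norm M (2 * real m + 1) g"
    if g: "weighted_L2 M (2 * real m + 1) g" for g
  proof -
    have e: "cmod (g \<xi> * ?k \<xi>) = (1 + \<xi>\<^sup>2) ^ m * cmod (g \<xi>)" for \<xi>
      unfolding norm_mult norm_of_real by simp
    show ?thesis
      using integrable_norm[OF weighted_pairing(1)[OF g k]] weighted_pairing(2)[OF g k] unfolding e
      by (simp add: mult.commute)
  qed
  then show ?thesis by (intro exI[of _ "weighted_norm M (- (2 * real m + 1)) ?k"]) simp
qed

lemma integral_freq_reflect:
  fixes f :: "real \<Rightarrow> complex"
  assumes [measurable]: "f \<in> borel_measurable borel"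
  shows "(LINT \<xi>|freq_measure M. f (- \<xi>)) = (LINT \<xi>|freq_measure M. f \<xi>)"
proof (cases M)
  case Real_Line
  then show ?thesis using lborel_integral_real_affine[of "- 1" f 0] by simp
next
  case Torus
  have "bij_betw uminus (UNIV :: int set) UNIV" by (rule bij_betw_byWitness[where f' = uminus]) auto
  from integral_bij_count_space[OF this, of "\<lambda>k. f (of_int k)"]
  show ?thesis unfolding Torus by (subst (1 2) integral_freq_Torus) auto
qed

text \<open>The symmetry makes the synthesis equal to its conjugate, as the frequency measure is
  invariant under reflection.\<close>

lemma synth_real:
  assumes gi: "integrable (freq_measure M) g" and sym: "AE \<xi> in freq_measure M. g (- \<xi>) = cnj (g \<xi>)"
  shows "of_real (Re (synth M g x)) = synth M g x"
proof -
  have gm[measurable]: "g \<in> borel_measurable borel"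
    using borel_measurable_integrable[OF gi] by simp
  have "cnj (spectral (freq_measure M) g x) = (LINT \<xi>|freq_measure M. cnj (cis (\<xi> * x) * g \<xi>))"
    unfolding spectral_def
    by (rule integral_bounded_linear[symmetric, OF bounded_linear_cnj spectral_integrable[OF gi]]) simp
  also have "\<dots> = (LINT \<xi>|freq_measure M. cis ((- \<xi>) * x) * g (- \<xi>))"
  proof (rule integral_cong_AE)
    show "AE \<xi> in freq_measure M. cnj (cis (\<xi> * x) * g \<xi>) = cis ((- \<xi>) * x) * g (- \<xi>)"
      using sym by eventually_elim (simp add: cis_cnj)
    show "(\<lambda>\<xi>. cnj (cis (\<xi> * x) * g \<xi>)) \<in> borel_measurable (freq_measure M)"
      "(\<lambda>\<xi>. cis ((- \<xi>) * x) * g (- \<xi>)) \<in> borel_measurable (freq_measure M)"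
      unfolding borel_measurable_freq by measurable
  qed
  also have "\<dots> = spectral (freq_measure M) g x"
    unfolding spectral_def by (rule integral_freq_reflect[of "\<lambda>\<xi>. cis (\<xi> * x) * g \<xi>"]) measurable
  finally have "cnj (synth M g x) = synth M g x" by (simp add: synth_def)
  then show ?thesis by (metis Reals_cnj_iff of_real_Re)
qed

lemma smooth_data_of_transform:
  assumes gm[measurable]: "g \<in> borel_measurable borel" and g: "\<And>\<sigma>. weighted_L2 M \<sigma> g"
    and sym: "AE \<xi> in freq_measure M. g (- \<xi>) = cnj (g \<xi>)"
  shows "\<exists>u\<in>smooth_data M. has_transform M u g"
proof -
  have gi: "integrable (freq_measure M) g"
    using weighted_L2_moment[of M 0] g[of 1] by (auto simp: integrable_norm_iff)
  define W where "W x = Re (synth M g x)" for x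
  have cS: "continuous_on UNIV (synth M g)"
    unfolding synth_def[abs_def] by (intro continuous_intros spectral_continuous gi) simp
  have [measurable]: "synth M g \<in> borel_measurable borel" by (rule borel_measurable_continuous_onI[OF cS])
  have Wm[measurable]: "W \<in> borel_measurable borel" unfolding W_def by measurable
  have WS: "of_real (W x) = synth M g x" for x
    unfolding W_def by (rule synth_real[OF gi sym])
  obtain B where B: "\<And>x. cmod (synth M g x) \<le> B"
  proof
    show "cmod (synth M g x) \<le> synth_const M * (LINT \<xi>|freq_measure M. cmod (g \<xi>))" for x
      unfolding synth_def norm_mult
      using spectral_bound[of "freq_measure M" g x] synth_const_pos[of M] by (auto intro!: mult_mono)
  qed
  have Wb: "\<bar>W x\<bar> \<le> B" for x using B[of x] abs_Re_le_cmod[of "synth M g x"] by (simp add: W_def)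
  define u where "u = fun_dist M W"
  have rd: "Defs.real_distribution M u" unfolding u_def by (rule real_distribution_fun_dist[OF Wm Wb])
  have tr: "has_transform M u g"
  proof (cases M)
    case Real_Line
    have "has_fourier u g"
    proof (rule has_fourier_of_synthesis)
      show "integrable lborel g" using gi Real_Line by simp
      fix \<phi> assume "\<phi> \<in> schwartz"
      then have "u \<phi> = (LINT x|lborel. synth M g x * \<phi> x)"
        unfolding WS[symmetric]
        by (simp add: u_def fun_dist_def Real_Line fun_domain_def set_lebesgue_integral_def)
      then show "u \<phi> = of_real (1 / (2 * pi)) * (LINT x|lborel. spectral lborel g x * \<phi> x)"
        by (simp add: synth_def synth_const_def Real_Line mult.assoc)
    qed (rule gm)
    then show ?thesis by (simp add: has_transform_def Real_Line)
  next
    case Torus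
    have "fourier_coeff u k = g (of_int k)" for k
    proof -
      have t: "(\<lambda>x. cis (- (of_int k * x))) \<in> test_fun Torus"
        using cis_test_fun_Torus[of 1 "- k"] by simp
      have "u (\<lambda>x. cis (- (of_int k * x))) = (LINT x:{0..2 * pi}|lborel. synth M g x * cis (- (of_int k * x)))"
        unfolding WS[symmetric] using t by (simp add: u_def fun_dist_def Torus fun_domain_def)
      also have "\<dots> = of_real (2 * pi) * g (of_int k)"
        using torus_coefficient_of_synthesis[OF gm, of k] gi
        by (simp add: synth_def synth_const_def Torus del: freq_measure.simps)
      finally show ?thesis by (simp add: fourier_coeff_def)
    qed
    then show ?thesis by (simp add: has_transform_def Torus)
  qed
  have "u \<in> smooth_data M" using rd tr g by (auto simp: smooth_data_def sobolev_iff_transform)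
  then show ?thesis using tr by blast
qed

text \<open>For a real distribution, \<open>\<lambda>\<xi>. cnj (g (- \<xi>))\<close> is a transform too, and transforms are
  unique.\<close>

lemma transform_conjugate_symmetric:
  assumes u: "Defs.real_distribution M u" and g: "has_transform M u g"
  shows "AE \<xi> in freq_measure M. g (- \<xi>) = cnj (g \<xi>)"
proof -
  have gm[measurable]: "g \<in> borel_measurable borel" using g by (simp add: has_transform_def)
  have cn: "u (\<lambda>x. cnj (\<phi> x)) = cnj (u \<phi>)" if "\<phi> \<in> test_fun M" for \<phi>
    using u that unfolding Defs.real_distribution_def by blast
  show ?thesis
  proof (cases M)
    case Real_Line
    have F: "has_fourier u g" using g Real_Line by (simp add: has_transform_def)
    have "has_fourier u (\<lambda>\<xi>. cnj (g (- \<xi>)))"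
      unfolding has_fourier_def
    proof (intro conjI ballI)
      show "(\<lambda>\<xi>. cnj (g (- \<xi>))) \<in> borel_measurable lborel" by measurable
      fix \<phi> assume \<phi>: "\<phi> \<in> schwartz"
      let ?\<psi> = "\<lambda>\<xi>. cnj (\<phi> (- \<xi>))"
      have \<psi>: "?\<psi> \<in> schwartz" by (intro schwartz_intros \<phi>)
      have i: "integrable lborel (\<lambda>\<xi>. g \<xi> * ?\<psi> \<xi>)" and e: "u (fourier ?\<psi>) = (LINT \<xi>|lborel. g \<xi> * ?\<psi> \<xi>)"
        using F[unfolded has_fourier_def, THEN conjunct2, THEN bspec, OF \<psi>] by (rule conjunct1, rule conjunct2)
      have ir: "integrable lborel (\<lambda>\<xi>. g (- \<xi>) * ?\<psi> (- \<xi>))"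
        using lborel_integrable_real_affine[OF i, of "- 1" 0] by simp
      from integrable_bounded_linear[OF bounded_linear_cnj ir]
      show "integrable lborel (\<lambda>\<xi>. cnj (g (- \<xi>)) * \<phi> \<xi>)" by simp
      have "fourier ?\<psi> = (\<lambda>x. cnj (fourier \<phi> x))"
      proof
        fix x
        have i': "integrable lborel (\<lambda>\<xi>. cis (\<xi> * (- x)) * \<phi> \<xi>)"
          by (rule spectral_integrable[OF schwartz_integrable[OF \<phi>]]) simp
        have "cnj (fourier \<phi> x) = (LINT \<xi>|lborel. cnj (cis (\<xi> * (- x)) * \<phi> \<xi>))"
          unfolding fourier_eq_spectral spectral_def
          by (rule integral_bounded_linear[symmetric, OF bounded_linear_cnj i'])
        also have "\<dots> = (LINT \<xi>|lborel. cis (x * \<xi>) * cnj (\<phi> \<xi>))"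
          by (simp add: cis_cnj mult.commute)
        also have "\<dots> = (LINT \<xi>|lborel. cis (x * (- \<xi>)) * cnj (\<phi> (- \<xi>)))"
          using lborel_integral_real_affine[of "- 1" "\<lambda>\<xi>. cis (x * \<xi>) * cnj (\<phi> \<xi>)" 0] by simp
        finally show "fourier ?\<psi> x = cnj (fourier \<phi> x)" by (simp add: fourier_def)
      qed
      then have "u (fourier ?\<psi>) = cnj (u (fourier \<phi>))"
        using cn[of "fourier \<phi>"] fourier_schwartz[OF \<phi>] Real_Line by simp
      then have "u (fourier \<phi>) = cnj (LINT \<xi>|lborel. g \<xi> * ?\<psi> \<xi>)" using e by simp
      also have "\<dots> = cnj (LINT \<xi>|lborel. g (- \<xi>) * ?\<psi> (- \<xi>))"
        using lborel_integral_real_affine[of "- 1" "\<lambda>\<xi>. g \<xi> * ?\<psi> \<xi>" 0] by simp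
      also have "\<dots> = (LINT \<xi>|lborel. cnj (g (- \<xi>) * ?\<psi> (- \<xi>)))"
        by (rule integral_bounded_linear[symmetric, OF bounded_linear_cnj ir])
      finally show "u (fourier \<phi>) = (LINT \<xi>|lborel. cnj (g (- \<xi>)) * \<phi> \<xi>)" by simp
    qed
    from has_fourier_unique[OF F this] have "AE \<xi> in lborel. g \<xi> = cnj (g (- \<xi>))" .
    then show ?thesis unfolding Real_Line freq_measure.simps by eventually_elim simp
  next
    case Torus
    have "g (- of_int k) = cnj (g (of_int k))" for k :: int
    proof -
      have t: "(\<lambda>x. cis (- (of_int k * x))) \<in> test_fun M"
        using cis_test_fun_Torus[of 1 "- k"] Torus by simp
      have gk: "g (of_int k) = fourier_coeff u k" for k
        using g Torus by (simp add: has_transform_def)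
      show ?thesis
        using cn[OF t] gk[of "- k"] by (simp add: gk fourier_coeff_def cis_cnj)
    qed
    then show ?thesis unfolding Torus freq_measure.simps
      by (subst AE_distr_iff) (simp_all add: AE_count_space)
  qed
qed

section \<open>Frequency truncation and high-frequency waves\<close>

text \<open>On a bounded set of frequencies all the weights are comparable.\<close>

lemma weighted_L2_cutoff_smooth:
  assumes g: "weighted_L2 M s g" and z: "\<And>\<xi>. R < \<bar>\<xi>\<bar> \<Longrightarrow> g \<xi> = 0"
  shows "weighted_L2 M \<sigma> g"
proof -
  have [measurable]: "g \<in> borel_measurable borel" using g by (simp add: weighted_L2_def)
  have i: "integrable (freq_measure M) (\<lambda>\<xi>. (1 + \<xi>\<^sup>2) powr s * (cmod (g \<xi>))\<^sup>2)" using g unfolding weighted_L2_def by blast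
  define K where "K = (1 + R\<^sup>2) powr (max 0 (\<sigma> - s))"
  have "integrable (freq_measure M) (\<lambda>\<xi>. (1 + \<xi>\<^sup>2) powr \<sigma> * (cmod (g \<xi>))\<^sup>2)"
  proof (rule Bochner_Integration.integrable_bound[OF integrable_mult_right[OF i, of K]])
    show "(\<lambda>\<xi>. (1 + \<xi>\<^sup>2) powr \<sigma> * (cmod (g \<xi>))\<^sup>2) \<in> borel_measurable (freq_measure M)"
      unfolding borel_measurable_freq by measurable
    show "AE \<xi> in freq_measure M. norm ((1 + \<xi>\<^sup>2) powr \<sigma> * (cmod (g \<xi>))\<^sup>2) \<le> norm (K * ((1 + \<xi>\<^sup>2) powr s * (cmod (g \<xi>))\<^sup>2))"
    proof (rule AE_I2)
      fix \<xi>
      have "(1 + \<xi>\<^sup>2) powr \<sigma> * (cmod (g \<xi>))\<^sup>2 \<le> K * (1 + \<xi>\<^sup>2) powr s * (cmod (g \<xi>))\<^sup>2"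
      proof (cases "R < \<bar>\<xi>\<bar>")
        case False
        then have "\<bar>\<xi>\<bar>\<^sup>2 \<le> R\<^sup>2" by (intro power_mono) auto
        then have le: "1 + \<xi>\<^sup>2 \<le> 1 + R\<^sup>2" by simp
        have "(1 + \<xi>\<^sup>2) powr (\<sigma> - s) \<le> (1 + \<xi>\<^sup>2) powr (max 0 (\<sigma> - s))" by (rule powr_mono) auto
        also have "\<dots> \<le> K" unfolding K_def by (rule powr_mono2[OF _ _ le]) auto
        finally have "(1 + \<xi>\<^sup>2) powr (\<sigma> - s) * (1 + \<xi>\<^sup>2) powr s \<le> K * (1 + \<xi>\<^sup>2) powr s"
          by (rule mult_right_mono) simp
        then have "(1 + \<xi>\<^sup>2) powr \<sigma> \<le> K * (1 + \<xi>\<^sup>2) powr s" by (simp add: powr_add[symmetric])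
        then show ?thesis by (rule mult_right_mono) simp
      qed (simp add: z)
      moreover have "0 \<le> K" by (simp add: K_def)
      ultimately show "norm ((1 + \<xi>\<^sup>2) powr \<sigma> * (cmod (g \<xi>))\<^sup>2) \<le> norm (K * ((1 + \<xi>\<^sup>2) powr s * (cmod (g \<xi>))\<^sup>2))"
        by (simp add: abs_mult mult.assoc)
    qed
  qed
  then show ?thesis by (simp add: weighted_L2_def)
qed

lemma weighted_norm_truncation:
  assumes g: "weighted_L2 M s g" and e: "e > 0"
  shows "\<exists>n::nat. weighted_L2 M s (\<lambda>\<xi>. indicator {- real n..real n} \<xi> * g \<xi>) \<and>
    weighted_norm M s (\<lambda>\<xi>. indicator {- real n..real n} \<xi> * g \<xi> - g \<xi>) < e"
proof -
  have [measurable]: "g \<in> borel_measurable borel" using g by (simp add: weighted_L2_def)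
  let ?w = "\<lambda>\<xi>. (1 + \<xi>\<^sup>2) powr s * (cmod (g \<xi>))\<^sup>2"
  let ?t = "\<lambda>n \<xi>. (1 + \<xi>\<^sup>2) powr s * (cmod (indicator {- real n..real n} \<xi> * g \<xi> - g \<xi>))\<^sup>2"
  have i: "integrable (freq_measure M) ?w" using g unfolding weighted_L2_def by blast
  have "(\<lambda>n. LINT \<xi>|freq_measure M. ?t n \<xi>) \<longlonglongrightarrow> (LINT \<xi>|freq_measure M. 0)"
  proof (rule integral_dominated_convergence[OF _ _ i])
    show "AE \<xi> in freq_measure M. (\<lambda>n. ?t n \<xi>) \<longlonglongrightarrow> 0"
    proof (rule AE_I2, rule tendsto_eventually)
      fix \<xi> :: real
      obtain N :: nat where "\<bar>\<xi>\<bar> \<le> real N" using real_arch_simple by blast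
      then show "\<forall>\<^sub>F n in sequentially. ?t n \<xi> = 0"
        by (auto simp: eventually_sequentially indicator_def intro!: exI[of _ N])
    qed
    show "AE \<xi> in freq_measure M. norm (?t n \<xi>) \<le> ?w \<xi>" for n
      by (rule AE_I2) (auto simp: indicator_def)
    show "?t n \<in> borel_measurable (freq_measure M)" for n
      unfolding borel_measurable_freq by measurable
  qed simp
  then have "(\<lambda>n. LINT \<xi>|freq_measure M. ?t n \<xi>) \<longlonglongrightarrow> 0" by simp
  from tendsto_real_sqrt[OF this]
  have "(\<lambda>n. weighted_norm M s (\<lambda>\<xi>. indicator {- real n..real n} \<xi> * g \<xi> - g \<xi>)) \<longlonglongrightarrow> 0"
    by (simp add: weighted_norm_def)
  from order_tendstoD(2)[OF this e] obtain n :: nat where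
    n: "weighted_norm M s (\<lambda>\<xi>. indicator {- real n..real n} \<xi> * g \<xi> - g \<xi>) < e"
    by (auto simp: eventually_sequentially)
  have "integrable (freq_measure M) (\<lambda>\<xi>. (1 + \<xi>\<^sup>2) powr s * (cmod (indicator {- real n..real n} \<xi> * g \<xi>))\<^sup>2)"
  proof (rule Bochner_Integration.integrable_bound[OF i])
    show "(\<lambda>\<xi>. (1 + \<xi>\<^sup>2) powr s * (cmod (indicator {- real n..real n} \<xi> * g \<xi>))\<^sup>2) \<in> borel_measurable (freq_measure M)"
      unfolding borel_measurable_freq by measurable
    show "AE \<xi> in freq_measure M. norm ((1 + \<xi>\<^sup>2) powr s * (cmod (indicator {- real n..real n} \<xi> * g \<xi>))\<^sup>2) \<le> norm (?w \<xi>)"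
      by (rule AE_I2) (auto simp: indicator_def)
  qed
  then have "weighted_L2 M s (\<lambda>\<xi>. indicator {- real n..real n} \<xi> * g \<xi>)" by (simp add: weighted_L2_def)
  with n show ?thesis by blast
qed

text \<open>Each half of the band has unit length, so that on the torus the band contains the
  two adjacent frequencies \<open>N\<close> and \<open>N + 1\<close>. A single frequency would not do there: its
  square contributes at low frequency only a constant, which \<open>\<partial>\<^sub>x\<close> annihilates.\<close>

definition freq_band :: "nat \<Rightarrow> real set" where
  "freq_band N = {real N..real N + 1} \<union> {- (real N + 1)..- real N}"

lemma freq_band_measurable [measurable]: "freq_band N \<in> sets borel"
  by (simp add: freq_band_def)

lemma integrable_indicator_band:
  fixes a b :: real
  shows "integrable lborel (indicator {a..b} :: real \<Rightarrow> real)"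
  by (rule integrable_real_indicator) (auto simp: emeasure_lborel_Icc_eq)

lemma torus_band_sum:
  fixes f :: "real \<Rightarrow> 'a::{banach, second_countable_topology}"
  assumes [measurable]: "f \<in> borel_measurable borel" and N: "N \<ge> 1"
  shows "integrable (freq_measure Torus) (\<lambda>\<xi>. indicator (freq_band N) \<xi> *\<^sub>R f \<xi>)"
    and "(LINT \<xi>|freq_measure Torus. indicator (freq_band N) \<xi> *\<^sub>R f \<xi>) =
      f (real N) + f (real N + 1) + f (- real N) + f (- (real N + 1))"
proof -
  let ?f = "\<lambda>k::int. indicator (freq_band N) (of_int k) *\<^sub>R f (of_int k)"
  let ?K = "{int N, int N + 1, - int N, - (int N + 1)}"
  have sub: "{k \<in> UNIV. ?f k \<noteq> 0} \<subseteq> ?K"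
  proof
    fix k assume "k \<in> {k \<in> UNIV. ?f k \<noteq> 0}"
    then have "of_int k \<in> freq_band N" by (auto simp: indicator_def split: if_splits)
    then have "(of_int (int N) \<le> (of_int k :: real) \<and> (of_int k :: real) \<le> of_int (int N + 1)) \<or>
        (of_int (- (int N + 1)) \<le> (of_int k :: real) \<and> (of_int k :: real) \<le> of_int (- int N))"
      by (auto simp: freq_band_def)
    then have "(int N \<le> k \<and> k \<le> int N + 1) \<or> (- (int N + 1) \<le> k \<and> k \<le> - int N)"
      unfolding of_int_le_iff .
    then show "k \<in> ?K" by auto
  qed
  have fin: "finite {k \<in> UNIV. ?f k \<noteq> 0}" by (rule finite_subset[OF sub]) simp
  show "integrable (freq_measure Torus) (\<lambda>\<xi>. indicator (freq_band N) \<xi> *\<^sub>R f \<xi>)"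
  proof (subst integrable_freq_Torus)
    have "Infinite_Set_Sum.abs_summable_on ?f UNIV \<longleftrightarrow> Infinite_Set_Sum.abs_summable_on ?f ?K"
      by (rule abs_summable_on_cong_neutral) (use sub in auto)
    then show "integrable (count_space UNIV) ?f"
      by (simp add: Infinite_Set_Sum.abs_summable_on_def integrable_count_space)
  qed measurable
  have "(LINT \<xi>|freq_measure Torus. indicator (freq_band N) \<xi> *\<^sub>R f \<xi>) = (LINT k|count_space UNIV. ?f k)"
    by (rule integral_freq_Torus) measurable
  also have "\<dots> = (\<Sum>k | k \<in> UNIV \<and> ?f k \<noteq> 0. ?f k)"
    by (rule lebesgue_integral_count_space_finite_support[OF fin])
  also have "\<dots> = (\<Sum>k\<in>?K. ?f k)"
    by (rule sum.mono_neutral_left) (use sub in auto)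
  also have "\<dots> = (\<Sum>k\<in>?K. f (of_int k))"
    by (rule sum.cong) (auto simp: freq_band_def)
  also have "\<dots> = f (of_int (int N)) + (f (of_int (int N + 1)) + (f (of_int (- int N)) + f (of_int (- (int N + 1)))))"
    using N by (subst sum.insert; simp)+
  also have "\<dots> = f (real N) + f (real N + 1) + f (- real N) + f (- (real N + 1))"
    by (simp add: add.assoc)
  finally show "(LINT \<xi>|freq_measure Torus. indicator (freq_band N) \<xi> *\<^sub>R f \<xi>) =
      f (real N) + f (real N + 1) + f (- real N) + f (- (real N + 1))" .
qed

lemma freq_band_mass:
  assumes "N \<ge> 1"
  shows "integrable (freq_measure M) (indicator (freq_band N) :: real \<Rightarrow> real)"
    and "(LINT \<xi>|freq_measure M. indicator (freq_band N) \<xi> :: real) \<le> 4"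
proof -
  have "integrable (freq_measure M) (indicator (freq_band N) :: real \<Rightarrow> real) \<and>
    (LINT \<xi>|freq_measure M. indicator (freq_band N) \<xi> :: real) \<le> 4"
  proof (cases M)
    case Real_Line
    let ?g = "\<lambda>\<xi>. indicator {real N..real N + 1} \<xi> + indicator {- (real N + 1)..- real N} \<xi> :: real"
    have gi: "integrable lborel ?g" by (intro Bochner_Integration.integrable_add integrable_indicator_band)
    have i: "integrable lborel (indicator (freq_band N) :: real \<Rightarrow> real)"
      by (rule Bochner_Integration.integrable_bound[OF gi]) (auto simp: indicator_def freq_band_def)
    have "(LINT \<xi>|lborel. indicator (freq_band N) \<xi> :: real) \<le> (LINT \<xi>|lborel. ?g \<xi>)"
      by (rule integral_mono[OF i gi]) (auto simp: indicator_def freq_band_def)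
    also have "\<dots> = 2"
      by (subst Bochner_Integration.integral_add) (auto intro!: integrable_indicator_band)
    finally show ?thesis using i Real_Line by simp
  next
    case Torus
    then show ?thesis using torus_band_sum[of "\<lambda>_. 1 :: real" N] assms by (simp del: freq_measure.simps)
  qed
  then show "integrable (freq_measure M) (indicator (freq_band N) :: real \<Rightarrow> real)"
    and "(LINT \<xi>|freq_measure M. indicator (freq_band N) \<xi> :: real) \<le> 4" by auto
qed

definition band_wave :: "real \<Rightarrow> nat \<Rightarrow> real \<Rightarrow> complex" where
  "band_wave \<mu> N \<xi> = of_real (\<mu> * indicator (freq_band N) \<xi>)"

lemma band_wave_weighted_L2:
  assumes N: "N \<ge> 1" shows "weighted_L2 M \<sigma> (band_wave \<mu> N)"
proof (rule weighted_L2_cutoff_smooth[where s = 0 and R = "real N + 1"])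
  have e: "(1 + \<xi>\<^sup>2) powr 0 * (cmod (band_wave \<mu> N \<xi>))\<^sup>2 = \<mu>\<^sup>2 * indicator (freq_band N) \<xi>" for \<xi>
    by (auto simp: band_wave_def norm_mult indicator_def)
  show "weighted_L2 M 0 (band_wave \<mu> N)"
    unfolding weighted_L2_def e using integrable_mult_right[OF freq_band_mass(1)[OF N, of M], of "\<mu>\<^sup>2"]
    by (simp add: band_wave_def[abs_def])
  show "real N + 1 < \<bar>\<xi>\<bar> \<Longrightarrow> band_wave \<mu> N \<xi> = 0" for \<xi>
    by (auto simp: band_wave_def freq_band_def indicator_def)
qed

lemma band_wave_even: "band_wave \<mu> N (- \<xi>) = cnj (band_wave \<mu> N \<xi>)"
  by (auto simp: band_wave_def freq_band_def indicator_def)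

text \<open>This is where \<open>s < 0\<close> enters: on the band the weight is at most \<open>N powr (2 * s)\<close>.\<close>

lemma band_wave_small:
  assumes s: "s < 0" and e: "e > 0"
  shows "\<exists>N\<ge>1. weighted_norm M s (band_wave \<mu> N) < e"
proof -
  have "(weighted_norm M s (band_wave \<mu> N))\<^sup>2 \<le> 4 * \<mu>\<^sup>2 * real N powr (2 * s)" if N: "N \<ge> 1" for N
  proof -
    have i1: "integrable (freq_measure M) (\<lambda>\<xi>. (1 + \<xi>\<^sup>2) powr s * (cmod (band_wave \<mu> N \<xi>))\<^sup>2)"
      using band_wave_weighted_L2[OF N, of M s \<mu>] unfolding weighted_L2_def by blast
    have i2: "integrable (freq_measure M) (\<lambda>\<xi>. (\<mu>\<^sup>2 * real N powr (2 * s)) * indicator (freq_band N) \<xi>)"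
      by (rule integrable_mult_right[OF freq_band_mass(1)[OF N]])
    have "(weighted_norm M s (band_wave \<mu> N))\<^sup>2 = (LINT \<xi>|freq_measure M. (1 + \<xi>\<^sup>2) powr s * (cmod (band_wave \<mu> N \<xi>))\<^sup>2)"
      by (simp add: weighted_norm_def)
    also have "\<dots> \<le> (LINT \<xi>|freq_measure M. (\<mu>\<^sup>2 * real N powr (2 * s)) * indicator (freq_band N) \<xi>)"
    proof (rule integral_mono[OF i1 i2])
      fix \<xi>
      show "(1 + \<xi>\<^sup>2) powr s * (cmod (band_wave \<mu> N \<xi>))\<^sup>2 \<le> (\<mu>\<^sup>2 * real N powr (2 * s)) * indicator (freq_band N) \<xi>"
      proof (cases "\<xi> \<in> freq_band N")
        case True
        then have "real N \<le> \<bar>\<xi>\<bar>" by (auto simp: freq_band_def)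
        then have "(real N)\<^sup>2 \<le> \<bar>\<xi>\<bar>\<^sup>2" by (intro power_mono) auto
        then have "(real N)\<^sup>2 \<le> 1 + \<xi>\<^sup>2" by simp
        then have "(1 + \<xi>\<^sup>2) powr s \<le> ((real N)\<^sup>2) powr s"
          using N s by (intro powr_mono2') auto
        also have "((real N)\<^sup>2) powr s = real N powr (2 * s)"
          using N by (simp add: powr_powr[symmetric] powr_numeral)
        finally show ?thesis using True
          by (simp add: band_wave_def norm_mult mult.commute mult_left_mono)
      qed (simp add: band_wave_def)
    qed
    also have "\<dots> = (\<mu>\<^sup>2 * real N powr (2 * s)) * (LINT \<xi>|freq_measure M. indicator (freq_band N) \<xi>)"
      by (rule integral_mult_right_zero)
    also have "\<dots> \<le> (\<mu>\<^sup>2 * real N powr (2 * s)) * 4"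
      by (rule mult_left_mono[OF freq_band_mass(2)[OF N]]) simp
    finally show ?thesis by (simp add: mult_ac)
  qed
  moreover have "(\<lambda>N. 4 * \<mu>\<^sup>2 * real N powr (2 * s)) \<longlonglongrightarrow> 4 * \<mu>\<^sup>2 * 0"
    using s by (intro tendsto_mult_left tendsto_neg_powr filterlim_real_sequentially) auto
  then have "\<forall>\<^sub>F N in sequentially. 4 * \<mu>\<^sup>2 * real N powr (2 * s) < e\<^sup>2"
    using e by (intro order_tendstoD(2)[where y = 0]) auto
  then obtain N0 where "\<And>N. N \<ge> N0 \<Longrightarrow> 4 * \<mu>\<^sup>2 * real N powr (2 * s) < e\<^sup>2"
    unfolding eventually_sequentially by blast
  ultimately have "(weighted_norm M s (band_wave \<mu> (max 1 N0)))\<^sup>2 < e\<^sup>2"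
    by (meson le_less_trans max.cobounded1 max.cobounded2)
  then have "weighted_norm M s (band_wave \<mu> (max 1 N0)) < e" using e by (simp add: power_less_imp_less_base)
  then show ?thesis by (intro exI[of _ "max 1 N0"]) simp
qed

lemma band_wave_synth_bound:
  assumes "N \<ge> 1" shows "cmod (synth M (band_wave \<mu> N) x) \<le> 4 * \<bar>\<mu>\<bar>"
proof -
  have "cmod (spectral (freq_measure M) (band_wave \<mu> N) x) \<le> (LINT \<xi>|freq_measure M. cmod (band_wave \<mu> N \<xi>))"
    by (rule spectral_bound)
  also have "\<dots> = (LINT \<xi>|freq_measure M. \<bar>\<mu>\<bar> * indicator (freq_band N) \<xi>)"
    by (rule Bochner_Integration.integral_cong) (auto simp: band_wave_def norm_mult indicator_def)
  also have "\<dots> = \<bar>\<mu>\<bar> * (LINT \<xi>|freq_measure M. indicator (freq_band N) \<xi>)"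
    by (rule integral_mult_right_zero)
  also have "\<dots> \<le> \<bar>\<mu>\<bar> * 4" by (rule mult_left_mono[OF freq_band_mass(2)[OF assms]]) simp
  finally have b: "cmod (spectral (freq_measure M) (band_wave \<mu> N) x) \<le> 4 * \<bar>\<mu>\<bar>" by simp
  have c: "synth_const M \<le> 1"
  proof (cases M)
    case Real_Line
    have "1 \<le> 2 * pi" using pi_gt3 by simp
    then show ?thesis by (simp add: synth_const_def Real_Line divide_le_eq)
  qed (simp add: synth_const_def)
  have "synth_const M * cmod (spectral (freq_measure M) (band_wave \<mu> N) x) \<le> 1 * (4 * \<bar>\<mu>\<bar>)"
    by (rule mult_mono[OF c b]) auto
  then show ?thesis using synth_const_pos[of M] by (simp add: synth_def norm_mult)
qed

section \<open>Sobolev embedding along smooth curves\<close>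

text \<open>The multiplier \<open>a\<close> is \<open>1\<close> for the function itself and \<open>\<i> * \<xi>\<close> for its derivative.\<close>

lemma synth_weighted_bound:
  "\<exists>C\<ge>0. \<forall>g a x. weighted_L2 M (2 * real m + 1) g \<and> (\<forall>\<xi>. cmod (a \<xi>) \<le> (1 + \<xi>\<^sup>2) ^ m) \<longrightarrow>
     cmod (synth M (\<lambda>\<xi>. a \<xi> * g \<xi>) x) \<le> C * weighted_norm M (2 * real m + 1) g"
proof -
  obtain C where C: "C \<ge> 0" "\<And>g. weighted_L2 M (2 * real m + 1) g \<Longrightarrow> integrable (freq_measure M) (\<lambda>\<xi>. (1 + \<xi>\<^sup>2) ^ m * cmod (g \<xi>))"
    "\<And>g. weighted_L2 M (2 * real m + 1) g \<Longrightarrow> (LINT \<xi>|freq_measure M. (1 + \<xi>\<^sup>2) ^ m * cmod (g \<xi>)) \<le> C * weighted_norm M (2 * real m + 1) g"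
    using weighted_L2_moment[of M m] by blast
  have "cmod (synth M (\<lambda>\<xi>. a \<xi> * g \<xi>) x) \<le> (synth_const M * C) * weighted_norm M (2 * real m + 1) g"
    if g: "weighted_L2 M (2 * real m + 1) g" and a: "\<And>\<xi>. cmod (a \<xi>) \<le> (1 + \<xi>\<^sup>2) ^ m" for g a x
  proof -
    have "cmod (spectral (freq_measure M) (\<lambda>\<xi>. a \<xi> * g \<xi>) x) \<le> (LINT \<xi>|freq_measure M. cmod (a \<xi> * g \<xi>))"
      by (rule spectral_bound)
    also have "\<dots> \<le> (LINT \<xi>|freq_measure M. (1 + \<xi>\<^sup>2) ^ m * cmod (g \<xi>))"
      by (rule integral_mono_AE'[OF C(2)[OF g]]) (auto simp: norm_mult intro!: AE_I2 mult_right_mono a)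
    also have "\<dots> \<le> C * weighted_norm M (2 * real m + 1) g" by (rule C(3)[OF g])
    finally show ?thesis using synth_const_pos[of M] by (simp add: synth_def norm_mult mult.assoc mult_left_mono)
  qed
  then show ?thesis using C(1) synth_const_pos[of M] by (intro exI[of _ "synth_const M * C"]) auto
qed

lemma weighted_L2_integrable: "weighted_L2 M 1 g \<Longrightarrow> integrable (freq_measure M) g"
proof -
  assume g: "weighted_L2 M 1 g"
  then have [measurable]: "g \<in> borel_measurable borel" by (simp add: weighted_L2_def)
  have "integrable (freq_measure M) (\<lambda>\<xi>. cmod (g \<xi>))" using weighted_L2_moment[of M 0] g by auto
  then show ?thesis by (rule integrable_norm_cancel) simp
qed

lemma synth_diff:
  assumes "integrable (freq_measure M) g" "integrable (freq_measure M) h"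
  shows "synth M (\<lambda>\<xi>. g \<xi> - h \<xi>) x = synth M g x - synth M h x"
proof -
  have "spectral (freq_measure M) (\<lambda>\<xi>. g \<xi> - h \<xi>) x = spectral (freq_measure M) g x - spectral (freq_measure M) h x"
    unfolding spectral_def right_diff_distrib
    by (rule Bochner_Integration.integral_diff) (auto intro!: spectral_integrable assms)
  then show ?thesis by (simp add: synth_def right_diff_distrib)
qed

lemma sobolev_dist_transform:
  assumes "has_transform M u g" "weighted_L2 M \<sigma> g" "has_transform M v h" "weighted_L2 M \<sigma> h"
  shows "sobolev_dist M \<sigma> u v = weighted_norm M \<sigma> (\<lambda>\<xi>. g \<xi> - h \<xi>)"
  unfolding sobolev_dist_def
  by (rule sobolev_norm_transform[OF has_transform_diff[OF assms(1,3)] weighted_L2_diff(1)[OF assms(2,4)]])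

lemma smooth_transform:
  assumes "\<And>\<sigma>. u \<in> sobolev M \<sigma>"
  shows "\<exists>g. has_transform M u g \<and> (\<forall>\<sigma>. weighted_L2 M \<sigma> g)"
proof -
  obtain g where g: "has_transform M u g" "weighted_L2 M 0 g" using assms[of 0] by (auto simp: sobolev_iff_transform)
  have "weighted_L2 M \<sigma> g" for \<sigma>
  proof -
    obtain h where h: "has_transform M u h" "weighted_L2 M \<sigma> h" using assms[of \<sigma>] by (auto simp: sobolev_iff_transform)
    have [measurable]: "g \<in> borel_measurable borel" "h \<in> borel_measurable borel"
      using g h by (auto simp: weighted_L2_def)
    have i: "integrable (freq_measure M) (\<lambda>\<xi>. (1 + \<xi>\<^sup>2) powr \<sigma> * (cmod (h \<xi>))\<^sup>2)" using h unfolding weighted_L2_def by blast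
    have "integrable (freq_measure M) (\<lambda>\<xi>. (1 + \<xi>\<^sup>2) powr \<sigma> * (cmod (g \<xi>))\<^sup>2)"
    proof (rule Bochner_Integration.integrable_bound[OF i])
      show "(\<lambda>\<xi>. (1 + \<xi>\<^sup>2) powr \<sigma> * (cmod (g \<xi>))\<^sup>2) \<in> borel_measurable (freq_measure M)"
        unfolding borel_measurable_freq by measurable
      show "AE \<xi> in freq_measure M. norm ((1 + \<xi>\<^sup>2) powr \<sigma> * (cmod (g \<xi>))\<^sup>2) \<le> norm ((1 + \<xi>\<^sup>2) powr \<sigma> * (cmod (h \<xi>))\<^sup>2)"
        using has_transform_unique[OF g(1) h(1)] by eventually_elim simp
    qed
    then show ?thesis by (simp add: weighted_L2_def)
  qed
  with g(1) show ?thesis by blast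
qed

text \<open>The sup norm of a difference is controlled by the distance in \<open>H\<^sup>1\<close>, that of the
  difference of derivatives by the distance in \<open>H\<^sup>3\<close>.\<close>

lemma smooth_curve_sup_norm:
  assumes u: "u \<in> (\<Inter>\<sigma>. sobolev_curves M \<sigma> T)"
    and rep: "\<And>t. t \<in> {0..T} \<Longrightarrow> represents M (U t) (u t)"
    and sm: "\<And>t. t \<in> {0..T} \<Longrightarrow> smooth_fun (U t)"
  shows "sup_norm_curve T U" and "sup_norm_curve T (\<lambda>t. D_x (U t))"
proof -
  have us: "u t \<in> sobolev M \<sigma>" and uc: "((\<lambda>\<tau>. sobolev_dist M \<sigma> (u \<tau>) (u t)) \<longlongrightarrow> 0) (at t within {0..T})"
    if "t \<in> {0..T}" for t \<sigma>
    using u that unfolding sobolev_curves_def by blast+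
  define G where "G t = (SOME g. has_transform M (u t) g \<and> (\<forall>\<sigma>. weighted_L2 M \<sigma> g))" for t
  have G: "has_transform M (u t) (G t)" "\<And>\<sigma>. weighted_L2 M \<sigma> (G t)" if "t \<in> {0..T}" for t
    using someI_ex[OF smooth_transform[OF us[OF that]]] unfolding G_def by blast+
  have Gm: "G t \<in> borel_measurable borel" if "t \<in> {0..T}" for t
    using G(2)[OF that, of 0] by (simp add: weighted_L2_def)
  have d0: "(U t has_vector_derivative D_x (U t) x) (at x)" if "t \<in> {0..T}" for t x
    using smooth_fun_has_derivative[OF sm[OF that], of 0 x] by simp
  have S0: "of_real (U t x) = synth M (\<lambda>\<xi>. 1 * G t \<xi>) x" if t: "t \<in> {0..T}" for t x
  proof -
    have "continuous_on UNIV (U t)"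
      using d0[OF t] by (intro continuous_at_imp_continuous_on) (auto dest: has_vector_derivative_continuous)
    from representation_by_synthesis[OF rep[OF t] this G(1)[OF t] weighted_L2_integrable[OF G(2)[OF t]]]
    show ?thesis by simp
  qed
  have S1: "of_real (D_x (U t) x) = synth M (\<lambda>\<xi>. (\<i> * of_real \<xi>) * G t \<xi>) x" if t: "t \<in> {0..T}" for t x
  proof -
    have "integrable (freq_measure M) (\<lambda>\<xi>. (1 + \<xi>\<^sup>2) ^ 1 * cmod (G t \<xi>))"
      using weighted_L2_moment[of M 1] G(2)[OF t] by blast
    then have "(spectral (freq_measure M) (G t) has_vector_derivative
        spectral (freq_measure M) (\<lambda>\<xi>. \<i> * of_real \<xi> * G t \<xi>) x) (at x)"
      by (intro spectral_has_vector_derivative Gm t) simp_all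
    from has_vector_derivative_mult_right[OF this, of "of_real (synth_const M)"]
    have "((\<lambda>x. synth M (G t) x) has_vector_derivative synth M (\<lambda>\<xi>. \<i> * of_real \<xi> * G t \<xi>) x) (at x)"
      by (simp add: synth_def)
    moreover have "(\<lambda>x. synth M (G t) x) = (\<lambda>x. of_real (U t x))" using S0[OF t] by simp
    moreover have "((\<lambda>x. complex_of_real (U t x)) has_vector_derivative of_real (D_x (U t) x)) (at x)"
      using d0[OF t, of x] by (simp add: has_vector_derivative_complex_iff has_real_derivative_iff_has_vector_derivative)
    ultimately show ?thesis using vector_derivative_unique_at by metis
  qed
  have key: "sup_norm_curve T V"
    if V: "\<And>t x. t \<in> {0..T} \<Longrightarrow> of_real (V t x) = synth M (\<lambda>\<xi>. a \<xi> * G t \<xi>) x"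
      and a: "\<And>\<xi>. cmod (a \<xi>) \<le> (1 + \<xi>\<^sup>2) ^ m" and am: "a \<in> borel_measurable borel" for V a m
  proof -
    obtain C where C: "C \<ge> 0" "\<And>g x. weighted_L2 M (2 * real m + 1) g \<Longrightarrow>
        cmod (synth M (\<lambda>\<xi>. a \<xi> * g \<xi>) x) \<le> C * weighted_norm M (2 * real m + 1) g"
      using synth_weighted_bound[of M m] a by metis
    have ai: "integrable (freq_measure M) (\<lambda>\<xi>. a \<xi> * G t \<xi>)" if t: "t \<in> {0..T}" for t
    proof (rule Bochner_Integration.integrable_bound)
      note [measurable] = am Gm[OF t]
      show "integrable (freq_measure M) (\<lambda>\<xi>. (1 + \<xi>\<^sup>2) ^ m * cmod (G t \<xi>))"
        using weighted_L2_moment[of M m] G(2)[OF t] by blast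
      show "(\<lambda>\<xi>. a \<xi> * G t \<xi>) \<in> borel_measurable (freq_measure M)"
        unfolding borel_measurable_freq by measurable
      show "AE \<xi> in freq_measure M. norm (a \<xi> * G t \<xi>) \<le> norm ((1 + \<xi>\<^sup>2) ^ m * cmod (G t \<xi>))"
        using a by (intro AE_I2) (simp add: norm_mult mult_right_mono power_abs)
    qed
    have lip: "\<bar>V \<tau> x - V t x\<bar> \<le> C * sobolev_dist M (2 * real m + 1) (u \<tau>) (u t)"
      if "t \<in> {0..T}" "\<tau> \<in> {0..T}" for t \<tau> x
    proof -
      have "of_real (V \<tau> x - V t x) = synth M (\<lambda>\<xi>. a \<xi> * (G \<tau> \<xi> - G t \<xi>)) x"
        unfolding right_diff_distrib synth_diff[OF ai[OF that(2)] ai[OF that(1)]] V[OF that(1), symmetric] V[OF that(2), symmetric]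
        by simp
      then have "\<bar>V \<tau> x - V t x\<bar> = cmod (synth M (\<lambda>\<xi>. a \<xi> * (G \<tau> \<xi> - G t \<xi>)) x)"
        by (metis norm_of_real)
      also have "\<dots> \<le> C * weighted_norm M (2 * real m + 1) (\<lambda>\<xi>. G \<tau> \<xi> - G t \<xi>)"
        by (rule C(2)[OF weighted_L2_diff(1)[OF G(2)[OF that(2)] G(2)[OF that(1)]]])
      finally show ?thesis
        unfolding sobolev_dist_transform[OF G(1)[OF that(2)] G(2)[OF that(2)] G(1)[OF that(1)] G(2)[OF that(1)]] .
    qed
    show ?thesis
      unfolding sup_norm_curve_def
    proof (intro ballI conjI allI impI)
      fix t assume t: "t \<in> {0..T}"
      show "\<exists>B. \<forall>x. \<bar>V t x\<bar> \<le> B"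
      proof (intro exI allI)
        fix x show "\<bar>V t x\<bar> \<le> C * weighted_norm M (2 * real m + 1) (G t)"
          using C(2)[OF G(2)[OF t], of x] unfolding V[OF t, symmetric] norm_of_real by simp
      qed
      fix e :: real assume e: "e > 0"
      have "((\<lambda>\<tau>. C * sobolev_dist M (2 * real m + 1) (u \<tau>) (u t)) \<longlongrightarrow> C * 0) (at t within {0..T})"
        by (rule tendsto_mult_left[OF uc[OF t]])
      then have "\<forall>\<^sub>F \<tau> in at t within {0..T}. C * sobolev_dist M (2 * real m + 1) (u \<tau>) (u t) < e"
        using e by (intro order_tendstoD(2)[where y = "C * 0"]) auto
      moreover have "\<forall>\<^sub>F \<tau> in at t within {0..T}. \<tau> \<in> {0..T}"
        unfolding eventually_at_filter by (rule always_eventually) auto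
      ultimately show "\<forall>\<^sub>F \<tau> in at t within {0..T}. \<forall>x. \<bar>V \<tau> x - V t x\<bar> < e"
        by eventually_elim (use lip[OF t] in \<open>blast intro: le_less_trans\<close>)
    qed
  qed
  show "sup_norm_curve T U"
    by (rule key[where a = "\<lambda>_. 1" and m = 0]) (use S0 in auto)
  show "sup_norm_curve T (\<lambda>t. D_x (U t))"
  proof (rule key[where a = "\<lambda>\<xi>. \<i> * of_real \<xi>" and m = 1, OF S1])
    show "cmod (\<i> * of_real \<xi>) \<le> (1 + \<xi>\<^sup>2) ^ 1" for \<xi> :: real
    proof -
      have "0 \<le> (\<bar>\<xi>\<bar> - 1)\<^sup>2 + \<xi>\<^sup>2 + 1" by simp
      then have "\<bar>\<xi>\<bar> \<le> 1 + \<xi>\<^sup>2" by (simp add: power2_diff)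
      then show ?thesis by (simp add: norm_mult)
    qed
  qed auto
qed

section \<open>Resonant test functions\<close>

text \<open>The test function is \<open>\<psi> - \<psi>''\<close>, and \<open>k\<close> is the function on the frequency side that
  represents the pairing with it. The last clause says that the low-frequency part of the
  square of a band wave, tested against \<open>\<psi>'\<close>, stays away from \<open>0\<close> as the frequency of the
  wave grows.\<close>

definition resonant_test ::
  "domain \<Rightarrow> (real \<Rightarrow> real) \<Rightarrow> (real \<Rightarrow> real) \<Rightarrow> (real \<Rightarrow> real) \<Rightarrow> real \<Rightarrow> (real \<Rightarrow> complex) \<Rightarrow> bool" where
  "resonant_test M \<psi> \<psi>1 \<psi>2 c k \<longleftrightarrow>
     flux_test M \<psi> \<psi>1 \<psi>2 \<and> c > 0 \<and> (\<lambda>x. of_real (\<psi> x - \<psi>2 x)) \<in> test_fun M \<and>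
     (\<forall>\<sigma>. weighted_L2 M \<sigma> k) \<and>
     (\<forall>u g. Defs.real_distribution M u \<and> has_transform M u g \<longrightarrow>
        u (\<lambda>x. of_real (\<psi> x - \<psi>2 x)) = (LINT \<xi>|freq_measure M. g \<xi> * k \<xi>)) \<and>
     (\<forall>N\<ge>1. \<forall>h. (\<forall>x. of_real (h x) = synth M (band_wave 1 N) x) \<longrightarrow>
        c \<le> (LINT x:fun_domain M|lborel. (h x)\<^sup>2 * \<psi>1 x))"

lemma cos_int_integral:
  "n \<noteq> (0::int) \<Longrightarrow> ((\<lambda>x. cos (of_int n * x)) has_integral 0) {0..2 * pi}"
proof -
  assume n: "n \<noteq> 0"
  have "((\<lambda>x. cos (of_int n * x)) has_integral sin (of_int n * (2 * pi)) / of_int n - sin (of_int n * 0) / of_int n) {0..2 * pi}"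
  proof (rule fundamental_theorem_of_calculus)
    fix x
    have "((\<lambda>x. sin (of_int n * x) / of_int n) has_real_derivative cos (of_int n * x)) (at x within {0..2 * pi})"
      using n by (auto intro!: derivative_eq_intros)
    then show "((\<lambda>x. sin (of_int n * x) / of_int n) has_vector_derivative cos (of_int n * x)) (at x within {0..2 * pi})"
      by (simp add: has_real_derivative_iff_has_vector_derivative)
  qed simp
  moreover have "sin (of_int n * (2 * pi)) = 0"
    using sin_int_2pin[of n] by (simp add: mult_ac)
  ultimately show ?thesis by simp
qed

text \<open>Here \<open>h x = 2 * cos (N * x) + 2 * cos ((N + 1) * x)\<close>, whose square contains
  \<open>4 * cos x\<close>.\<close>

lemma resonant_test_Torus:
  "\<exists>k. resonant_test Torus sin cos (\<lambda>x. - sin x) (4 * pi) k"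
proof -
  let ?\<nu> = "freq_measure Torus"
  let ?\<phi> = "\<lambda>x. complex_of_real (sin x - - sin x)"
  have \<phi>: "?\<phi> = (\<lambda>x. (- \<i>) * cis (of_int 1 * x) + \<i> * cis (of_int (- 1) * x))"
    by (auto simp: fun_eq_iff complex_eq_iff)
  define k where "k \<xi> = (if \<xi> = 1 then 2 * pi * \<i> else if \<xi> = - 1 then - 2 * pi * \<i> else 0)" for \<xi> :: real
  have km[measurable]: "k \<in> borel_measurable borel" unfolding k_def by measurable
  have finite_sum: "integrable ?\<nu> f \<and> (LINT \<xi>|?\<nu>. f \<xi>) = f 1 + f (- 1)"
    if [measurable]: "f \<in> borel_measurable borel" and z: "\<And>\<xi>. \<xi> \<noteq> 1 \<Longrightarrow> \<xi> \<noteq> - 1 \<Longrightarrow> f \<xi> = 0"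
    for f :: "real \<Rightarrow> 'a::{banach, second_countable_topology}"
  proof -
    let ?f = "\<lambda>j::int. f (of_int j)"
    have z': "?f j = 0" if "j \<notin> {1, - 1}" for j
    proof (rule z)
      show "real_of_int j \<noteq> 1" using that by auto
      show "real_of_int j \<noteq> - 1" using that of_int_eq_iff[of j "- 1", where 'a = real] by auto
    qed
    have "Infinite_Set_Sum.abs_summable_on ?f UNIV \<longleftrightarrow> Infinite_Set_Sum.abs_summable_on ?f {1, - 1}"
      by (rule abs_summable_on_cong_neutral) (use z' in auto)
    then have i: "integrable (count_space UNIV) ?f" by (simp add: Infinite_Set_Sum.abs_summable_on_def integrable_count_space)
    have fin: "finite {j \<in> UNIV. ?f j \<noteq> 0}"
      by (rule finite_subset[of _ "{1, - 1}"]) (use z' in auto)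
    have "(LINT \<xi>|?\<nu>. f \<xi>) = (LINT j|count_space UNIV. ?f j)" by (rule integral_freq_Torus) measurable
    also have "\<dots> = (\<Sum>j | j \<in> UNIV \<and> ?f j \<noteq> 0. ?f j)"
      by (rule lebesgue_integral_count_space_finite_support[OF fin])
    also have "\<dots> = (\<Sum>j\<in>{1, - 1}. ?f j)"
      by (rule sum.mono_neutral_left) (use z' in auto)
    finally show ?thesis using i by (simp add: integrable_freq_Torus del: freq_measure.simps)
  qed
  have "resonant_test Torus sin cos (\<lambda>x. - sin x) (4 * pi) k"
    unfolding resonant_test_def
  proof (intro conjI allI impI)
    have cs: "set_integrable lborel {0..2 * pi} (\<lambda>x. sin x - - sin x)" "set_integrable lborel {0..2 * pi} cos"
      by (rule borel_integrable_atLeastAtMost', intro continuous_intros)+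
    show "flux_test Torus sin cos (\<lambda>x. - sin x)"
      using cs by (auto simp: flux_test_def fun_domain_def intro!: derivative_eq_intros)
    show "0 < 4 * pi" by simp
    show "?\<phi> \<in> test_fun Torus"
      unfolding \<phi> by (intro test_fun_add cis_test_fun_Torus)
    show "weighted_L2 Torus \<sigma> k" for \<sigma>
      unfolding weighted_L2_def
      using finite_sum[of "\<lambda>\<xi>. (1 + \<xi>\<^sup>2) powr \<sigma> * (cmod (k \<xi>))\<^sup>2"] by (simp add: k_def del: freq_measure.simps)
  next
    fix u g assume ug: "Defs.real_distribution Torus u \<and> has_transform Torus u g"
    then have gm[measurable]: "g \<in> borel_measurable borel"
      and gk: "\<And>j. u (\<lambda>x. cis (- (of_int j * x))) = 2 * pi * g (of_int j)"
      by (auto simp: has_transform_def fourier_coeff_def)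
    have add: "u (\<lambda>x. \<phi> x + \<psi> x) = u \<phi> + u \<psi>" and sc: "u (\<lambda>x. c * \<phi> x) = c * u \<phi>"
      if "\<phi> \<in> test_fun Torus" "\<psi> \<in> test_fun Torus" for \<phi> \<psi> c
      using ug that unfolding Defs.real_distribution_def by blast+
    have t: "(\<lambda>x. cis (of_int j * x)) \<in> test_fun Torus" for j
      using cis_test_fun_Torus[of 1 j] by simp
    have "u ?\<phi> = (- \<i>) * u (\<lambda>x. cis (of_int 1 * x)) + \<i> * u (\<lambda>x. cis (of_int (- 1) * x))"
      unfolding \<phi> add[OF test_fun_scale[OF t] test_fun_scale[OF t]] sc[OF t t] ..
    also have "\<dots> = (- \<i>) * (2 * pi * g (- 1)) + \<i> * (2 * pi * g 1)"
      using gk[of 1] gk[of "- 1"] by simp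
    also have "\<dots> = (LINT \<xi>|?\<nu>. g \<xi> * k \<xi>)"
    proof -
      have m: "(\<lambda>\<xi>. g \<xi> * k \<xi>) \<in> borel_measurable borel" by measurable
      have z: "g \<xi> * k \<xi> = 0" if "\<xi> \<noteq> 1" "\<xi> \<noteq> - 1" for \<xi> using that by (simp add: k_def)
      have v: "k 1 = 2 * pi * \<i>" "k (- 1) = - (2 * pi * \<i>)" by (simp_all add: k_def)
      show ?thesis using finite_sum[OF m z] by (simp add: v mult_ac del: freq_measure.simps)
    qed
    finally show "u ?\<phi> = (LINT \<xi>|?\<nu>. g \<xi> * k \<xi>)" .
  next
    fix N :: nat and h :: "real \<Rightarrow> real"
    assume N: "1 \<le> N" and h: "\<forall>x. of_real (h x) = synth Torus (band_wave 1 N) x"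
    have hx: "h x = 2 * cos (real N * x) + 2 * cos ((real N + 1) * x)" for x
    proof -
      have "synth Torus (band_wave 1 N) x = (LINT \<xi>|?\<nu>. indicator (freq_band N) \<xi> *\<^sub>R cis (\<xi> * x))"
        unfolding synth_def synth_const_def spectral_def
        by (simp add: band_wave_def indicator_def mult.commute del: freq_measure.simps)
           (rule Bochner_Integration.integral_cong; simp)
      also have "\<dots> = cis (real N * x) + cis ((real N + 1) * x) + cis (- real N * x) + cis (- (real N + 1) * x)"
        by (rule torus_band_sum(2)[OF _ N]) measurable
      finally have "of_real (h x) = cis (real N * x) + cis ((real N + 1) * x) + cis (- real N * x) + cis (- (real N + 1) * x)"
        using h by simp
      from arg_cong[OF this, of Re]
      have "h x = cos (real N * x) + cos ((real N + 1) * x) + cos (- (real N * x)) + cos (- ((real N + 1) * x))"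
        by (simp only: Re_complex_of_real plus_complex.sel cis.sel mult_minus_left)
      then show ?thesis by (simp only: cos_minus)
    qed
    let ?c = "\<lambda>n x. cos (of_int n * x)"
    have expand: "(h x)\<^sup>2 * cos x = 2 + (4 * ?c 1 x + (2 * ?c 2 x + (?c (2 * int N - 1) x + (2 * ?c (2 * int N) x
        + (2 * ?c (2 * int N + 1) x + (2 * ?c (2 * int N + 2) x + ?c (2 * int N + 3) x))))))" for x
    proof -
      define a where "a = real N * x"
      have b: "(real N + 1) * x = a + x" by (simp add: a_def algebra_simps)
      have cc: "cos p * cos q = (cos (p - q) + cos (p + q)) / 2" for p q :: real by (rule cos_times_cos)
      have "(h x)\<^sup>2 = 4 * (cos a * cos a) + 8 * (cos a * cos (a + x)) + 4 * (cos (a + x) * cos (a + x))"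
        unfolding hx b a_def[symmetric] by (simp add: power2_eq_square algebra_simps)
      also have "\<dots> = 4 + 2 * cos (2 * a) + 4 * cos x + 4 * cos (2 * a + x) + 2 * cos (2 * a + 2 * x)"
        unfolding cc by (simp add: field_simps)
      finally have "(h x)\<^sup>2 * cos x = 4 * cos x + 2 * (cos (2 * a) * cos x) + 4 * (cos x * cos x)
          + 4 * (cos (2 * a + x) * cos x) + 2 * (cos (2 * a + 2 * x) * cos x)" by (simp add: algebra_simps)
      also have "\<dots> = 4 * cos x + (cos (2 * a - x) + cos (2 * a + x)) + (2 + 2 * cos (2 * x))
          + 2 * (cos (2 * a) + cos (2 * a + 2 * x)) + (cos (2 * a + x) + cos (2 * a + 3 * x))"
        unfolding cc by (simp add: field_simps)
      finally show ?thesis by (simp add: a_def algebra_simps)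
    qed
    have I: "((\<lambda>x. (h x)\<^sup>2 * cos x) has_integral 2 * (2 * pi) + (4 * 0 + (2 * 0 + (0 + (2 * 0 + (2 * 0 + (2 * 0 + 0))))))) {0..2 * pi}"
      unfolding expand using N has_integral_const_real[of "2::real" 0 "2 * pi"]
      by (intro has_integral_add has_integral_mult_right cos_int_integral) (auto simp: mult.commute)
    have "continuous_on {0..2 * pi} (\<lambda>x. (h x)\<^sup>2 * cos x)"
      unfolding hx by (intro continuous_intros)
    from set_borel_integral_eq_integral(2)[OF borel_integrable_atLeastAtMost'[OF this]]
    show "4 * pi \<le> (LINT x:fun_domain Torus|lborel. (h x)\<^sup>2 * cos x)"
      using integral_unique[OF I] by (simp add: fun_domain_def)
  qed
  then show ?thesis by blast
qed

lemma schwartz_weighted_L2: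
  assumes k: "k \<in> schwartz" shows "weighted_L2 Real_Line \<sigma> k"
proof -
  define m where "m = nat \<lceil>\<sigma>\<rceil>"
  have m: "\<sigma> \<le> real m" unfolding m_def by linarith
  have S: "(\<lambda>\<xi>. of_real ((1 + \<xi>\<^sup>2) ^ n) * k \<xi>) \<in> schwartz" for n
  proof (induction n)
    case (Suc n)
    let ?f = "\<lambda>\<xi>. of_real ((1 + \<xi>\<^sup>2) ^ n) * k \<xi>"
    have "(\<lambda>\<xi>. ?f \<xi> + of_real \<xi> * (of_real \<xi> * ?f \<xi>)) \<in> schwartz"
      by (intro schwartz_intros Suc)
    moreover have "(\<lambda>\<xi>. ?f \<xi> + of_real \<xi> * (of_real \<xi> * ?f \<xi>)) = (\<lambda>\<xi>. of_real ((1 + \<xi>\<^sup>2) ^ Suc n) * k \<xi>)"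
      by (auto simp: algebra_simps power2_eq_square)
    ultimately show ?case by metis
  qed (use k in simp)
  note [measurable] = schwartz_measurable[OF k]
  obtain C where C: "\<And>\<xi>. cmod (k \<xi>) \<le> C"
    using schwartz_derivative(3)[OF k] unfolding rapidly_decreasing_def by (metis mult_1 power_0)
  have C0: "0 \<le> C" using C[of 0] norm_ge_zero order_trans by blast
  have "integrable lborel (\<lambda>\<xi>. C * cmod (of_real ((1 + \<xi>\<^sup>2) ^ m) * k \<xi>))"
    by (intro integrable_mult_right integrable_norm schwartz_integrable S)
  then have "integrable lborel (\<lambda>\<xi>. (1 + \<xi>\<^sup>2) powr \<sigma> * (cmod (k \<xi>))\<^sup>2)"
  proof (rule Bochner_Integration.integrable_bound)
    show "AE \<xi> in lborel. norm ((1 + \<xi>\<^sup>2) powr \<sigma> * (cmod (k \<xi>))\<^sup>2) \<le> norm (C * cmod (of_real ((1 + \<xi>\<^sup>2) ^ m) * k \<xi>))"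
    proof (rule AE_I2)
      fix \<xi> :: real
      have "(1 + \<xi>\<^sup>2) powr \<sigma> \<le> (1 + \<xi>\<^sup>2) powr (real m)" by (rule powr_mono[OF m]) simp
      also have "\<dots> = (1 + \<xi>\<^sup>2) ^ m" by (rule powr_realpow) simp
      finally have "(1 + \<xi>\<^sup>2) powr \<sigma> * (cmod (k \<xi>) * cmod (k \<xi>)) \<le> (1 + \<xi>\<^sup>2) ^ m * (C * cmod (k \<xi>))"
        using C[of \<xi>] C0 by (intro mult_mono mult_right_mono) auto
      moreover have "cmod (of_real ((1 + \<xi>\<^sup>2) ^ m) * k \<xi>) = (1 + \<xi>\<^sup>2) ^ m * cmod (k \<xi>)"
        unfolding norm_mult norm_of_real by simp
      ultimately show "norm ((1 + \<xi>\<^sup>2) powr \<sigma> * (cmod (k \<xi>))\<^sup>2) \<le> norm (C * cmod (of_real ((1 + \<xi>\<^sup>2) ^ m) * k \<xi>))"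
        using C0 by (simp add: power2_eq_square abs_mult mult_ac)
    qed
  qed measurable
  then show ?thesis by (simp add: weighted_L2_def)
qed

text \<open>The inverse transform of the test derivative \<open>(1 - x\<^sup>2) * exp (- (x\<^sup>2 / 2))\<close> on the
  line.\<close>

definition hermite_freq :: "real \<Rightarrow> real" where
  "hermite_freq \<xi> = \<xi>\<^sup>2 * exp (- (\<xi>\<^sup>2 / 2)) / sqrt (2 * pi)"

text \<open>Repeated differentiation of a Gaussian. Up to sign, the three transforms are the
  test functions \<open>\<psi>\<close>, \<open>\<psi>'\<close> and \<open>\<psi>''\<close> on the line.\<close>

lemma hermite_triple:
  defines "\<gamma> \<equiv> \<lambda>\<xi>. of_real (1 / sqrt (2 * pi)) * complex_of_real (exp (- (\<xi>\<^sup>2 / 2)))"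
  defines "\<gamma>1 \<equiv> \<lambda>\<xi>. (- \<i>) * (of_real \<xi> * \<gamma> \<xi>)"
  defines "\<gamma>2 \<equiv> \<lambda>\<xi>. (- \<i>) * (of_real \<xi> * \<gamma>1 \<xi>)"
  defines "\<gamma>3 \<equiv> \<lambda>\<xi>. (- \<i>) * (of_real \<xi> * \<gamma>2 \<xi>)"
  shows "\<gamma>1 \<in> schwartz" "\<gamma>2 \<in> schwartz" "\<gamma>3 \<in> schwartz"
    and "fourier \<gamma>1 x = - of_real (x * exp (- (x\<^sup>2 / 2)))"
    and "fourier \<gamma>2 x = - of_real ((1 - x\<^sup>2) * exp (- (x\<^sup>2 / 2)))"
    and "fourier \<gamma>3 x = - of_real ((x ^ 3 - 3 * x) * exp (- (x\<^sup>2 / 2)))"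
    and "\<gamma>2 \<xi> = - of_real (hermite_freq \<xi>)"
proof -
  have G: "(\<lambda>x. complex_of_real (exp (- (x\<^sup>2 / 2)))) \<in> schwartz"
    using schwartz_gaussian[of "1/2" 0] by simp
  have \<gamma>: "\<gamma> \<in> schwartz" unfolding \<gamma>_def by (rule schwartz_intros(2)[OF G])
  show g1: "\<gamma>1 \<in> schwartz" unfolding \<gamma>1_def by (intro schwartz_intros \<gamma>)
  show g2: "\<gamma>2 \<in> schwartz" unfolding \<gamma>2_def by (intro schwartz_intros g1)
  show g3: "\<gamma>3 \<in> schwartz" unfolding \<gamma>3_def by (intro schwartz_intros g2)
  have F0: "fourier \<gamma> = (\<lambda>x. of_real (exp (- (x\<^sup>2 / 2))))"
  proof
    fix x
    have "fourier \<gamma> x = of_real (1 / sqrt (2 * pi)) * fourier (\<lambda>\<xi>. complex_of_real (exp (- (\<xi>\<^sup>2 / 2)))) x"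
      unfolding fourier_def \<gamma>_def integral_mult_right_zero[symmetric] by (simp add: mult_ac)
    also have "\<dots> = of_real (1 / sqrt (2 * pi) * (sqrt (2 * pi) * exp (- (x\<^sup>2 / 2))))"
      unfolding fourier_gaussian of_real_mult ..
    also have "1 / sqrt (2 * pi) * (sqrt (2 * pi) * exp (- (x\<^sup>2 / 2))) = exp (- (x\<^sup>2 / 2))" by simp
    finally show "fourier \<gamma> x = of_real (exp (- (x\<^sup>2 / 2)))" .
  qed
  have step: "fourier (\<lambda>\<xi>. (- \<i>) * (of_real \<xi> * \<phi> \<xi>)) x = of_real (f' x)"
    if "\<phi> \<in> schwartz" "fourier \<phi> = (\<lambda>x. of_real (f x))" "\<And>x. (f has_real_derivative f' x) (at x)" for \<phi> f f' x
  proof -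
    have "((\<lambda>x. complex_of_real (f x)) has_vector_derivative fourier (\<lambda>\<xi>. (- \<i>) * (of_real \<xi> * \<phi> \<xi>)) x) (at x)"
      using fourier_has_vector_derivative[OF that(1), of x] unfolding that(2) .
    moreover have "((\<lambda>x. complex_of_real (f x)) has_vector_derivative of_real (f' x)) (at x)"
      using that(3)[of x] by (simp add: has_vector_derivative_complex_iff)
    ultimately show ?thesis by (rule vector_derivative_unique_at)
  qed
  have F1: "fourier \<gamma>1 x = of_real (- (x * exp (- (x\<^sup>2 / 2))))" for x
    unfolding \<gamma>1_def
    by (rule step[OF \<gamma> F0, where f' = "\<lambda>x. - (x * exp (- (x\<^sup>2 / 2)))"])
       (auto intro!: derivative_eq_intros)
  then have F1': "fourier \<gamma>1 = (\<lambda>x. of_real (- (x * exp (- (x\<^sup>2 / 2)))))" by auto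
  have F2: "fourier \<gamma>2 x = of_real (- ((1 - x\<^sup>2) * exp (- (x\<^sup>2 / 2))))" for x
    unfolding \<gamma>2_def
    by (rule step[OF g1 F1', where f' = "\<lambda>x. - ((1 - x\<^sup>2) * exp (- (x\<^sup>2 / 2)))"])
       (auto intro!: derivative_eq_intros simp: algebra_simps power2_eq_square)
  then have F2': "fourier \<gamma>2 = (\<lambda>x. of_real (- ((1 - x\<^sup>2) * exp (- (x\<^sup>2 / 2)))))" by auto
  have F3: "fourier \<gamma>3 x = of_real (- ((x ^ 3 - 3 * x) * exp (- (x\<^sup>2 / 2))))" for x
    unfolding \<gamma>3_def
    by (rule step[OF g2 F2', where f' = "\<lambda>x. - ((x ^ 3 - 3 * x) * exp (- (x\<^sup>2 / 2)))"])
       (auto intro!: derivative_eq_intros simp: algebra_simps power2_eq_square power3_eq_cube)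
  show "fourier \<gamma>1 x = - of_real (x * exp (- (x\<^sup>2 / 2)))" unfolding F1 by simp
  show "fourier \<gamma>2 x = - of_real ((1 - x\<^sup>2) * exp (- (x\<^sup>2 / 2)))" unfolding F2 by simp
  show "fourier \<gamma>3 x = - of_real ((x ^ 3 - 3 * x) * exp (- (x\<^sup>2 / 2)))" unfolding F3 by simp
  show "\<gamma>2 \<xi> = - of_real (hermite_freq \<xi>)"
    unfolding \<gamma>2_def \<gamma>1_def \<gamma>_def hermite_freq_def
    by (simp add: power2_eq_square mult_ac)
qed

text \<open>The average of \<open>(\<xi> + \<eta>)\<^sup>2\<close> is least for \<open>\<xi>\<close> in the middle of the interval, where it
  is \<open>1 / 12\<close>.\<close>

lemma square_average_unit_interval:
  fixes a \<xi> :: real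
  assumes "\<xi> \<in> {a..a + 1}"
  shows "((\<lambda>\<eta>. (\<xi> + \<eta>)\<^sup>2) has_integral ((\<xi> - a) ^ 3 - (\<xi> - a - 1) ^ 3) / 3) {- (a + 1)..- a}"
    and "1 / 12 \<le> ((\<xi> - a) ^ 3 - (\<xi> - a - 1) ^ 3) / 3"
proof -
  have "((\<lambda>\<eta>. (\<xi> + \<eta>)\<^sup>2) has_integral (\<xi> + (- a)) ^ 3 / 3 - (\<xi> + (- (a + 1))) ^ 3 / 3) {- (a + 1)..- a}"
  proof (rule fundamental_theorem_of_calculus)
    fix \<eta>
    have "((\<lambda>\<eta>. (\<xi> + \<eta>) ^ 3 / 3) has_real_derivative (\<xi> + \<eta>)\<^sup>2) (at \<eta> within {- (a + 1)..- a})"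
      by (auto intro!: derivative_eq_intros)
    then show "((\<lambda>\<eta>. (\<xi> + \<eta>) ^ 3 / 3) has_vector_derivative (\<xi> + \<eta>)\<^sup>2) (at \<eta> within {- (a + 1)..- a})"
      by (simp add: has_real_derivative_iff_has_vector_derivative)
  qed simp
  then show "((\<lambda>\<eta>. (\<xi> + \<eta>)\<^sup>2) has_integral ((\<xi> - a) ^ 3 - (\<xi> - a - 1) ^ 3) / 3) {- (a + 1)..- a}"
    by (simp add: diff_divide_distrib algebra_simps)
  define b where "b = \<xi> - a"
  have "b ^ 3 - (b - 1) ^ 3 - 1 / 4 = 3 * (b - 1 / 2)\<^sup>2"
    by (simp add: power3_eq_cube power2_eq_square field_simps)
  then have "1 / 4 \<le> b ^ 3 - (b - 1) ^ 3"
    using zero_le_power2[of "b - 1 / 2"] by (metis diff_ge_0_iff_ge mult_nonneg_nonneg zero_le_numeral)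
  then show "1 / 12 \<le> ((\<xi> - a) ^ 3 - (\<xi> - a - 1) ^ 3) / 3" unfolding b_def by (simp add: field_simps)
qed

text \<open>Only the negative half of the band is kept: there \<open>\<bar>\<xi> + \<eta>\<bar> \<le> 1\<close>, so the Gaussian
  factor is at least \<open>exp (- 1 / 2)\<close>.\<close>

lemma band_autocorrelation_lower:
  assumes N: "N \<ge> 1" and \<xi>: "\<xi> \<in> {real N..real N + 1}"
  shows "exp (- 1 / 2) / (12 * sqrt (2 * pi)) \<le> (LINT \<eta>|lborel. indicator (freq_band N) \<eta> * hermite_freq (\<xi> + \<eta>))"
proof -
  let ?I = "{- (real N + 1)..- real N}"
  let ?c = "exp (- 1 / 2) / sqrt (2 * pi)"
  have cq: "continuous_on ?I (\<lambda>\<eta>. (\<xi> + \<eta>)\<^sup>2)" by (intro continuous_intros)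
  have si: "set_integrable lborel ?I (\<lambda>\<eta>. (\<xi> + \<eta>)\<^sup>2)" by (rule borel_integrable_atLeastAtMost'[OF cq])
  have "1 / 12 \<le> (LINT \<eta>:?I|lborel. (\<xi> + \<eta>)\<^sup>2)"
    using square_average_unit_interval[OF \<xi>] set_borel_integral_eq_integral(2)[OF si]
    by (simp add: integral_unique)
  then have "?c * (1 / 12) \<le> ?c * (LINT \<eta>:?I|lborel. (\<xi> + \<eta>)\<^sup>2)" by (rule mult_left_mono) simp
  also have "\<dots> = (LINT \<eta>|lborel. ?c * (indicator ?I \<eta> *\<^sub>R (\<xi> + \<eta>)\<^sup>2))"
    unfolding set_lebesgue_integral_def by (rule integral_mult_right_zero[symmetric])
  also have "\<dots> \<le> (LINT \<eta>|lborel. indicator (freq_band N) \<eta> * hermite_freq (\<xi> + \<eta>))"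
  proof (rule integral_mono)
    show "integrable lborel (\<lambda>\<eta>. ?c * (indicator ?I \<eta> *\<^sub>R (\<xi> + \<eta>)\<^sup>2))"
      by (rule integrable_mult_right) (use si in \<open>simp add: set_integrable_def\<close>)
    have "continuous_on {- (real N + 1)..real N + 1} (\<lambda>\<eta>. hermite_freq (\<xi> + \<eta>))"
      unfolding hermite_freq_def by (intro continuous_intros) auto
    from borel_integrable_atLeastAtMost'[OF this]
    have i: "integrable lborel (\<lambda>\<eta>. indicator {- (real N + 1)..real N + 1} \<eta> *\<^sub>R hermite_freq (\<xi> + \<eta>))"
      by (simp add: set_integrable_def)
    have [measurable]: "hermite_freq \<in> borel_measurable borel" unfolding hermite_freq_def[abs_def] by measurable
    show "integrable lborel (\<lambda>\<eta>. indicator (freq_band N) \<eta> * hermite_freq (\<xi> + \<eta>))"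
      by (rule Bochner_Integration.integrable_bound[OF i]) (auto simp: indicator_def freq_band_def)
    fix \<eta>
    show "?c * (indicator ?I \<eta> *\<^sub>R (\<xi> + \<eta>)\<^sup>2) \<le> indicator (freq_band N) \<eta> * hermite_freq (\<xi> + \<eta>)"
    proof (cases "\<eta> \<in> ?I")
      case True
      have "\<bar>\<xi> + \<eta>\<bar> \<le> 1" using True \<xi> by (auto simp: abs_le_iff)
      then have "(\<xi> + \<eta>)\<^sup>2 \<le> 1" by (simp add: abs_square_le_1)
      then have "exp (- 1 / 2) \<le> exp (- ((\<xi> + \<eta>)\<^sup>2 / 2))" by simp
      then have "(\<xi> + \<eta>)\<^sup>2 * exp (- 1 / 2) / sqrt (2 * pi) \<le> hermite_freq (\<xi> + \<eta>)"
        unfolding hermite_freq_def by (intro divide_right_mono mult_left_mono) auto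
      moreover have "\<eta> \<in> freq_band N" using True by (auto simp: freq_band_def)
      ultimately show ?thesis using True by (simp add: mult_ac)
    next
      case False
      then show ?thesis by (auto simp: hermite_freq_def indicator_def)
    qed
  qed
  finally show ?thesis by simp
qed

text \<open>Two applications of Fubini turn the integral of \<open>h\<^sup>2 \<psi>'\<close> into the double integral of
  \<open>hermite_freq (\<xi> + \<eta>)\<close> over pairs of frequencies in the band. The integrand is
  nonnegative, so the oscillating part of \<open>h\<^sup>2\<close> cannot cancel its mean part.\<close>

lemma resonant_test_Real_Line:
  "\<exists>k. resonant_test Real_Line (\<lambda>x. x * exp (- (x\<^sup>2 / 2))) (\<lambda>x. (1 - x\<^sup>2) * exp (- (x\<^sup>2 / 2)))
     (\<lambda>x. (x ^ 3 - 3 * x) * exp (- (x\<^sup>2 / 2))) (exp (- 1 / 2) / (12 * sqrt (2 * pi)) / (2 * pi)) k"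
proof -
  let ?\<psi> = "\<lambda>x::real. x * exp (- (x\<^sup>2 / 2))"
  let ?\<psi>1 = "\<lambda>x::real. (1 - x\<^sup>2) * exp (- (x\<^sup>2 / 2))"
  let ?\<psi>2 = "\<lambda>x::real. (x ^ 3 - 3 * x) * exp (- (x\<^sup>2 / 2))"
  let ?c = "exp (- 1 / 2) / (12 * sqrt (2 * pi))"
  obtain \<gamma>1 \<gamma>2 \<gamma>3 where S: "\<gamma>1 \<in> schwartz" "\<gamma>2 \<in> schwartz" "\<gamma>3 \<in> schwartz"
    and F1: "\<And>x. fourier \<gamma>1 x = - of_real (?\<psi> x)"
    and F2: "\<And>x. fourier \<gamma>2 x = - of_real (?\<psi>1 x)"
    and F3: "\<And>x. fourier \<gamma>3 x = - of_real (?\<psi>2 x)"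
    and \<gamma>2: "\<And>\<xi>. \<gamma>2 \<xi> = - of_real (hermite_freq \<xi>)"
    using hermite_triple by blast
  define k where "k \<xi> = (- 1) * \<gamma>1 \<xi> + \<gamma>3 \<xi>" for \<xi>
  have k: "k \<in> schwartz" unfolding k_def[abs_def] by (intro schwartz_intros S)
  have Fk: "fourier k x = of_real (?\<psi> x - ?\<psi>2 x)" for x
  proof -
    have i: "integrable lborel (\<lambda>\<xi>. cis (- (x * \<xi>)) * \<gamma> \<xi>)" if "\<gamma> \<in> schwartz" for \<gamma>
      using spectral_integrable[OF schwartz_integrable[OF that], of "- x"] by (simp add: mult.commute)
    have "fourier k x = (LINT \<xi>|lborel. (- 1) * (cis (- (x * \<xi>)) * \<gamma>1 \<xi>) + cis (- (x * \<xi>)) * \<gamma>3 \<xi>)"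
      unfolding fourier_def k_def by (simp add: algebra_simps)
    also have "\<dots> = (- 1) * fourier \<gamma>1 x + fourier \<gamma>3 x"
      unfolding fourier_def
      by (subst Bochner_Integration.integral_add) (auto intro!: i S integrable_minus)
    finally show ?thesis unfolding F1 F3 by simp
  qed
  have S1: "(\<lambda>x. complex_of_real (?\<psi> x)) \<in> schwartz" and S2: "(\<lambda>x. complex_of_real (?\<psi>1 x)) \<in> schwartz"
  proof -
    have "(\<lambda>x. (- 1) * fourier \<gamma>1 x) \<in> schwartz" "(\<lambda>x. (- 1) * fourier \<gamma>2 x) \<in> schwartz"
      by (intro schwartz_intros(2) fourier_schwartz S)+
    then show "(\<lambda>x. complex_of_real (?\<psi> x)) \<in> schwartz" "(\<lambda>x. complex_of_real (?\<psi>1 x)) \<in> schwartz"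
      unfolding F1 F2 by simp_all
  qed
  have lim: "(f \<longlongrightarrow> 0) F" if "(\<lambda>x. complex_of_real (f x)) \<in> schwartz" "F \<in> {at_top, at_bot}" for f :: "real \<Rightarrow> real" and F
  proof -
    have "((\<lambda>x. complex_of_real (f x)) \<longlongrightarrow> of_real 0) F"
      using schwartz_tendsto_zero[OF that(1)] that(2) by auto
    then show ?thesis unfolding tendsto_of_real_iff .
  qed
  have int: "integrable lborel f" if "(\<lambda>x. complex_of_real (f x)) \<in> schwartz" for f :: "real \<Rightarrow> real"
    using integrable_bounded_linear[OF bounded_linear_Re schwartz_integrable[OF that]] by simp
  have T: "(\<lambda>x. complex_of_real (?\<psi> x - ?\<psi>2 x)) \<in> schwartz"
    using fourier_schwartz[OF k] unfolding Fk[abs_def, symmetric] by (simp add: Fk[abs_def])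
  have "resonant_test Real_Line ?\<psi> ?\<psi>1 ?\<psi>2 (?c / (2 * pi)) k"
    unfolding resonant_test_def
  proof (intro conjI allI impI)
    show "flux_test Real_Line ?\<psi> ?\<psi>1 ?\<psi>2"
      unfolding flux_test_def domain.case
    proof (intro conjI allI ballI)
      show "(?\<psi> has_real_derivative ?\<psi>1 x) (at x)" for x
        by (auto intro!: derivative_eq_intros simp: algebra_simps power2_eq_square)
      show "(?\<psi>1 has_real_derivative ?\<psi>2 x) (at x)" for x
        by (auto intro!: derivative_eq_intros simp: algebra_simps power2_eq_square power3_eq_cube)
      show "set_integrable lborel (fun_domain Real_Line) (\<lambda>x. ?\<psi> x - ?\<psi>2 x)"
        using int[OF T] by (simp add: fun_domain_def set_integrable_def)
      show "set_integrable lborel (fun_domain Real_Line) ?\<psi>1"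
        using int[OF S2] by (simp add: fun_domain_def set_integrable_def)
    qed (use lim S1 S2 in auto)
    show "0 < ?c / (2 * pi)" by simp
    show "(\<lambda>x. complex_of_real (?\<psi> x - ?\<psi>2 x)) \<in> schwartz" by (rule T)
    show "weighted_L2 Real_Line \<sigma> k" for \<sigma> by (rule schwartz_weighted_L2[OF k])
  next
    fix u g assume "Defs.real_distribution Real_Line u \<and> has_transform Real_Line u g"
    then have "has_fourier u g" by (simp add: has_transform_def)
    then have "u (fourier k) = (LINT \<xi>|lborel. g \<xi> * k \<xi>)"
      using k unfolding has_fourier_def by blast
    then show "u (\<lambda>x. of_real (?\<psi> x - ?\<psi>2 x)) = (LINT \<xi>|freq_measure Real_Line. g \<xi> * k \<xi>)"
      unfolding Fk[abs_def] by simp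
  next
    fix N :: nat and h :: "real \<Rightarrow> real"
    assume N: "1 \<le> N" and h: "\<forall>x. of_real (h x) = synth Real_Line (band_wave 1 N) x"
    let ?g = "band_wave 1 N"
    define S where "S = spectral lborel ?g"
    have hS: "of_real (h x) = of_real (1 / (2 * pi)) * S x" for x
      using h by (simp add: synth_def synth_const_def S_def)
    have gi: "integrable lborel ?g"
      using weighted_L2_integrable[OF band_wave_weighted_L2[OF N, of Real_Line 1 1]] by simp
    have Sc: "continuous_on UNIV S" unfolding S_def by (rule spectral_continuous[OF _ gi]) simp
    have [measurable]: "S \<in> borel_measurable borel" by (rule borel_measurable_continuous_onI[OF Sc])
    obtain B where B: "\<And>x. cmod (S x) \<le> B" unfolding S_def using spectral_bound by blast
    let ?p = "\<lambda>x. complex_of_real (?\<psi>1 x)"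
    have p2: "spectral lborel ?p \<zeta> = of_real (2 * pi * hermite_freq \<zeta>)" for \<zeta>
    proof -
      have e: "?p = (\<lambda>x. (- 1) * fourier \<gamma>2 x)" unfolding F2 by simp
      have "spectral lborel ?p \<zeta> = (- 1) * spectral lborel (fourier \<gamma>2) \<zeta>"
        unfolding e spectral_def by simp
      also have "\<dots> = (- 1) * (2 * pi * \<gamma>2 \<zeta>)" unfolding fourier_inversion[OF S(2)] ..
      finally show ?thesis unfolding \<gamma>2 by simp
    qed
    have pi': "integrable lborel ?p" by (rule schwartz_integrable[OF S2])
    have Spi: "integrable lborel (\<lambda>x. S x * ?p x)"
    proof -
      have "set_integrable lborel UNIV (\<lambda>x. S x * ?p x)"
        by (rule set_integrable_bounded_times[where B = B])
           (use pi' B schwartz_measurable[OF S2] in \<open>auto simp: set_integrable_def\<close>)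
      then show ?thesis by (simp add: set_integrable_def)
    qed
    define J where "J \<xi> = (LINT \<eta>|lborel. indicator (freq_band N) \<eta> * hermite_freq (\<xi> + \<eta>))" for \<xi>
    have JS: "spectral lborel (\<lambda>x. S x * ?p x) \<xi> = of_real (2 * pi * J \<xi>)" for \<xi>
    proof -
      have ci: "integrable lborel (\<lambda>x. cis (x * \<xi>) * ?p x)" by (rule spectral_integrable[OF pi']) simp
      have shift: "spectral lborel (\<lambda>x. cis (x * \<xi>) * ?p x) \<eta> = of_real (2 * pi * hermite_freq (\<xi> + \<eta>))" for \<eta>
      proof -
        have "spectral lborel (\<lambda>x. cis (x * \<xi>) * ?p x) \<eta> = spectral lborel ?p (\<xi> + \<eta>)"
          unfolding spectral_def
        proof (rule Bochner_Integration.integral_cong)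
          fix x
          have "cis (x * \<eta>) * (cis (x * \<xi>) * ?p x) = (cis (x * \<eta>) * cis (x * \<xi>)) * ?p x"
            by (rule mult.assoc[symmetric])
          also have "cis (x * \<eta>) * cis (x * \<xi>) = cis (x * (\<xi> + \<eta>))"
            by (simp add: cis_mult distrib_left add.commute)
          finally show "cis (x * \<eta>) * (cis (x * \<xi>) * ?p x) = cis (x * (\<xi> + \<eta>)) * ?p x" .
        qed simp
        then show ?thesis unfolding p2 .
      qed
      have "spectral lborel (\<lambda>x. S x * ?p x) \<xi> = (LINT x|lborel. spectral lborel ?g x * (cis (x * \<xi>) * ?p x))"
        unfolding spectral_def[of _ _ \<xi>] S_def by (simp only: mult.left_commute)
      also have "\<dots> = (LINT \<eta>|lborel. ?g \<eta> * spectral lborel (\<lambda>x. cis (x * \<xi>) * ?p x) \<eta>)"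
        by (rule spectral_Fubini[OF sets_lborel lborel.sigma_finite_measure_axioms gi ci])
      also have "\<dots> = (LINT \<eta>|lborel. ?g \<eta> * of_real (2 * pi * hermite_freq (\<xi> + \<eta>)))"
        unfolding shift ..
      also have "(LINT \<eta>|lborel. ?g \<eta> * of_real (2 * pi * hermite_freq (\<xi> + \<eta>))) =
          (LINT \<eta>|lborel. complex_of_real (2 * pi * (indicator (freq_band N) \<eta> * hermite_freq (\<xi> + \<eta>))))"
        by (rule Bochner_Integration.integral_cong) (auto simp: band_wave_def mult_ac)
      also have "\<dots> = of_real (2 * pi * J \<xi>)" unfolding J_def integral_complex_of_real integral_mult_right_zero ..
      finally show ?thesis .
    qed
    have J0: "0 \<le> J \<xi>" for \<xi> unfolding J_def by (auto simp: hermite_freq_def intro!: integral_nonneg_AE)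
    have JC: "continuous_on UNIV (\<lambda>\<xi>. spectral lborel (\<lambda>x. S x * ?p x) \<xi>)"
      by (rule spectral_continuous[OF _ Spi]) simp
    have Jc: "continuous_on UNIV J"
    proof -
      have "continuous_on UNIV (\<lambda>\<xi>. Re (spectral lborel (\<lambda>x. S x * ?p x) \<xi>) / (2 * pi))"
        by (intro continuous_intros JC) auto
      then show ?thesis unfolding JS by simp
    qed
    have Ji: "integrable lborel (\<lambda>\<xi>. indicator (freq_band N) \<xi> * J \<xi>)"
    proof -
      have [measurable]: "J \<in> borel_measurable borel" by (rule borel_measurable_continuous_onI[OF Jc])
      have "set_integrable lborel {- (real N + 1)..real N + 1} J"
        by (rule borel_integrable_atLeastAtMost'[OF continuous_on_subset[OF Jc]]) simp
      then have "integrable lborel (\<lambda>\<xi>. indicator {- (real N + 1)..real N + 1} \<xi> *\<^sub>R J \<xi>)"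
        by (simp add: set_integrable_def)
      then show ?thesis
        by (rule Bochner_Integration.integrable_bound) (auto simp: indicator_def freq_band_def)
    qed
    have "complex_of_real (LINT x|lborel. (h x)\<^sup>2 * ?\<psi>1 x) = (LINT x|lborel. of_real ((h x)\<^sup>2 * ?\<psi>1 x))"
      by (rule integral_complex_of_real[symmetric])
    also have "\<dots> = (LINT x|lborel. (of_real (1 / (2 * pi)) * of_real (1 / (2 * pi))) * (spectral lborel ?g x * (S x * ?p x)))"
    proof (rule Bochner_Integration.integral_cong)
      fix x
      have "complex_of_real ((h x)\<^sup>2 * ?\<psi>1 x) = of_real (h x) * of_real (h x) * ?p x"
        by (simp add: power2_eq_square)
      then show "complex_of_real ((h x)\<^sup>2 * ?\<psi>1 x) =
          (of_real (1 / (2 * pi)) * of_real (1 / (2 * pi))) * (spectral lborel ?g x * (S x * ?p x))"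
        unfolding hS S_def[symmetric] by (simp only: mult_ac)
    qed simp
    also have "\<dots> = (of_real (1 / (2 * pi)) * of_real (1 / (2 * pi))) * (LINT \<xi>|lborel. ?g \<xi> * spectral lborel (\<lambda>x. S x * ?p x) \<xi>)"
      unfolding integral_mult_right_zero
      unfolding spectral_Fubini[OF sets_lborel lborel.sigma_finite_measure_axioms gi Spi] ..
    also have "(LINT \<xi>|lborel. ?g \<xi> * spectral lborel (\<lambda>x. S x * ?p x) \<xi>) =
        (LINT \<xi>|lborel. complex_of_real (2 * pi * (indicator (freq_band N) \<xi> * J \<xi>)))"
      unfolding JS by (rule Bochner_Integration.integral_cong) (auto simp: band_wave_def mult_ac)
    also have "\<dots> = of_real (2 * pi * (LINT \<xi>|lborel. indicator (freq_band N) \<xi> * J \<xi>))"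
      unfolding integral_complex_of_real integral_mult_right_zero ..
    finally have "(LINT x|lborel. (h x)\<^sup>2 * ?\<psi>1 x) =
        1 / (2 * pi) * (1 / (2 * pi)) * (2 * pi * (LINT \<xi>|lborel. indicator (freq_band N) \<xi> * J \<xi>))"
      unfolding of_real_mult[symmetric] of_real_eq_iff .
    also have "\<dots> = (LINT \<xi>|lborel. indicator (freq_band N) \<xi> * J \<xi>) / (2 * pi)" by simp
    finally have main: "(LINT x|lborel. (h x)\<^sup>2 * ?\<psi>1 x) = (LINT \<xi>|lborel. indicator (freq_band N) \<xi> * J \<xi>) / (2 * pi)" .
    have "?c = (LINT \<xi>|lborel. ?c * indicator {real N..real N + 1} \<xi>)" by simp
    also have "\<dots> \<le> (LINT \<xi>|lborel. indicator (freq_band N) \<xi> * J \<xi>)"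
    proof (rule integral_mono[OF _ Ji])
      show "integrable lborel (\<lambda>\<xi>. ?c * indicator {real N..real N + 1} \<xi>)"
        by (rule integrable_mult_right[OF integrable_indicator_band])
      fix \<xi>
      show "?c * indicator {real N..real N + 1} \<xi> \<le> indicator (freq_band N) \<xi> * J \<xi>"
      proof (cases "\<xi> \<in> {real N..real N + 1}")
        case True
        then show ?thesis using band_autocorrelation_lower[OF N True] by (simp add: J_def freq_band_def)
      next
        case False
        then have "indicator {real N..real N + 1} \<xi> = (0 :: real)" by simp
        then show ?thesis using J0[of \<xi>] by simp
      qed
    qed
    finally have "?c / (2 * pi) \<le> (LINT \<xi>|lborel. indicator (freq_band N) \<xi> * J \<xi>) / (2 * pi)"
      by (rule divide_right_mono) simp
    then show "?c / (2 * pi) \<le> (LINT x:fun_domain Real_Line|lborel. (h x)\<^sup>2 * ?\<psi>1 x)"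
      unfolding main[symmetric] by (simp add: fun_domain_def set_lebesgue_integral_def)
  qed
  then show ?thesis by blast
qed

section \<open>Discontinuity of the solution map\<close>

lemma sobolev_dist_commute:
  assumes "u \<in> sobolev M s" "v \<in> sobolev M s"
  shows "sobolev_dist M s u v = sobolev_dist M s v u"
proof -
  obtain g h where g: "has_transform M u g" "weighted_L2 M s g" and h: "has_transform M v h" "weighted_L2 M s h"
    using assms by (auto simp: sobolev_iff_transform)
  show ?thesis
    unfolding sobolev_dist_transform[OF g h] sobolev_dist_transform[OF h g] weighted_norm_def
    by (simp add: norm_minus_commute)
qed

lemma sobolev_dist_nonneg: "u \<in> sobolev M s \<Longrightarrow> v \<in> sobolev M s \<Longrightarrow> 0 \<le> sobolev_dist M s u v"
  by (auto simp: sobolev_iff_transform sobolev_dist_transform)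

lemma sobolev_quasi_triangle:
  assumes "u \<in> sobolev M s" "v \<in> sobolev M s" "w \<in> sobolev M s"
  shows "sobolev_dist M s u w \<le> 2 * (sobolev_dist M s u v + sobolev_dist M s v w)"
proof -
  obtain g h k where g: "has_transform M u g" "weighted_L2 M s g" and h: "has_transform M v h" "weighted_L2 M s h"
    and k: "has_transform M w k" "weighted_L2 M s k"
    using assms by (auto simp: sobolev_iff_transform)
  have "sobolev_dist M s u w = weighted_norm M s (\<lambda>\<xi>. (g \<xi> - h \<xi>) - (k \<xi> - h \<xi>))"
    unfolding sobolev_dist_transform[OF g k] by simp
  also have "\<dots> \<le> 2 * (weighted_norm M s (\<lambda>\<xi>. g \<xi> - h \<xi>) + weighted_norm M s (\<lambda>\<xi>. k \<xi> - h \<xi>))"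
    by (rule weighted_L2_diff(2)[OF weighted_L2_diff(1)[OF g(2) h(2)] weighted_L2_diff(1)[OF k(2) h(2)]])
  finally show ?thesis
    unfolding sobolev_dist_transform[OF g h, symmetric] sobolev_dist_transform[OF k h, symmetric]
    using sobolev_dist_commute[OF assms(3) assms(2)] by simp
qed

text \<open>The distance is locally bounded in time, hence bounded on the compact interval, so
  that its supremum is an upper bound.\<close>

lemma curve_dist_upper:
  assumes u: "u \<in> sobolev_curves M s T" and v: "v \<in> sobolev_curves M s T" and t: "t \<in> {0..T}"
  shows "sobolev_dist M s (u t) (v t) \<le> curve_dist M s T u v"
proof -
  have us: "u t \<in> sobolev M s" and vs: "v t \<in> sobolev M s"
    and uc: "((\<lambda>\<tau>. sobolev_dist M s (u \<tau>) (u t)) \<longlongrightarrow> 0) (at t within {0..T})"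
    and vc: "((\<lambda>\<tau>. sobolev_dist M s (v \<tau>) (v t)) \<longlongrightarrow> 0) (at t within {0..T})" if "t \<in> {0..T}" for t
    using u v that unfolding sobolev_curves_def by blast+
  let ?d = "\<lambda>t. sobolev_dist M s (u t) (v t)"
  have "\<exists>S B. open S \<and> t \<in> S \<and> (\<forall>\<tau>\<in>S \<inter> {0..T}. ?d \<tau> \<le> B)" if t: "t \<in> {0..T}" for t
  proof -
    have "\<forall>\<^sub>F \<tau> in at t within {0..T}. sobolev_dist M s (u \<tau>) (u t) < 1"
      "\<forall>\<^sub>F \<tau> in at t within {0..T}. sobolev_dist M s (v \<tau>) (v t) < 1"
      using order_tendstoD(2)[OF uc[OF t]] order_tendstoD(2)[OF vc[OF t]] by auto
    then have "\<forall>\<^sub>F \<tau> in at t within {0..T}. sobolev_dist M s (u \<tau>) (u t) < 1 \<and> sobolev_dist M s (v \<tau>) (v t) < 1"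
      by (rule eventually_conj)
    then obtain S where S: "open S" "t \<in> S"
      "\<And>\<tau>. \<tau> \<in> S \<Longrightarrow> \<tau> \<noteq> t \<Longrightarrow> \<tau> \<in> {0..T} \<Longrightarrow> sobolev_dist M s (u \<tau>) (u t) < 1 \<and> sobolev_dist M s (v \<tau>) (v t) < 1"
      unfolding eventually_at_topological by blast
    have "?d \<tau> \<le> 2 * (1 + 2 * (?d t + 1))" if \<tau>: "\<tau> \<in> S \<inter> {0..T}" for \<tau>
    proof (cases "\<tau> = t")
      case True
      then show ?thesis using sobolev_dist_nonneg[OF us[OF t] vs[OF t]] by simp
    next
      case False
      have \<tau>T: "\<tau> \<in> {0..T}" using \<tau> by simp
      have "?d \<tau> \<le> 2 * (sobolev_dist M s (u \<tau>) (u t) + sobolev_dist M s (u t) (v \<tau>))"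
        by (rule sobolev_quasi_triangle[OF us[OF \<tau>T] us[OF t] vs[OF \<tau>T]])
      also have "\<dots> \<le> 2 * (1 + 2 * (?d t + 1))"
      proof (rule mult_left_mono[OF add_mono])
        show "sobolev_dist M s (u \<tau>) (u t) \<le> 1" using S(3)[of \<tau>] False \<tau> by auto
        have "sobolev_dist M s (u t) (v \<tau>) \<le> 2 * (?d t + sobolev_dist M s (v t) (v \<tau>))"
          by (rule sobolev_quasi_triangle[OF us[OF t] vs[OF t] vs[OF \<tau>T]])
        also have "\<dots> \<le> 2 * (?d t + 1)"
          using S(3)[of \<tau>] False \<tau> sobolev_dist_commute[OF vs[OF t] vs[OF \<tau>T]] by auto
        finally show "sobolev_dist M s (u t) (v \<tau>) \<le> 2 * (?d t + 1)" .
      qed simp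
      finally show ?thesis .
    qed
    then show ?thesis using S(1,2) by blast
  qed
  then obtain S B where SB: "\<And>t. t \<in> {0..T} \<Longrightarrow> open (S t) \<and> t \<in> S t \<and> (\<forall>\<tau>\<in>S t \<inter> {0..T}. ?d \<tau> \<le> B t)"
    by metis
  obtain F where F: "F \<subseteq> {0..T}" "finite F" "{0..T} \<subseteq> (\<Union>t\<in>F. S t)"
    by (rule compactE_image[of "{0..T}" "{0..T}" S]) (use SB in auto)
  have "?d \<tau> \<le> (\<Sum>t\<in>F. \<bar>B t\<bar>)" if \<tau>: "\<tau> \<in> {0..T}" for \<tau>
  proof -
    obtain t where t: "t \<in> F" "\<tau> \<in> S t" using F(3) \<tau> by auto
    then have "?d \<tau> \<le> B t" using SB[of t] F(1) \<tau> by auto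
    also have "\<dots> \<le> \<bar>B t\<bar>" by simp
    also have "\<dots> \<le> (\<Sum>t\<in>F. \<bar>B t\<bar>)" by (rule member_le_sum) (use t F(2) in auto)
    finally show ?thesis .
  qed
  then have "bdd_above (?d ` {0..T})" by (intro bdd_aboveI2)
  from cSUP_upper[OF t this] show ?thesis by (simp add: curve_dist_def)
qed

lemma represented_increment:
  assumes r1: "represents M U1 u1" and r0: "represents M U0 u0"
    and T: "(\<lambda>x. of_real (f x)) \<in> test_fun M"
  shows "u1 (\<lambda>x. of_real (f x)) - u0 (\<lambda>x. of_real (f x)) =
    of_real (LINT x:fun_domain M|lborel. (U1 x - U0 x) * f x)"
proof -
  let ?\<phi> = "\<lambda>x. complex_of_real (f x)"
  note R1 = r1[unfolded represents_def, THEN conjunct2, THEN bspec, OF T]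
  note R0 = r0[unfolded represents_def, THEN conjunct2, THEN bspec, OF T]
  have 1: "set_integrable lborel (fun_domain M) (\<lambda>x. of_real (U1 x) * ?\<phi> x)"
    "u1 ?\<phi> = (LINT x:fun_domain M|lborel. of_real (U1 x) * ?\<phi> x)"
    by (rule R1[THEN conjunct1], rule R1[THEN conjunct2])
  have 0: "set_integrable lborel (fun_domain M) (\<lambda>x. of_real (U0 x) * ?\<phi> x)"
    "u0 ?\<phi> = (LINT x:fun_domain M|lborel. of_real (U0 x) * ?\<phi> x)"
    by (rule R0[THEN conjunct1], rule R0[THEN conjunct2])
  have "u1 ?\<phi> - u0 ?\<phi> = (LINT x:fun_domain M|lborel. of_real (U1 x) * ?\<phi> x - of_real (U0 x) * ?\<phi> x)"
    unfolding 1(2) 0(2) by (rule set_integral_diff(2)[OF 1(1) 0(1), symmetric])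
  also have "\<dots> = (LINT x:fun_domain M|lborel. complex_of_real ((U1 x - U0 x) * f x))"
    by (simp add: left_diff_distrib)
  also have "\<dots> = of_real (LINT x:fun_domain M|lborel. (U1 x - U0 x) * f x)"
    by (rule set_integral_complex_of_real)
  finally show ?thesis .
qed

text \<open>With \<open>t = K / \<mu>\<^sup>2\<close> the quadratic term \<open>t * (4 * \<mu>)\<^sup>2 / 2\<close> equals \<open>8 * K\<close>, and every
  other term is \<open>O(1 / \<mu>)\<close>.\<close>

lemma amplitude_choice:
  fixes K W L t\<^sub>0 :: real
  assumes K: "0 < K" and W: "0 \<le> W" and L: "0 \<le> L" and t0: "0 < t\<^sub>0"
  defines "B \<equiv> W + 8 * K + 1"
  shows "\<exists>\<mu>>0. K / \<mu>\<^sup>2 \<le> t\<^sub>0 \<and> W + K / \<mu>\<^sup>2 * ((B + 4 * \<mu>) + (B + 4 * \<mu>)\<^sup>2 / 2) < B \<and>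
    K / \<mu>\<^sup>2 * (B + 4 * \<mu> + B\<^sup>2 / 2 + B * (4 * \<mu>)) * L \<le> 1"
proof -
  define q where "q = B + 4 + B\<^sup>2 / 2 + 4 * B"
  have B: "0 < B" using K W by (simp add: B_def)
  have q: "0 < q" using B by (simp add: q_def add_pos_nonneg)
  \<comment> \<open>For \<open>\<mu> \<ge> 1\<close> the lower-order terms are at most \<open>q * \<mu>\<close>; each summand meets one of the three requirements.\<close>
  define \<mu> where "\<mu> = 1 + (K * q + K * q * L + K / t\<^sub>0)"
  have KqL: "0 < K * q" "0 \<le> K * q * L" "0 < K / t\<^sub>0" using K q L t0 by auto
  have \<mu>: "1 \<le> \<mu>" "K * q < \<mu>" "K * q * L \<le> \<mu>" "K / t\<^sub>0 \<le> \<mu>" using KqL unfolding \<mu>_def by linarith+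
  have \<mu>0: "0 < \<mu>" using \<mu>(1) by linarith
  have sq: "\<mu> \<le> \<mu>\<^sup>2" using \<mu>(1) by (simp add: power2_eq_square)
  have lin: "B + 4 * \<mu> + B\<^sup>2 / 2 + B * (4 * \<mu>) \<le> q * \<mu>"
  proof -
    have "B \<le> B * \<mu>" "B\<^sup>2 / 2 \<le> B\<^sup>2 / 2 * \<mu>" using B \<mu>(1) by simp_all
    then show ?thesis unfolding q_def by (simp add: algebra_simps)
  qed
  have frac: "K / \<mu>\<^sup>2 * (q * \<mu>) = K * q / \<mu>" using \<mu>0 by (simp add: power2_eq_square)
  have step: "K / \<mu>\<^sup>2 * (B + 4 * \<mu> + B\<^sup>2 / 2 + B * (4 * \<mu>)) \<le> K * q / \<mu>"
    unfolding frac[symmetric] by (rule mult_left_mono[OF lin]) (use K in simp)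
  have "K / \<mu>\<^sup>2 \<le> t\<^sub>0"
  proof -
    have "K / \<mu>\<^sup>2 \<le> K / \<mu>" using sq \<mu>0 K by (intro divide_left_mono) auto
    also have "\<dots> \<le> t\<^sub>0" using \<mu>(4) t0 \<mu>0 by (simp add: field_simps)
    finally show ?thesis .
  qed
  moreover have "W + K / \<mu>\<^sup>2 * ((B + 4 * \<mu>) + (B + 4 * \<mu>)\<^sup>2 / 2) < B"
  proof -
    have "(B + 4 * \<mu>) + (B + 4 * \<mu>)\<^sup>2 / 2 = (B + 4 * \<mu> + B\<^sup>2 / 2 + B * (4 * \<mu>)) + 8 * \<mu>\<^sup>2"
      by (simp add: power2_eq_square field_simps)
    then have "K / \<mu>\<^sup>2 * ((B + 4 * \<mu>) + (B + 4 * \<mu>)\<^sup>2 / 2) =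
        K / \<mu>\<^sup>2 * (B + 4 * \<mu> + B\<^sup>2 / 2 + B * (4 * \<mu>)) + 8 * K"
      using \<mu>0 by (simp add: distrib_left)
    also have "\<dots> \<le> K * q / \<mu> + 8 * K" using step by simp
    also have "K * q / \<mu> < 1" using \<mu>(2) \<mu>0 by simp
    finally show ?thesis by (simp add: B_def)
  qed
  moreover have "K / \<mu>\<^sup>2 * (B + 4 * \<mu> + B\<^sup>2 / 2 + B * (4 * \<mu>)) * L \<le> 1"
  proof -
    have "K / \<mu>\<^sup>2 * (B + 4 * \<mu> + B\<^sup>2 / 2 + B * (4 * \<mu>)) * L \<le> K * q / \<mu> * L"
      by (rule mult_right_mono[OF step L])
    also have "\<dots> \<le> 1" using \<mu>(3) \<mu>0 by simp
    finally show ?thesis .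
  qed
  ultimately show ?thesis using \<mu>0 by blast
qed

lemma sobolev_pairing_bound:
  assumes u: "u \<in> sobolev M s" and v: "v \<in> sobolev M s" and k: "weighted_L2 M (- s) k"
    and \<phi>: "\<And>u g. Defs.real_distribution M u \<Longrightarrow> has_transform M u g \<Longrightarrow> u \<phi> = (LINT \<xi>|freq_measure M. g \<xi> * k \<xi>)"
  shows "cmod (u \<phi> - v \<phi>) \<le> weighted_norm M (- s) k * sobolev_dist M s u v"
proof -
  obtain g h where g: "has_transform M u g" "weighted_L2 M s g" "Defs.real_distribution M u"
    and h: "has_transform M v h" "weighted_L2 M s h" "Defs.real_distribution M v"
    using u v by (auto simp: sobolev_iff_transform)
  have "u \<phi> - v \<phi> = (LINT \<xi>|freq_measure M. g \<xi> * k \<xi> - h \<xi> * k \<xi>)"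
    unfolding \<phi>[OF g(3,1)] \<phi>[OF h(3,1)]
    by (rule Bochner_Integration.integral_diff[symmetric, OF weighted_pairing(1)[OF g(2) k] weighted_pairing(1)[OF h(2) k]])
  also have "\<dots> = (LINT \<xi>|freq_measure M. (g \<xi> - h \<xi>) * k \<xi>)" by (simp add: left_diff_distrib)
  also have "cmod \<dots> \<le> (LINT \<xi>|freq_measure M. cmod ((g \<xi> - h \<xi>) * k \<xi>))" by (rule integral_norm_bound)
  also have "\<dots> \<le> weighted_norm M s (\<lambda>\<xi>. g \<xi> - h \<xi>) * weighted_norm M (- s) k"
    by (rule weighted_pairing(2)[OF weighted_L2_diff(1)[OF g(2) h(2)] k])
  finally show ?thesis unfolding sobolev_dist_transform[OF g(1,2) h(1,2)] by (simp add: mult.commute)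
qed

theorem corollary1p8:
  fixes M :: domain and s T :: real
    and \<Phi> :: "dist_fun \<Rightarrow> real \<Rightarrow> dist_fun"
  assumes "s < 0" and "T > 0"
    and "\<forall>u\<^sub>0\<in>sobolev M s. \<Phi> u\<^sub>0 \<in> sobolev_curves M s T"
    and "\<forall>u\<^sub>0\<in>smooth_data M. bbm_smooth_solution M T u\<^sub>0 (\<Phi> u\<^sub>0)"
  shows "\<forall>u\<^sub>0\<in>sobolev M s.
    \<not> (\<forall>\<epsilon>>0. \<exists>\<delta>>0. \<forall>v\<in>sobolev M s.
          sobolev_dist M s v u\<^sub>0 < \<delta> \<longrightarrow> curve_dist M s T (\<Phi> v) (\<Phi> u\<^sub>0) < \<epsilon>)"
proof (intro ballI notI)
  fix u\<^sub>0 assume u0: "u\<^sub>0 \<in> sobolev M s"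
    and "\<forall>\<epsilon>>0. \<exists>\<delta>>0. \<forall>v\<in>sobolev M s.
          sobolev_dist M s v u\<^sub>0 < \<delta> \<longrightarrow> curve_dist M s T (\<Phi> v) (\<Phi> u\<^sub>0) < \<epsilon>"
  then obtain \<delta> where \<delta>: "\<delta> > 0"
    and close: "\<And>v. v \<in> sobolev M s \<Longrightarrow> sobolev_dist M s v u\<^sub>0 < \<delta> \<Longrightarrow> curve_dist M s T (\<Phi> v) (\<Phi> u\<^sub>0) < 1"
    using zero_less_one by blast
  obtain \<psi> \<psi>1 \<psi>2 c k where res: "resonant_test M \<psi> \<psi>1 \<psi>2 c k"
    using resonant_test_Real_Line resonant_test_Torus by (cases M) blast+
  then have flux: "flux_test M \<psi> \<psi>1 \<psi>2" and c: "c > 0"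
    and \<phi>T: "(\<lambda>x. of_real (\<psi> x - \<psi>2 x)) \<in> test_fun M" and kw: "\<And>\<sigma>. weighted_L2 M \<sigma> k"
    and pair: "\<And>u g. Defs.real_distribution M u \<Longrightarrow> has_transform M u g \<Longrightarrow>
        u (\<lambda>x. of_real (\<psi> x - \<psi>2 x)) = (LINT \<xi>|freq_measure M. g \<xi> * k \<xi>)"
    and reson: "\<And>N h. N \<ge> 1 \<Longrightarrow> (\<And>x. of_real (h x) = synth M (band_wave 1 N) x) \<Longrightarrow>
        c \<le> (LINT x:fun_domain M|lborel. (h x)\<^sup>2 * \<psi>1 x)"
    unfolding resonant_test_def by blast+
  let ?\<phi> = "\<lambda>x. complex_of_real (\<psi> x - \<psi>2 x)"
  define Ck where "Ck = weighted_norm M (- s) k"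
  have Ck0: "0 \<le> Ck" by (simp add: Ck_def)
  have dual: "cmod (u ?\<phi> - v ?\<phi>) \<le> Ck * sobolev_dist M s u v" if "u \<in> sobolev M s" "v \<in> sobolev M s" for u v
    unfolding Ck_def by (rule sobolev_pairing_bound[OF that kw pair])

  \<comment> \<open>The time \<open>t\<^sub>0\<close> depends only on the curve of \<open>u\<^sub>0\<close>, not on the perturbed data chosen below.\<close>
  have \<Phi>u0: "\<Phi> u\<^sub>0 \<in> sobolev_curves M s T" using assms(3) u0 by blast
  have 0: "0 \<in> {0..T}" using assms(2) by simp
  have \<Phi>s: "\<Phi> u\<^sub>0 t \<in> sobolev M s" if "t \<in> {0..T}" for t using \<Phi>u0 that unfolding sobolev_curves_def by blast
  have "((\<lambda>\<tau>. sobolev_dist M s (\<Phi> u\<^sub>0 \<tau>) (\<Phi> u\<^sub>0 0)) \<longlongrightarrow> 0) (at 0 within {0..T})"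
    using \<Phi>u0 0 unfolding sobolev_curves_def by blast
  then have "\<forall>\<^sub>F \<tau> in at 0 within {0..T}. sobolev_dist M s (\<Phi> u\<^sub>0 \<tau>) (\<Phi> u\<^sub>0 0) < 1"
    by (rule order_tendstoD(2)) simp
  then obtain r where r: "r > 0" "\<And>\<tau>. \<tau> \<in> {0..T} \<Longrightarrow> \<tau> \<noteq> 0 \<Longrightarrow> \<bar>\<tau>\<bar> < r \<Longrightarrow> sobolev_dist M s (\<Phi> u\<^sub>0 \<tau>) (\<Phi> u\<^sub>0 0) < 1"
    unfolding eventually_at by (auto simp: dist_real_def)
  define t\<^sub>0 where "t\<^sub>0 = min T (r / 2)"
  have t0: "0 < t\<^sub>0" "t\<^sub>0 \<le> T" "t\<^sub>0 < r" using assms(2) r(1) by (auto simp: t\<^sub>0_def)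

  \<comment> \<open>The smooth part \<open>gw\<close> of the data is fixed before the amplitude \<open>\<mu>\<close>, which depends on its size \<open>W\<close>.\<close>
  obtain g\<^sub>0 where g0: "has_transform M u\<^sub>0 g\<^sub>0" "weighted_L2 M s g\<^sub>0" "Defs.real_distribution M u\<^sub>0"
    using u0 by (auto simp: sobolev_iff_transform)
  obtain n :: nat where n: "weighted_L2 M s (\<lambda>\<xi>. indicator {- real n..real n} \<xi> * g\<^sub>0 \<xi>)"
      "weighted_norm M s (\<lambda>\<xi>. indicator {- real n..real n} \<xi> * g\<^sub>0 \<xi> - g\<^sub>0 \<xi>) < \<delta> / 4"
    using weighted_norm_truncation[OF g0(2), of "\<delta> / 4"] \<delta> by auto
  define gw where "gw \<xi> = indicator {- real n..real n} \<xi> * g\<^sub>0 \<xi>" for \<xi>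
  have gw: "weighted_L2 M \<sigma> gw" for \<sigma>
    unfolding gw_def by (rule weighted_L2_cutoff_smooth[OF n(1), of "real n"]) (auto simp: indicator_def)
  have gw_sym: "AE \<xi> in freq_measure M. gw (- \<xi>) = cnj (gw \<xi>)"
    using transform_conjugate_symmetric[OF g0(3,1)]
    by eventually_elim (auto simp: gw_def indicator_def)
  have gwi: "integrable (freq_measure M) gw" by (rule weighted_L2_integrable[OF gw])
  define W where "W = synth_const M * (LINT \<xi>|freq_measure M. cmod (gw \<xi>))"
  have W: "cmod (synth M gw x) \<le> W" for x
    using spectral_bound[of "freq_measure M" gw x] synth_const_pos[of M]
    by (simp add: synth_def W_def norm_mult)
  have W0: "0 \<le> W" using W[of 0] norm_ge_zero order_trans by blast

  define L where "L = (LINT x:fun_domain M|lborel. \<bar>\<psi>1 x\<bar>)"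
  have L0: "0 \<le> L" unfolding L_def set_lebesgue_integral_def by simp
  \<comment> \<open>Closeness to the curve of \<open>u\<^sub>0\<close> will bound the displacement by \<open>3 * Ck\<close>; the resonance produces
    at least \<open>K * c / 2 - 1\<close>.\<close>
  define K where "K = 2 * (3 * Ck + 2) / c"
  have K: "0 < K" using Ck0 c by (simp add: K_def)
  define B where "B = W + 8 * K + 1"
  obtain \<mu> where \<mu>: "\<mu> > 0" "K / \<mu>\<^sup>2 \<le> t\<^sub>0" "W + K / \<mu>\<^sup>2 * ((B + 4 * \<mu>) + (B + 4 * \<mu>)\<^sup>2 / 2) < B"
    "K / \<mu>\<^sup>2 * (B + 4 * \<mu> + B\<^sup>2 / 2 + B * (4 * \<mu>)) * L \<le> 1"
    using amplitude_choice[OF K W0 L0 t0(1)] unfolding B_def by blast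
  obtain N where N: "N \<ge> 1" "weighted_norm M s (band_wave \<mu> N) < \<delta> / 4"
    using band_wave_small[OF assms(1), of "\<delta> / 4"] \<delta> by auto

  define gv where "gv \<xi> = gw \<xi> - band_wave \<mu> N \<xi>" for \<xi>
  have gv: "weighted_L2 M \<sigma> gv" for \<sigma> unfolding gv_def by (rule weighted_L2_diff(1)[OF gw band_wave_weighted_L2[OF N(1)]])
  have gv_sym: "AE \<xi> in freq_measure M. gv (- \<xi>) = cnj (gv \<xi>)"
    using gw_sym by eventually_elim (simp add: gv_def band_wave_even)
  obtain v where v: "v \<in> smooth_data M" "has_transform M v gv"
    using smooth_data_of_transform[OF _ gv gv_sym] gv[of 0] by (auto simp: weighted_L2_def)
  have vs: "v \<in> sobolev M s" using v(1) by (auto simp: smooth_data_def)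
  have "sobolev_dist M s v u\<^sub>0 = weighted_norm M s (\<lambda>\<xi>. (gw \<xi> - g\<^sub>0 \<xi>) - band_wave \<mu> N \<xi>)"
    unfolding sobolev_dist_transform[OF v(2) gv g0(1,2)] by (simp add: gv_def algebra_simps)
  also have "\<dots> \<le> 2 * (weighted_norm M s (\<lambda>\<xi>. gw \<xi> - g\<^sub>0 \<xi>) + weighted_norm M s (band_wave \<mu> N))"
    by (rule weighted_L2_diff(2)[OF weighted_L2_diff(1)[OF gw g0(2)] band_wave_weighted_L2[OF N(1)]])
  also have "\<dots> < 2 * (\<delta> / 4 + \<delta> / 4)"
    using n(2) N(2) by (intro mult_strict_left_mono add_strict_mono) (simp_all add: gw_def)
  finally have "sobolev_dist M s v u\<^sub>0 < \<delta>" by simp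
  from close[OF vs this] have cd: "curve_dist M s T (\<Phi> v) (\<Phi> u\<^sub>0) < 1" .
  have \<Phi>v: "\<Phi> v \<in> sobolev_curves M s T" using assms(3) vs by blast
  have \<Phi>vs: "\<Phi> v t \<in> sobolev M s" if "t \<in> {0..T}" for t using \<Phi>v that unfolding sobolev_curves_def by blast
  have dist1: "sobolev_dist M s (\<Phi> v t) (\<Phi> u\<^sub>0 t) \<le> 1" if "t \<in> {0..T}" for t
    using curve_dist_upper[OF \<Phi>v \<Phi>u0 that] cd by linarith
  obtain U where sol: "\<Phi> v \<in> (\<Inter>\<sigma>. sobolev_curves M \<sigma> T)" "\<Phi> v 0 = v"
    and rep: "\<And>t. t \<in> {0..T} \<Longrightarrow> represents M (U t) (\<Phi> v t)" and bbm: "bbm_classical T U"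
    using assms(4) v(1) unfolding bbm_smooth_solution_def by blast
  have sm: "smooth_fun (U t)" if "t \<in> {0..T}" for t using bbm that by (auto simp: bbm_classical_def)
  have curve: "sup_norm_curve T U" and curve': "sup_norm_curve T (\<lambda>t. D_x (U t))"
    using smooth_curve_sup_norm[OF sol(1) rep sm] by blast+
  have per: "\<forall>\<tau>\<in>{0..T}. \<forall>x. U \<tau> (x + 2 * pi) = U \<tau> x" if "M = Torus"
    using rep that by (auto simp: represents_def)

  \<comment> \<open>The wave is subtracted in its initial position; its own motion is part of the terms \<open>O(\<mu>)\<close> of the flux.\<close>
  define h1 where "h1 x = Re (synth M (band_wave 1 N) x)" for x
  define h where "h x = - (\<mu> * h1 x)" for x
  have bi: "integrable (freq_measure M) (band_wave \<mu> N)" for \<mu> by (rule weighted_L2_integrable[OF band_wave_weighted_L2[OF N(1)]])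
  have h1: "of_real (h1 x) = synth M (band_wave 1 N) x" for x
    unfolding h1_def by (rule synth_real[OF bi]) (simp add: band_wave_even)
  have wave: "synth M (band_wave \<mu> N) x = of_real (\<mu> * h1 x)" for x
  proof -
    have "synth M (band_wave \<mu> N) x = of_real \<mu> * synth M (band_wave 1 N) x"
      unfolding synth_def spectral_def integral_mult_right_zero[symmetric] band_wave_def by (simp add: mult_ac)
    then show ?thesis by (simp add: h1)
  qed
  have h_bound: "\<bar>h x\<bar> \<le> 4 * \<mu>" for x
    using band_wave_synth_bound[OF N(1), of M \<mu> x] \<mu>(1) unfolding wave norm_of_real by (simp add: h_def)
  have hc: "continuous_on UNIV h"
    unfolding h_def h1_def synth_def by (intro continuous_intros spectral_continuous bi) simp
  have U0: "U 0 x - h x = Re (synth M gw x)" for x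
  proof -
    have "(U 0 has_vector_derivative D_x (U 0) x) (at x)" for x
      using smooth_fun_has_derivative[OF sm[OF 0], of 0 x] by simp
    then have "continuous_on UNIV (U 0)"
      by (intro continuous_at_imp_continuous_on) (auto dest: has_vector_derivative_continuous)
    from representation_by_synthesis[OF rep[OF 0] this _ weighted_L2_integrable[OF gv]] v(2) sol(2)
    have "of_real (U 0 x) = synth M gv x" by simp
    also have "\<dots> = synth M gw x - synth M (band_wave \<mu> N) x" unfolding gv_def by (rule synth_diff[OF gwi bi])
    finally have "Re (of_real (U 0 x)) = Re (synth M gw x - of_real (\<mu> * h1 x))" unfolding wave by simp
    then show ?thesis by (simp add: h_def)
  qed
  have U0W: "\<bar>U 0 x - h x\<bar> \<le> W" for x
    unfolding U0 using abs_Re_le_cmod[of "synth M gw x"] W[of x] by linarith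

  define t where "t = K / \<mu>\<^sup>2"
  have tpos: "0 < t" using K \<mu>(1) by (simp add: t_def)
  have tt0: "t \<le> t\<^sub>0" using \<mu>(2) by (simp add: t_def)
  have t: "t \<in> {0..T}" using tpos tt0 t0(2) by auto
  have B0: "0 \<le> B" using W0 K by (simp add: B_def)
  have z: "\<bar>U \<tau> x - h x\<bar> \<le> B" if "\<tau> \<in> {0..t}" for \<tau> x
    by (rule bbm_bootstrap[OF bbm curve curve' t h_bound U0W B0 _ that]) (use \<mu>(3) in \<open>simp add: t_def\<close>)
  define P where "P = (LINT x:fun_domain M|lborel. (U t x - U 0 x) * (\<psi> x - \<psi>2 x))"
  define Q where "Q = (LINT x:fun_domain M|lborel. (h x)\<^sup>2 * \<psi>1 x)"
  have growth: "\<bar>P - t / 2 * Q\<bar> \<le> t * (B + 4 * \<mu> + B\<^sup>2 / 2 + B * (4 * \<mu>)) * L"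
    unfolding P_def Q_def L_def
    by (rule bbm_pairing_growth[OF bbm curve curve' t per flux h_bound continuous_on_UNIV_borel[OF hc] z])
  have "\<mu>\<^sup>2 * c \<le> Q"
  proof -
    have "Q = \<mu>\<^sup>2 * (LINT x:fun_domain M|lborel. (h1 x)\<^sup>2 * \<psi>1 x)"
      unfolding Q_def h_def by (simp add: power_mult_distrib mult.assoc)
    moreover have "\<mu>\<^sup>2 * c \<le> \<mu>\<^sup>2 * (LINT x:fun_domain M|lborel. (h1 x)\<^sup>2 * \<psi>1 x)"
      by (rule mult_left_mono[OF reson[OF N(1) h1]]) simp
    ultimately show ?thesis by simp
  qed
  then have "t / 2 * (\<mu>\<^sup>2 * c) \<le> t / 2 * Q" using tpos by (intro mult_left_mono) auto
  moreover have "t / 2 * (\<mu>\<^sup>2 * c) = 3 * Ck + 2" using \<mu>(1) c by (simp add: t_def K_def)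
  moreover have "\<bar>P - t / 2 * Q\<bar> \<le> 1" using growth \<mu>(4) unfolding t_def by linarith
  ultimately have P: "3 * Ck + 1 \<le> P" unfolding abs_le_iff by linarith

  \<comment> \<open>The curves of \<open>v\<close> and \<open>u\<^sub>0\<close> are within distance \<open>1\<close> at both times, and that of \<open>u\<^sub>0\<close> moves by at most \<open>1\<close>.\<close>
  have "\<bar>t\<bar> < r" using tpos tt0 t0(3) by simp
  then have d2: "sobolev_dist M s (\<Phi> u\<^sub>0 t) (\<Phi> u\<^sub>0 0) \<le> 1" using r(2)[OF t] tpos by simp
  have "of_real P = \<Phi> v t ?\<phi> - \<Phi> v 0 ?\<phi>"
    unfolding P_def by (rule represented_increment[OF rep[OF t] rep[OF 0] \<phi>T, symmetric])
  also have "\<dots> = (\<Phi> v t ?\<phi> - \<Phi> u\<^sub>0 t ?\<phi>) + ((\<Phi> u\<^sub>0 t ?\<phi> - \<Phi> u\<^sub>0 0 ?\<phi>) + (\<Phi> u\<^sub>0 0 ?\<phi> - \<Phi> v 0 ?\<phi>))"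
    by simp
  finally have "\<bar>P\<bar> = cmod \<dots>" by (metis norm_of_real)
  also have "\<dots> \<le> Ck * 1 + (Ck * 1 + Ck * 1)"
  proof (intro norm_triangle_le add_mono)
    show "cmod (\<Phi> v t ?\<phi> - \<Phi> u\<^sub>0 t ?\<phi>) \<le> Ck * 1"
      by (rule order_trans[OF dual[OF \<Phi>vs[OF t] \<Phi>s[OF t]] mult_left_mono[OF dist1[OF t] Ck0]])
    show "cmod (\<Phi> u\<^sub>0 t ?\<phi> - \<Phi> u\<^sub>0 0 ?\<phi>) \<le> Ck * 1"
      by (rule order_trans[OF dual[OF \<Phi>s[OF t] \<Phi>s[OF 0]] mult_left_mono[OF d2 Ck0]])
    show "cmod (\<Phi> u\<^sub>0 0 ?\<phi> - \<Phi> v 0 ?\<phi>) \<le> Ck * 1"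
      unfolding norm_minus_commute[of "\<Phi> u\<^sub>0 0 ?\<phi>"]
      by (rule order_trans[OF dual[OF \<Phi>vs[OF 0] \<Phi>s[OF 0]] mult_left_mono[OF dist1[OF 0] Ck0]])
  qed
  finally have "P \<le> 3 * Ck" by simp
  with P show False by linarith
qed

end
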